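(* Let $U$ be an open disk, and let $\mathcal{I}(U)\subset\mathcal{M}$ denote the set of those $S\in\mathcal{M}$ such that $U\rightsquigarrow S$. For $S\in\mathcal{I}(U)$, let $\iota_S:U\rightsquigarrow S$ be the associated (unique) immersion. Then the map $$I_U:\mathcal{I}(U)\times U\to\mathcal{E};\quad (S,u)\mapsto\iota_S(u)$$ is continuous, where $\mathcal{M}$ and $\mathcal{E}$ carry the immersive topologies and $\mathcal{I}(U)\times U$ has the product topology (with $\mathcal{I}(U)$ having the subspace topology).
   Context: Surfaces and translation structures. A surface is a connected oriented 2-manifold without boundary (possibly non-compact). A translation atlas on a surface $X$ is a collection of pairs $(U_j,\phi_j)$ with the $U_j$ open and covering $X$, and $\phi_j:U_j\to\mathbb{R}^2$ orientation preserving local homeomorphisms, such that on overlaps $U_i\cap U_j$ the transition functions $\phi_i\circ\phi_j^{-1}$ are locally restrictions of translations (i.e. $\phi_i-\phi_j$ is locally constant on $U_i\cap U_j$). A translation structure is a pair $(X,\mathcal{A})$ with $\mathcal{A}$ a maximal translation atlas on $X$. A pointed translation structure is $(X,x_0,\mathcal{A})$ with basepoint $x_0\in X$. An isomorphism $(X,x_0,\mathcal{A})\to(Y,y_0,\mathcal{B})$ is a homeomorphism $h:X\to Y$ with $h(x_0)=y_0$ and $\mathcal{B}=\{(h(U),\phi\circ h^{-1}):(U,\phi)\in\mathcal{A}\}$. The spaces. $\mathcal{M}$ is the set of all isomorphism classes $[X,x_0,\mathcal{A}]$. $\mathcal{E}$ is the set of isomorphism classes $[X,x_0,\mathcal{A};x]$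 of pointed translation structures with an additional point $x\in X$ (isomorphisms must also carry the additional point to the additional point). The projection $\pi:\mathcal{E}\to\mathcal{M}$ forgets $x$. The fiber of $\pi$ over $[X,x_0,\mathcal{A}]$ is in canonical bijection with $X$ via $x\mapsto[X,x_0,\mathcal{A};x]$ and thus is itself a translation surface $S$ isomorphic to $(X,x_0,\mathcal{A})$, with basepoint denoted $o_S$. One identifies a point of $\mathcal{M}$ with the translation surface $S$ above it; points $s\in S$ are points of $\mathcal{E}$, also written as pairs $(S,s)$. Immersions. $PC(S)$ is the collection of path-connected subsets of $S$ containing $o_S$. For $A\in PC(S)$ and $B\subset T$ (with $S,T$ translation surfaces), an immersion of $A$ into $B$ is a continuous map $\iota:A\to B$ with $\iota(o_S)=o_T$ such that each $s\in A$ has a chart $(U,\phi)$ of $S$ with $s\in U$, a chart $(V,\psi)$ of $T$, and a vector $v\in\mathbb{R}^2$ with $\iota(U\cap A)\subset V$ and $\psi\circ\iota(s')=v+\phi(s')$ for all $s'\in U\cap A$ (charts from the maximal atlases). Immersions are unique when they exist. Write $A\rightsquigarrow B$ if an immersion exists and $A\not\rightsquigarrow B$ otherwise. Disks. An open disk is a path-connected subset of a translation surface, containing the basepoint, homeomorphic to an open disk. A closed disk is a subset of a translation surface homeomorphic to a closed disk and containing the basepoint in its interior; $D^\circ$ denotes the interior of $D$. Immersive topology on $\mathcal{M}$: the coarsest topology in which all the following sets are open: $\{S: D\rightsquigarrow S\}$ for $D$ a closed disk; $\{S: U\not\rightsquigarrow S\}$ for $U$ an open disk; $\mathcal{M}_+(D,U)=\{S:\exists\,\iota:D\rightsquigarrow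 S\text{ and }o_S\in\iota(U)\}$ for $D$ a closed disk and $U\subset D^\circ$ open; $\mathcal{M}_-(D,K)=\{S:\exists\,\iota:D\rightsquigarrow S\text{ and }o_S\notin\iota(K)\}$ for $D$ a closed disk and $K\subset D$ closed. Immersive topology on $\mathcal{E}$: the coarsest topology such that $\pi:\mathcal{E}\to\mathcal{M}$ is continuous and $\mathcal{E}_+(D,U)=\{(S,s):\exists\,\iota:D\rightsquigarrow S\text{ and }s\in\iota(U)\}$ is open for every closed disk $D$ and open $U\subset D^\circ$. *)

theory Defs
  imports "HOL-Analysis.Analysis" "HOL-Complex_Analysis.Winding_Numbers"
begin

section \<open>Oriented surfaces\<close>

definition complex_of_plane :: "real^2 \<Rightarrow> complex"
  where "complex_of_plane p = Complex (p $ 1) (p $ 2)"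

definition plane_of_complex :: "complex \<Rightarrow> real^2"
  where "plane_of_complex z = vector [Re z, Im z]"

text \<open>A local homeomorphism between open subsets of the plane preserves orientation iff it has
  local degree 1 at each point; the local degree is the winding number of the image of a small
  positively oriented circle.\<close>

definition orientation_preserving_on :: "(real^2) set \<Rightarrow> (real^2 \<Rightarrow> real^2) \<Rightarrow> bool"
  where "orientation_preserving_on W f \<longleftrightarrow>
    (\<forall>p\<in>W. \<forall>\<^sub>F r in at_right 0.
       winding_number
         (complex_of_plane \<circ> f \<circ> plane_of_complex \<circ> circlepath (complex_of_plane p) r)
         (complex_of_plane (f p)) = 1)"

text \<open>An orientation of a topological 2-manifold is given by an oriented atlas, which need not be
  maximal here.\<close>

definition oriented_atlas :: "'a topology \<Rightarrow> ('a set \<times> ('a \<Rightarrow> real^2)) set \<Rightarrow> bool"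
  where "oriented_atlas X \<Omega> \<longleftrightarrow>
    (\<forall>(V, \<psi>)\<in>\<Omega>. openin X V \<and> open (\<psi> ` V) \<and>
       homeomorphic_map (subtopology X V) (top_of_set (\<psi> ` V)) \<psi>) \<and>
    (\<Union>(V, \<psi>)\<in>\<Omega>. V) = topspace X \<and>
    (\<forall>(V, \<psi>)\<in>\<Omega>. \<forall>(V', \<psi>')\<in>\<Omega>.
       orientation_preserving_on (\<psi> ` (V \<inter> V')) (\<psi>' \<circ> inv_into V \<psi>))"

definition second_countable_space :: "'a topology \<Rightarrow> bool"
  where "second_countable_space X \<longleftrightarrow>
    (\<exists>\<B>. countable \<B> \<and> (\<forall>B\<in>\<B>. openin X B) \<and>
       (\<forall>V x. openin X V \<and> x \<in> V \<longrightarrow> (\<exists>B\<in>\<B>. x \<in> B \<and> B \<subseteq> V)))"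

definition oriented_surface :: "'a topology \<Rightarrow> ('a set \<times> ('a \<Rightarrow> real^2)) set \<Rightarrow> bool"
  where "oriented_surface X \<Omega> \<longleftrightarrow>
    connected_space X \<and> Hausdorff_space X \<and> second_countable_space X \<and> oriented_atlas X \<Omega>"

section \<open>Translation structures\<close>

definition local_homeomorphism_on :: "'a topology \<Rightarrow> 'a set \<Rightarrow> ('a \<Rightarrow> real^2) \<Rightarrow> bool"
  where "local_homeomorphism_on X U \<phi> \<longleftrightarrow>
    (\<forall>x\<in>U. \<exists>V. openin X V \<and> x \<in> V \<and> V \<subseteq> U \<and> open (\<phi> ` V) \<and>
       homeomorphic_map (subtopology X V) (top_of_set (\<phi> ` V)) \<phi>)"

text \<open>Charts are only local homeomorphisms, not necessarily injective. A chart is a function on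
  its domain \<open>U\<close>, hence extensional, so that equality of atlases has the intended meaning.\<close>

definition translation_atlas ::
  "'a topology \<Rightarrow> ('a set \<times> ('a \<Rightarrow> real^2)) set \<Rightarrow> ('a set \<times> ('a \<Rightarrow> real^2)) set \<Rightarrow> bool"
  where "translation_atlas X \<Omega> A \<longleftrightarrow>
    (\<forall>(U, \<phi>)\<in>A. openin X U \<and> \<phi> \<in> extensional U \<and> local_homeomorphism_on X U \<phi> \<and>
       (\<forall>(V, \<psi>)\<in>\<Omega>. orientation_preserving_on (\<psi> ` (U \<inter> V)) (\<phi> \<circ> inv_into V \<psi>))) \<and>
    (\<Union>(U, \<phi>)\<in>A. U) = topspace X \<and>
    (\<forall>(U, \<phi>)\<in>A. \<forall>(V, \<psi>)\<in>A. \<forall>x\<in>U \<inter> V.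
       \<exists>W. openin X W \<and> x \<in> W \<and> W \<subseteq> U \<inter> V \<and> (\<forall>y\<in>W. \<phi> y - \<psi> y = \<phi> x - \<psi> x))"

definition maximal_translation_atlas ::
  "'a topology \<Rightarrow> ('a set \<times> ('a \<Rightarrow> real^2)) set \<Rightarrow> ('a set \<times> ('a \<Rightarrow> real^2)) set \<Rightarrow> bool"
  where "maximal_translation_atlas X \<Omega> A \<longleftrightarrow>
    translation_atlas X \<Omega> A \<and> (\<forall>A'. translation_atlas X \<Omega> A' \<and> A \<subseteq> A' \<longrightarrow> A' = A)"

text \<open>The orientation of the surface is not a separate component: the requirement that the charts
  of a translation atlas preserve orientation determines it.\<close>

definition translation_structure :: "'a topology \<Rightarrow> ('a set \<times> ('a \<Rightarrow> real^2)) set \<Rightarrow> bool"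
  where "translation_structure X A \<longleftrightarrow>
    (\<exists>\<Omega>. oriented_surface X \<Omega> \<and> maximal_translation_atlas X \<Omega> A)"

record 'a pointed_surface =
  surface_top :: "'a topology"
  basepoint :: 'a
  atlas :: "('a set \<times> ('a \<Rightarrow> real^2)) set"

abbreviation points :: "'a pointed_surface \<Rightarrow> 'a set"
  where "points P \<equiv> topspace (surface_top P)"

definition pointed_translation_structure :: "'a pointed_surface \<Rightarrow> bool"
  where "pointed_translation_structure P \<longleftrightarrow>
    translation_structure (surface_top P) (atlas P) \<and> basepoint P \<in> points P"

definition push_atlas ::
  "'a set \<Rightarrow> ('a \<Rightarrow> 'b) \<Rightarrow> ('a set \<times> ('a \<Rightarrow> real^2)) set \<Rightarrow> ('b set \<times> ('b \<Rightarrow> real^2)) set"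
  where "push_atlas X h A = (\<lambda>(U, \<phi>). (h ` U, restrict (\<phi> \<circ> inv_into X h) (h ` U))) ` A"

definition isomorphism :: "'a pointed_surface \<Rightarrow> 'b pointed_surface \<Rightarrow> ('a \<Rightarrow> 'b) \<Rightarrow> bool"
  where "isomorphism P Q h \<longleftrightarrow>
    homeomorphic_map (surface_top P) (surface_top Q) h \<and>
    h (basepoint P) = basepoint Q \<and>
    atlas Q = push_atlas (points P) h (atlas P)"

section \<open>The sets of isomorphism classes\<close>

text \<open>Isomorphism classes are formed among structures whose points are real numbers. As a surface
  has the cardinality of the continuum, every pointed translation structure is isomorphic to one
  of these.\<close>

type_synonym moduli_point = "real pointed_surface set"
type_synonym universal_point = "(real pointed_surface \<times> real) set"

definition iso_class :: "real pointed_surface \<Rightarrow> moduli_point"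
  where "iso_class P = {Q. pointed_translation_structure Q \<and> (\<exists>h. isomorphism P Q h)}"

definition iso_class_point :: "real pointed_surface \<Rightarrow> real \<Rightarrow> universal_point"
  where "iso_class_point P x =
    {(Q, y). pointed_translation_structure Q \<and> y \<in> points Q \<and> (\<exists>h. isomorphism P Q h \<and> h x = y)}"

definition moduli :: "moduli_point set"  (\<open>\<M>\<close>)
  where "\<M> = {iso_class P | P. pointed_translation_structure P}"

definition universal :: "universal_point set"  (\<open>\<E>\<close>)
  where "\<E> = {iso_class_point P x | P x. pointed_translation_structure P \<and> x \<in> points P}"

text \<open>Forgetting the additional point in each member of \<open>[P; x]\<close> gives the class \<open>[P]\<close>.\<close>

definition proj :: "universal_point \<Rightarrow> moduli_point"
  where "proj e = fst ` e"

text \<open>Transport of structure along a map that is injective on the points of the surface.\<close>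

definition push_surface :: "('a \<Rightarrow> 'b) \<Rightarrow> 'a pointed_surface \<Rightarrow> 'b pointed_surface"
  where "push_surface h P =
    \<lparr> surface_top = pullback_topology (h ` points P) (inv_into (points P) h) (surface_top P),
      basepoint = h (basepoint P),
      atlas = push_atlas (points P) h (atlas P) \<rparr>"

text \<open>The fiber of the projection over \<open>S\<close>, with the structure transported along the bijection
  \<open>x \<mapsto> [P; x]\<close>. The result does not depend on the representative \<open>P\<close> of \<open>S\<close>.\<close>

definition fiber :: "moduli_point \<Rightarrow> universal_point pointed_surface"
  where "fiber S = (let P = (SOME P. P \<in> S) in push_surface (iso_class_point P) P)"

section \<open>Immersions\<close>

definition PC :: "'a pointed_surface \<Rightarrow> 'a set set"
  where "PC P = {A. path_connectedin (surface_top P) A \<and> basepoint P \<in> A}"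

text \<open>As a function on \<open>A\<close> an immersion is extensional, so that it is literally unique.\<close>

definition immersion ::
  "'a pointed_surface \<Rightarrow> 'a set \<Rightarrow> 'b pointed_surface \<Rightarrow> 'b set \<Rightarrow> ('a \<Rightarrow> 'b) \<Rightarrow> bool"
  where "immersion P A Q B \<iota> \<longleftrightarrow>
    A \<in> PC P \<and> B \<subseteq> points Q \<and> \<iota> \<in> extensional A \<and>
    continuous_map (subtopology (surface_top P) A) (subtopology (surface_top Q) B) \<iota> \<and>
    \<iota> (basepoint P) = basepoint Q \<and>
    (\<forall>s\<in>A. \<exists>(U, \<phi>)\<in>atlas P. \<exists>(V, \<psi>)\<in>atlas Q. \<exists>v.
       s \<in> U \<and> \<iota> ` (U \<inter> A) \<subseteq> V \<and> (\<forall>s'\<in>U \<inter> A. \<psi> (\<iota> s') = v + \<phi> s'))"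

definition immerses :: "'a pointed_surface \<Rightarrow> 'a set \<Rightarrow> 'b pointed_surface \<Rightarrow> 'b set \<Rightarrow> bool"
  where "immerses P A Q B \<longleftrightarrow> (\<exists>\<iota>. immersion P A Q B \<iota>)"

definition the_immersion ::
  "'a pointed_surface \<Rightarrow> 'a set \<Rightarrow> 'b pointed_surface \<Rightarrow> 'b set \<Rightarrow> 'a \<Rightarrow> 'b"
  where "the_immersion P A Q B = (THE \<iota>. immersion P A Q B \<iota>)"

definition open_disk :: "'a pointed_surface \<Rightarrow> 'a set \<Rightarrow> bool"
  where "open_disk P U \<longleftrightarrow>
    U \<in> PC P \<and> subtopology (surface_top P) U homeomorphic_space top_of_set (ball (0 :: real^2) 1)"

definition closed_disk :: "'a pointed_surface \<Rightarrow> 'a set \<Rightarrow> bool"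
  where "closed_disk P D \<longleftrightarrow>
    D \<subseteq> points P \<and>
    subtopology (surface_top P) D homeomorphic_space top_of_set (cball (0 :: real^2) 1) \<and>
    basepoint P \<in> surface_top P interior_of D"

section \<open>The immersive topologies\<close>

text \<open>The surface containing a disk is passed explicitly, as a point \<open>T\<close> of \<open>\<M>\<close>.\<close>

definition moduli_immersed :: "moduli_point \<Rightarrow> universal_point set \<Rightarrow> moduli_point set"
  where "moduli_immersed T A = {S \<in> \<M>. immerses (fiber T) A (fiber S) (points (fiber S))}"

definition moduli_plus ::
  "moduli_point \<Rightarrow> universal_point set \<Rightarrow> universal_point set \<Rightarrow> moduli_point set"
  where "moduli_plus T D U =
    {S \<in> \<M>. \<exists>\<iota>. immersion (fiber T) D (fiber S) (points (fiber S)) \<iota> \<and>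
       basepoint (fiber S) \<in> \<iota> ` U}"

definition moduli_minus ::
  "moduli_point \<Rightarrow> universal_point set \<Rightarrow> universal_point set \<Rightarrow> moduli_point set"
  where "moduli_minus T D K =
    {S \<in> \<M>. \<exists>\<iota>. immersion (fiber T) D (fiber S) (points (fiber S)) \<iota> \<and>
       basepoint (fiber S) \<notin> \<iota> ` K}"

text \<open>Including the whole set \<open>\<M>\<close> in the subbase guarantees that it is the underlying set.\<close>

definition moduli_topology :: "moduli_point topology"
  where "moduli_topology = topology_generated_by
    ({\<M>} \<union>
     {moduli_immersed T D | T D. T \<in> \<M> \<and> closed_disk (fiber T) D} \<union>
     {\<M> - moduli_immersed T U | T U. T \<in> \<M> \<and> open_disk (fiber T) U} \<union>
     {moduli_plus T D U | T D U. T \<in> \<M> \<and> closed_disk (fiber T) D \<and>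
        openin (surface_top (fiber T)) U \<and> U \<subseteq> surface_top (fiber T) interior_of D} \<union>
     {moduli_minus T D K | T D K. T \<in> \<M> \<and> closed_disk (fiber T) D \<and>
        closedin (surface_top (fiber T)) K \<and> K \<subseteq> D})"

definition universal_plus ::
  "moduli_point \<Rightarrow> universal_point set \<Rightarrow> universal_point set \<Rightarrow> universal_point set"
  where "universal_plus T D U =
    {s \<in> \<E>. \<exists>\<iota>. immersion (fiber T) D (fiber (proj s)) (points (fiber (proj s))) \<iota> \<and> s \<in> \<iota> ` U}"

definition universal_topology :: "universal_point topology"
  where "universal_topology = topology_generated_by
    ({{s \<in> \<E>. proj s \<in> W} | W. openin moduli_topology W} \<union>
     {universal_plus T D U | T D U. T \<in> \<M> \<and> closed_disk (fiber T) D \<and>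
        openin (surface_top (fiber T)) U \<and> U \<subseteq> surface_top (fiber T) interior_of D})"

end

theory Submission
  imports Defs "HOL-Complex_Analysis.Conformal_Mappings"
begin

text \<open>Composing the map \<open>(S, u) \<mapsto> \<iota>\<^sub>S(u)\<close> with the projection gives \<open>(S, u) \<mapsto> S\<close>, so the substance
is the preimage of a subbasic set \<open>\<E>\<^sub>+(D, V)\<close>. Suppose that \<open>S\<^sub>0\<close> admits immersions of \<open>U\<close> and \<open>D\<close>
which send \<open>u\<^sub>0 \<in> U\<close> and \<open>d\<^sub>0 \<in> V\<close> to the same point. Then \<open>\<iota>\<^sub>S(u)\<close> must lie in the image of \<open>V\<close> for all
\<open>S\<close> near \<open>S\<^sub>0\<close> and \<open>u\<close> near \<open>u\<^sub>0\<close>.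

Join the basepoint of \<open>U\<close> to \<open>u\<^sub>0\<close> by a path in \<open>U\<close>, and \<open>d\<^sub>0\<close> to the basepoint of \<open>D\<close> by a path in the
interior of \<open>D\<close>. In \<open>S\<^sub>0\<close> the two images form a loop, which may cross itself and need not lie in any disk
of \<open>S\<^sub>0\<close>. It does lift to a thin disk \<open>E\<close> of a different translation surface: the loop
develops to a path in the plane, and \<open>E\<close> is a thin neighbourhood of an interval in \<open>\<complex>\<close> with the
translation structure pulled back by a holomorphic map \<open>F\<close> that is uniformly close to the developed path on the
interval and has no critical point there. For \<open>F\<close> one takes a complex polynomial
(lemma \<open>polynomial_path_without_critical_points\<close>); the surface carrying \<open>E\<close> comes from
\<open>planar_surface_in_moduli\<close>. As \<open>F\<close> is close to the developed path, the points of \<open>E\<close> are short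
translates of points of the loop, so \<open>E\<close> immerses into \<open>S\<^sub>0\<close>; the left end of the interval is the basepoint of \<open>E\<close>, and the
right end \<open>o'\<close> also goes to the basepoint of \<open>S\<^sub>0\<close>. Hence \<open>S\<^sub>0\<close> belongs to the open set \<open>\<M>\<^sub>+(E, N)\<close>
for each small neighbourhood \<open>N\<close> of \<open>o'\<close>.

Conversely, let \<open>S\<close> be a member of \<open>\<M>\<^sub>+(E, N)\<close> into which \<open>U\<close> and \<open>D\<close> immerse. The immersion of \<open>E\<close> sends some
point near \<open>o'\<close>, off by a short vector \<open>w\<close>, to the basepoint of \<open>S\<close>. By uniqueness of
continuation the immersion of \<open>E\<close> agrees with that of \<open>U\<close> along the first half of the loop, and with that of \<open>D\<close>
translated by \<open>w\<close> along the second half. In the middle this expresses \<open>\<iota>\<^sub>S(u)\<close>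
as the image of a point of \<open>D\<close> that differs from \<open>d\<^sub>0\<close> by a short vector, hence of a point
of \<open>V\<close> (lemma \<open>universal_plus_neighbourhood\<close>).

All the continuations are instances of one rigidity statement, \<open>parallel_unique\<close>. The translates of points along a path
are organised in a \<open>tube\<close>.\<close>

section \<open>Translation charts\<close>

lemma homeomorphic_chart_restrict:
  assumes V: "openin X V" and op: "open (\<phi> ` V)"
    and hom: "homeomorphic_map (subtopology X V) (top_of_set (\<phi> ` V)) \<phi>" and W: "openin X W"
  shows "openin X (V \<inter> W)" "open (\<phi> ` (V \<inter> W))"
    "homeomorphic_map (subtopology X (V \<inter> W)) (top_of_set (\<phi> ` (V \<inter> W))) \<phi>"
proof -
  have sub: "V \<subseteq> topspace X" using V by (rule openin_subset)
  show "openin X (V \<inter> W)" using V W by auto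
  have "openin (subtopology X V) (V \<inter> W)"
    using W by (auto simp: openin_subtopology)
  then have "openin (top_of_set (\<phi> ` V)) (\<phi> ` (V \<inter> W))"
    using hom sub homeomorphic_map_openness_eq by blast
  then show "open (\<phi> ` (V \<inter> W))"
    using op openin_open_trans by blast
  have "\<phi> ` (topspace (subtopology X V) \<inter> (V \<inter> W)) = topspace (top_of_set (\<phi> ` V)) \<inter> (\<phi> ` (V \<inter> W))"
    using sub by auto
  then have "homeomorphic_map (subtopology (subtopology X V) (V \<inter> W)) (subtopology (top_of_set (\<phi> ` V)) (\<phi> ` (V \<inter> W))) \<phi>"
    by (rule homeomorphic_map_subtopologies[OF hom])
  moreover have "subtopology (subtopology X V) (V \<inter> W) = subtopology X (V \<inter> W)"
    by (simp add: subtopology_subtopology Int_assoc[symmetric])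
  moreover have "subtopology (top_of_set (\<phi> ` V)) (\<phi> ` (V \<inter> W)) = top_of_set (\<phi> ` (V \<inter> W))"
    by (simp add: subtopology_subtopology) (metis Int_absorb1 Int_lower1 image_mono)
  ultimately show "homeomorphic_map (subtopology X (V \<inter> W)) (top_of_set (\<phi> ` (V \<inter> W))) \<phi>" by simp
qed

text \<open>The properties of a translation structure on which continuation along charts rests. They make sense
for points of any type and are carried along by isomorphisms, so that they hold for the fibers, whose points are
isomorphism classes.\<close>

definition flat_surface :: "'a pointed_surface \<Rightarrow> bool"
  where "flat_surface P \<longleftrightarrow>
    Hausdorff_space (surface_top P) \<and> basepoint P \<in> points P \<and>
    (\<forall>(U, \<phi>)\<in>atlas P. openin (surface_top P) U \<and> \<phi> \<in> extensional U \<and>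
       local_homeomorphism_on (surface_top P) U \<phi>) \<and>
    (\<Union>(U, \<phi>)\<in>atlas P. U) = points P \<and>
    (\<forall>(U, \<phi>)\<in>atlas P. \<forall>(V, \<psi>)\<in>atlas P. \<forall>x\<in>U \<inter> V.
       \<exists>W. openin (surface_top P) W \<and> x \<in> W \<and> W \<subseteq> U \<inter> V \<and> (\<forall>y\<in>W. \<phi> y - \<psi> y = \<phi> x - \<psi> x))"

lemma flat_surface_if_translation_structure:
  "pointed_translation_structure P \<Longrightarrow> flat_surface P"
  unfolding pointed_translation_structure_def translation_structure_def maximal_translation_atlas_def
    translation_atlas_def oriented_surface_def flat_surface_def
  by blast

lemma
  assumes "flat_surface P"
  shows flat_Hausdorff: "Hausdorff_space (surface_top P)"
    and flat_basepoint: "basepoint P \<in> points P"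
    and flat_chart_openin: "(U, \<phi>) \<in> atlas P \<Longrightarrow> openin (surface_top P) U"
    and flat_chart_extensional: "(U, \<phi>) \<in> atlas P \<Longrightarrow> \<phi> \<in> extensional U"
    and flat_chart_local_homeomorphism:
      "(U, \<phi>) \<in> atlas P \<Longrightarrow> local_homeomorphism_on (surface_top P) U \<phi>"
  using assms unfolding flat_surface_def by auto

lemma flat_chart_at:
  assumes "flat_surface P" "x \<in> points P"
  obtains U \<phi> where "(U, \<phi>) \<in> atlas P" "x \<in> U"
  using assms unfolding flat_surface_def by blast

lemma flat_charts_compatible:
  assumes P: "flat_surface P" and ch: "(U, \<phi>) \<in> atlas P" "(V, \<psi>) \<in> atlas P" and x: "x \<in> U" "x \<in> V"
  obtains W where "openin (surface_top P) W" "x \<in> W" "W \<subseteq> U \<inter> V"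
    "\<forall>y\<in>W. \<phi> y - \<psi> y = \<phi> x - \<psi> x"
proof -
  have "\<forall>(U, \<phi>)\<in>atlas P. \<forall>(V, \<psi>)\<in>atlas P. \<forall>x\<in>U \<inter> V.
       \<exists>W. openin (surface_top P) W \<and> x \<in> W \<and> W \<subseteq> U \<inter> V \<and> (\<forall>y\<in>W. \<phi> y - \<psi> y = \<phi> x - \<psi> x)"
    using P unfolding flat_surface_def by (elim conjE)
  from bspec[OF this ch(1)] have "\<forall>(V, \<psi>)\<in>atlas P. \<forall>x\<in>U \<inter> V.
       \<exists>W. openin (surface_top P) W \<and> x \<in> W \<and> W \<subseteq> U \<inter> V \<and> (\<forall>y\<in>W. \<phi> y - \<psi> y = \<phi> x - \<psi> x)"
    by simp
  from bspec[OF this ch(2)] have "\<forall>x\<in>U \<inter> V.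
       \<exists>W. openin (surface_top P) W \<and> x \<in> W \<and> W \<subseteq> U \<inter> V \<and> (\<forall>y\<in>W. \<phi> y - \<psi> y = \<phi> x - \<psi> x)"
    by simp
  from bspec[OF this IntI[OF x]] show thesis by (elim exE conjE) (rule that)
qed

lemma flat_chart_local_inverse:
  assumes P: "flat_surface P" and ch: "(U, \<phi>) \<in> atlas P" and x: "x \<in> U" "x \<in> W"
    and W: "openin (surface_top P) W"
  obtains V g where "openin (surface_top P) V" "x \<in> V" "V \<subseteq> U \<inter> W" "open (\<phi> ` V)"
    "homeomorphic_maps (subtopology (surface_top P) V) (top_of_set (\<phi> ` V)) \<phi> g"
proof -
  let ?X = "surface_top P"
  obtain V0 where V0: "openin ?X V0" "x \<in> V0" "V0 \<subseteq> U" "open (\<phi> ` V0)"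
      "homeomorphic_map (subtopology ?X V0) (top_of_set (\<phi> ` V0)) \<phi>"
    using flat_chart_local_homeomorphism[OF P ch] x(1) unfolding local_homeomorphism_on_def by meson
  note V = homeomorphic_chart_restrict[OF V0(1,4,5) W]
  then obtain g where
      "homeomorphic_maps (subtopology ?X (V0 \<inter> W)) (top_of_set (\<phi> ` (V0 \<inter> W))) \<phi> g"
    unfolding homeomorphic_map_maps by blast
  then show thesis using that[of "V0 \<inter> W"] V(1,2) V0(2,3) x(2) by blast
qed

text \<open>With the plane as a translation surface, a developing map is a special case of a map parallel to
another one.\<close>

definition plane :: "(real^2) pointed_surface"
  where "plane = \<lparr> surface_top = euclidean, basepoint = 0, atlas = {(UNIV, \<lambda>x. x)} \<rparr>"

lemma plane_simps [simp]:
  "surface_top plane = euclidean" "basepoint plane = 0" "atlas plane = {(UNIV, \<lambda>x. x)}"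
  by (auto simp: plane_def)

lemma flat_plane: "flat_surface plane"
  unfolding flat_surface_def
  by (auto simp: local_homeomorphism_on_def homeomorphic_map_id[unfolded id_def] subtopology_UNIV
      intro!: exI[of _ UNIV])

section \<open>Parallel maps\<close>

text \<open>Demanding a constant difference, and not equality with the difference at a chosen point, makes this
relation symmetric and transitive without any bookkeeping of points.\<close>

definition parallel_in_charts ::
  "'k set \<Rightarrow> 'a set \<Rightarrow> ('a \<Rightarrow> real^2) \<Rightarrow> ('k \<Rightarrow> 'a) \<Rightarrow> 'b set \<Rightarrow> ('b \<Rightarrow> real^2) \<Rightarrow> ('k \<Rightarrow> 'b) \<Rightarrow> bool"
  where "parallel_in_charts N U \<phi> f V \<psi> g \<longleftrightarrow>
    f ` N \<subseteq> U \<and> g ` N \<subseteq> V \<and> (\<exists>c. \<forall>k\<in>N. \<phi> (f k) - \<psi> (g k) = c)"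

lemma parallel_in_chartsD:
  assumes "parallel_in_charts N U \<phi> f V \<psi> g" "k \<in> N" "k' \<in> N"
  shows "f k \<in> U" "g k \<in> V" "\<phi> (f k) - \<psi> (g k) = \<phi> (f k') - \<psi> (g k')"
proof -
  show "f k \<in> U" "g k \<in> V"
    using assms(1,2) by (simp_all add: parallel_in_charts_def image_subset_iff)
  obtain c where c: "\<forall>k\<in>N. \<phi> (f k) - \<psi> (g k) = c"
    using assms(1) unfolding parallel_in_charts_def by (elim conjE exE)
  show "\<phi> (f k) - \<psi> (g k) = \<phi> (f k') - \<psi> (g k')"
    using bspec[OF c assms(2)] bspec[OF c assms(3)] by simp
qed

lemma parallel_in_charts_mono:
  "parallel_in_charts N U \<phi> f V \<psi> g \<Longrightarrow> M \<subseteq> N \<Longrightarrow> parallel_in_charts M U \<phi> f V \<psi> g"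
  unfolding parallel_in_charts_def by (meson image_mono order_trans subsetD)

lemma parallel_in_charts_compose:
  "parallel_in_charts N U \<phi> f V \<psi> g \<Longrightarrow> \<kappa> ` M \<subseteq> N \<Longrightarrow>
    parallel_in_charts M U \<phi> (f \<circ> \<kappa>) V \<psi> (g \<circ> \<kappa>)"
  unfolding parallel_in_charts_def image_subset_iff o_def by meson

lemma parallel_in_charts_sym:
  assumes "parallel_in_charts N U \<phi> f V \<psi> g"
  shows "parallel_in_charts N V \<psi> g U \<phi> f"
proof -
  obtain c where "\<forall>k\<in>N. \<phi> (f k) - \<psi> (g k) = c"
    using assms unfolding parallel_in_charts_def by (elim conjE exE)
  then have "\<forall>k\<in>N. \<psi> (g k) - \<phi> (f k) = - c" by (metis minus_diff_eq)
  then show ?thesis using assms unfolding parallel_in_charts_def by (intro conjI) (elim conjE, assumption, elim conjE, assumption, rule exI, rule ballI, blast)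
qed

lemma parallel_in_charts_trans:
  assumes "parallel_in_charts N U \<phi> f V \<psi> g" "parallel_in_charts N V \<psi> g W \<xi> h"
  shows "parallel_in_charts N U \<phi> f W \<xi> h"
proof -
  obtain c d where cd: "\<forall>k\<in>N. \<phi> (f k) - \<psi> (g k) = c" "\<forall>k\<in>N. \<psi> (g k) - \<xi> (h k) = d"
    using assms unfolding parallel_in_charts_def by (elim conjE exE)
  have "\<phi> (f k) - \<xi> (h k) = c + d" if "k \<in> N" for k
  proof -
    have "(\<phi> (f k) - \<psi> (g k)) + (\<psi> (g k) - \<xi> (h k)) = c + d"
      using cd(1)[rule_format, OF that] cd(2)[rule_format, OF that] by (simp only:)
    then show ?thesis by simp
  qed
  then show ?thesis using assms unfolding parallel_in_charts_def by (intro conjI) (elim conjE, assumption, elim conjE, assumption, rule exI, rule ballI, blast)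
qed

lemma parallel_in_charts_cong:
  assumes "parallel_in_charts N U \<phi> f V \<psi> g" "\<And>k. k \<in> N \<Longrightarrow> f' k = f k" "\<And>k. k \<in> N \<Longrightarrow> g' k = g k"
  shows "parallel_in_charts N U \<phi> f' V \<psi> g'"
  using assms unfolding parallel_in_charts_def image_subset_iff by metis

lemma flat_charts_parallel:
  assumes P: "flat_surface P" and ch: "(U, \<phi>) \<in> atlas P" "(V, \<psi>) \<in> atlas P" and x: "x \<in> U" "x \<in> V"
  obtains W where "openin (surface_top P) W" "x \<in> W" "parallel_in_charts W U \<phi> id V \<psi> id"
proof -
  obtain W where W: "openin (surface_top P) W" "x \<in> W" "W \<subseteq> U \<inter> V"
    "\<forall>y\<in>W. \<phi> y - \<psi> y = \<phi> x - \<psi> x"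
    by (rule flat_charts_compatible[OF P ch x])
  have "\<exists>c. \<forall>y\<in>W. \<phi> (id y) - \<psi> (id y) = c"
    unfolding id_apply by (rule exI, rule W(4))
  moreover have "id ` W \<subseteq> U" "id ` W \<subseteq> V" using W(3) by simp_all
  ultimately have "parallel_in_charts W U \<phi> id V \<psi> id"
    unfolding parallel_in_charts_def by blast
  with W(1,2) show thesis by (rule that)
qed

text \<open>Two maps from a space \<open>K\<close> into translation surfaces are parallel if they move by the same vectors when the argument
moves a little. The notion covers immersions (parallel to the inclusion of their domain),
isomorphisms (parallel to the identity) and developing maps (parallel maps into the plane), so that one
uniqueness lemma and one composition lemma serve for all of them.\<close>

definition parallel ::
  "'k topology \<Rightarrow> 'a pointed_surface \<Rightarrow> ('k \<Rightarrow> 'a) \<Rightarrow> 'b pointed_surface \<Rightarrow> ('k \<Rightarrow> 'b) \<Rightarrow> bool"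
  where "parallel K P f Q g \<longleftrightarrow>
    continuous_map K (surface_top P) f \<and> continuous_map K (surface_top Q) g \<and>
    (\<forall>k\<in>topspace K. \<exists>U \<phi> V \<psi> N. (U, \<phi>) \<in> atlas P \<and> (V, \<psi>) \<in> atlas Q \<and> openin K N \<and> k \<in> N \<and>
       parallel_in_charts N U \<phi> f V \<psi> g)"

lemma parallelI:
  assumes "continuous_map K (surface_top P) f" "continuous_map K (surface_top Q) g"
    and "\<And>k. k \<in> topspace K \<Longrightarrow> \<exists>U \<phi> V \<psi> N. (U, \<phi>) \<in> atlas P \<and> (V, \<psi>) \<in> atlas Q \<and> openin K N \<and> k \<in> N \<and>
       parallel_in_charts N U \<phi> f V \<psi> g"
  shows "parallel K P f Q g"
  unfolding parallel_def using assms by (intro conjI ballI)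

lemma
  assumes "parallel K P f Q g"
  shows parallel_continuous: "continuous_map K (surface_top P) f" "continuous_map K (surface_top Q) g"
    and parallel_in_points: "k \<in> topspace K \<Longrightarrow> f k \<in> points P"  "k \<in> topspace K \<Longrightarrow> g k \<in> points Q"
  using assms unfolding parallel_def by (auto simp: continuous_map_def)

lemma parallel_locally:
  assumes "parallel K P f Q g" "k \<in> topspace K"
  obtains U \<phi> V \<psi> N where "(U, \<phi>) \<in> atlas P" "(V, \<psi>) \<in> atlas Q" "openin K N" "k \<in> N"
    "parallel_in_charts N U \<phi> f V \<psi> g"
proof -
  have "\<exists>U \<phi> V \<psi> N. (U, \<phi>) \<in> atlas P \<and> (V, \<psi>) \<in> atlas Q \<and> openin K N \<and> k \<in> N \<and>
       parallel_in_charts N U \<phi> f V \<psi> g"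
    using assms unfolding parallel_def by (elim conjE) (erule (1) bspec)
  then show thesis by (elim exE conjE) (rule that)
qed

text \<open>Since charts of one atlas differ by locally constant vectors, the charts that witness parallelism can be
exchanged for any others. This is what makes parallelism transitive.\<close>

lemma parallel_in_given_charts:
  assumes P: "flat_surface P" and Q: "flat_surface Q" and par: "parallel K P f Q g"
    and k: "k \<in> topspace K" and U: "(U, \<phi>) \<in> atlas P" "f k \<in> U" and V: "(V, \<psi>) \<in> atlas Q" "g k \<in> V"
  obtains N where "openin K N" "k \<in> N" "parallel_in_charts N U \<phi> f V \<psi> g"
proof -
  obtain U0 \<phi>0 V0 \<psi>0 N where 0: "(U0, \<phi>0) \<in> atlas P" "(V0, \<psi>0) \<in> atlas Q" "openin K N" "k \<in> N"
    and N: "parallel_in_charts N U0 \<phi>0 f V0 \<psi>0 g"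
    by (rule parallel_locally[OF par k])
  note fk = parallel_in_chartsD(1)[OF N 0(4) 0(4)] and gk = parallel_in_chartsD(2)[OF N 0(4) 0(4)]
  obtain A where A: "openin (surface_top P) A" "f k \<in> A" "parallel_in_charts A U \<phi> id U0 \<phi>0 id"
    by (rule flat_charts_parallel[OF P U(1) 0(1) U(2) fk])
  obtain B where B: "openin (surface_top Q) B" "g k \<in> B" "parallel_in_charts B V0 \<psi>0 id V \<psi> id"
    by (rule flat_charts_parallel[OF Q 0(2) V(1) gk V(2)])
  define N' where "N' = N \<inter> {k'\<in>topspace K. f k' \<in> A} \<inter> {k'\<in>topspace K. g k' \<in> B}"
  have sub: "N' \<subseteq> N" "f ` N' \<subseteq> A" "g ` N' \<subseteq> B" by (auto simp: N'_def)
  have "openin K N'"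
    unfolding N'_def using 0(3)
      openin_continuous_map_preimage[OF parallel_continuous(1)[OF par] A(1)]
      openin_continuous_map_preimage[OF parallel_continuous(2)[OF par] B(1)]
    by (intro openin_Int)
  moreover have "k \<in> N'" using 0 A B k by (simp add: N'_def)
  moreover have "parallel_in_charts N' U \<phi> f V \<psi> g"
  proof (rule parallel_in_charts_trans)
    show "parallel_in_charts N' U \<phi> f U0 \<phi>0 f"
      using parallel_in_charts_compose[OF A(3) sub(2)] by (simp only: id_comp)
    show "parallel_in_charts N' U0 \<phi>0 f V \<psi> g"
      using parallel_in_charts_compose[OF B(3) sub(3)] parallel_in_charts_mono[OF N sub(1)]
      by (simp only: id_comp) (rule parallel_in_charts_trans)
  qed
  ultimately show thesis by (rule that)
qed

lemma parallel_sym: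
  assumes "parallel K P f Q g"
  shows "parallel K Q g P f"
proof (rule parallelI)
  show "continuous_map K (surface_top Q) g" "continuous_map K (surface_top P) f"
    using assms by (simp_all add: parallel_def)
  fix k assume "k \<in> topspace K"
  then obtain U \<phi> V \<psi> N where N: "(U, \<phi>) \<in> atlas P" "(V, \<psi>) \<in> atlas Q" "openin K N" "k \<in> N"
    "parallel_in_charts N U \<phi> f V \<psi> g"
    by (rule parallel_locally[OF assms])
  then show "\<exists>V \<psi> U \<phi> N. (V, \<psi>) \<in> atlas Q \<and> (U, \<phi>) \<in> atlas P \<and> openin K N \<and> k \<in> N \<and>
       parallel_in_charts N V \<psi> g U \<phi> f"
    by (intro exI conjI) (assumption+, erule parallel_in_charts_sym)
qed

lemma parallel_trans:
  assumes flat: "flat_surface P" "flat_surface Q" "flat_surface R"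
    and par: "parallel K P f Q g" "parallel K Q g R h"
  shows "parallel K P f R h"
proof (rule parallelI)
  show "continuous_map K (surface_top P) f" "continuous_map K (surface_top R) h"
    using par by (simp_all add: parallel_def)
  fix k assume k: "k \<in> topspace K"
  obtain U \<phi> where U: "(U, \<phi>) \<in> atlas P" "f k \<in> U"
    using flat_chart_at[OF flat(1)] parallel_in_points(1)[OF par(1) k] by metis
  obtain V \<psi> where V: "(V, \<psi>) \<in> atlas Q" "g k \<in> V"
    using flat_chart_at[OF flat(2)] parallel_in_points(2)[OF par(1) k] by metis
  obtain W \<xi> where W: "(W, \<xi>) \<in> atlas R" "h k \<in> W"
    using flat_chart_at[OF flat(3)] parallel_in_points(2)[OF par(2) k] by metis
  obtain M where M: "openin K M" "k \<in> M" "parallel_in_charts M U \<phi> f V \<psi> g"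
    by (rule parallel_in_given_charts[OF flat(1,2) par(1) k U V])
  obtain N where N: "openin K N" "k \<in> N" "parallel_in_charts N V \<psi> g W \<xi> h"
    by (rule parallel_in_given_charts[OF flat(2,3) par(2) k V W])
  have "parallel_in_charts (M \<inter> N) U \<phi> f W \<xi> h"
    using parallel_in_charts_trans parallel_in_charts_mono M(3) N(3) by (metis Int_lower1 Int_lower2)
  moreover have "openin K (M \<inter> N)" "k \<in> M \<inter> N" using M N by auto
  ultimately show "\<exists>U \<phi> V \<psi> N. (U, \<phi>) \<in> atlas P \<and> (V, \<psi>) \<in> atlas R \<and> openin K N \<and> k \<in> N \<and>
       parallel_in_charts N U \<phi> f V \<psi> h"
    using U(1) W(1) by blast
qed

lemma parallel_compose:
  assumes par: "parallel K P f Q g" and \<kappa>: "continuous_map L K \<kappa>"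
  shows "parallel L P (f \<circ> \<kappa>) Q (g \<circ> \<kappa>)"
proof (rule parallelI)
  show "continuous_map L (surface_top P) (f \<circ> \<kappa>)" "continuous_map L (surface_top Q) (g \<circ> \<kappa>)"
    using parallel_continuous[OF par] \<kappa> continuous_map_compose by blast+
  fix l assume l: "l \<in> topspace L"
  then have "\<kappa> l \<in> topspace K" using \<kappa> by (simp add: continuous_map_def Pi_iff)
  then obtain U \<phi> V \<psi> N where N: "(U, \<phi>) \<in> atlas P" "(V, \<psi>) \<in> atlas Q" "openin K N" "\<kappa> l \<in> N"
    "parallel_in_charts N U \<phi> f V \<psi> g"
    by (rule parallel_locally[OF par])
  have "parallel_in_charts {x \<in> topspace L. \<kappa> x \<in> N} U \<phi> (f \<circ> \<kappa>) V \<psi> (g \<circ> \<kappa>)"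
    by (rule parallel_in_charts_compose[OF N(5)]) auto
  moreover have "l \<in> {x \<in> topspace L. \<kappa> x \<in> N}" using l N by simp
  ultimately show "\<exists>U \<phi> V \<psi> N. (U, \<phi>) \<in> atlas P \<and> (V, \<psi>) \<in> atlas Q \<and> openin L N \<and> l \<in> N \<and>
       parallel_in_charts N U \<phi> (f \<circ> \<kappa>) V \<psi> (g \<circ> \<kappa>)"
    using N(1,2) openin_continuous_map_preimage[OF \<kappa> N(3)] by blast
qed

lemma parallel_cong:
  assumes par: "parallel K P f Q g" and eq: "\<And>k. k \<in> topspace K \<Longrightarrow> f' k = f k" "\<And>k. k \<in> topspace K \<Longrightarrow> g' k = g k"
  shows "parallel K P f' Q g'"
proof (rule parallelI)
  show "continuous_map K (surface_top P) f'" "continuous_map K (surface_top Q) g'"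
    using parallel_continuous[OF par] eq continuous_map_eq by metis+
  fix k assume k: "k \<in> topspace K"
  then obtain U \<phi> V \<psi> N where N: "(U, \<phi>) \<in> atlas P" "(V, \<psi>) \<in> atlas Q" "openin K N" "k \<in> N"
    "parallel_in_charts N U \<phi> f V \<psi> g"
    by (rule parallel_locally[OF par])
  moreover have "parallel_in_charts N U \<phi> f' V \<psi> g'"
    using N(5) eq openin_subset[OF N(3)] by (intro parallel_in_charts_cong[OF N(5)]) auto
  ultimately show "\<exists>U \<phi> V \<psi> N. (U, \<phi>) \<in> atlas P \<and> (V, \<psi>) \<in> atlas Q \<and> openin K N \<and> k \<in> N \<and>
       parallel_in_charts N U \<phi> f' V \<psi> g'"
    by blast
qed

text \<open>Continuation is unique: a map into \<open>P\<close> that is parallel to \<open>g\<close> is determined on a connected space by one value.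
The set of agreement is closed because \<open>P\<close> is a Hausdorff space. It is open because near a point of agreement
the two maps have equal coordinates in a chart, and charts are locally injective.\<close>

lemma parallel_unique:
  assumes P: "flat_surface P" and Q: "flat_surface Q"
    and par: "parallel K P f Q g" "parallel K P f' Q g" and conn: "connected_space K"
    and l: "l \<in> topspace K" "f l = f' l" and k: "k \<in> topspace K"
  shows "f k = f' k"
proof -
  let ?E = "{k \<in> topspace K. f k = f' k}"
  have cl: "closedin K ?E"
    using par flat_Hausdorff[OF P] by (intro closedin_continuous_maps_eq) (auto simp: parallel_def)
  have "\<exists>N. openin K N \<and> k \<in> N \<and> N \<subseteq> ?E" if k: "k \<in> ?E" for k
  proof -
    have kK: "k \<in> topspace K" and eq: "f k = f' k" using k by auto
    obtain U \<phi> where U: "(U, \<phi>) \<in> atlas P" "f k \<in> U"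
      using flat_chart_at[OF P] parallel_in_points(1)[OF par(1) kK] by metis
    have U': "f' k \<in> U" using U eq by simp
    obtain V \<psi> where V: "(V, \<psi>) \<in> atlas Q" "g k \<in> V"
      using flat_chart_at[OF Q] parallel_in_points(2)[OF par(1) kK] by metis
    obtain W h where W: "openin (surface_top P) W" "f k \<in> W" "W \<subseteq> U \<inter> U" "open (\<phi> ` W)"
      "homeomorphic_maps (subtopology (surface_top P) W) (top_of_set (\<phi> ` W)) \<phi> h"
      by (rule flat_chart_local_inverse[OF P U U(2) flat_chart_openin[OF P U(1)]])
    have h: "h (\<phi> y) = y" if "y \<in> W" for y
      using W(5) that openin_subset[OF W(1)] unfolding homeomorphic_maps_def by auto
    obtain N where N: "openin K N" "k \<in> N" "parallel_in_charts N U \<phi> f V \<psi> g"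
      by (rule parallel_in_given_charts[OF P Q par(1) kK U V])
    obtain N' where N': "openin K N'" "k \<in> N'" "parallel_in_charts N' U \<phi> f' V \<psi> g"
      by (rule parallel_in_given_charts[OF P Q par(2) kK U(1) U' V])
    define M where "M = N \<inter> N' \<inter> {k'\<in>topspace K. f k' \<in> W} \<inter> {k'\<in>topspace K. f' k' \<in> W}"
    have "openin K M"
      unfolding M_def using N(1) N'(1)
        openin_continuous_map_preimage[OF parallel_continuous(1)[OF par(1)] W(1)]
        openin_continuous_map_preimage[OF parallel_continuous(1)[OF par(2)] W(1)]
      by (intro openin_Int)
    moreover have "k \<in> M" using N N' W kK eq by (simp add: M_def)
    moreover have "f k' = f' k'" if "k' \<in> M" for k'
    proof -
      have *: "k' \<in> N" "k' \<in> N'" "f k' \<in> W" "f' k' \<in> W" using that by (simp_all add: M_def)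
      have "\<phi> (f k') - \<psi> (g k') = \<phi> (f' k') - \<psi> (g k')"
        using parallel_in_chartsD(3)[OF N(3) *(1) N(2)] parallel_in_chartsD(3)[OF N'(3) *(2) N'(2)] eq by simp
      then have eq': "\<phi> (f k') = \<phi> (f' k')" by simp
      have "f k' = h (\<phi> (f k'))" by (rule h[OF *(3), symmetric])
      also have "\<dots> = h (\<phi> (f' k'))" by (simp only: eq')
      also have "\<dots> = f' k'" by (rule h[OF *(4)])
      finally show ?thesis .
    qed
    moreover have "M \<subseteq> topspace K" unfolding M_def by blast
    ultimately show ?thesis by blast
  qed
  then have "openin K ?E" using openin_subopen[of K ?E] by blast
  then have "?E = topspace K" using conn cl l unfolding connected_space_clopen_in by blast
  then show ?thesis using k by blast
qed

lemma continuous_map_Un_closed: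
  assumes "continuous_map (subtopology K A) X f" "continuous_map (subtopology K B) X f"
    and cl: "closedin K A" "closedin K B" "topspace K = A \<union> B"
  shows "continuous_map K X f"
proof (rule pasting_lemma_closed[where I = "{A, B}" and T = "\<lambda>C. C" and f = "\<lambda>_. f"])
  show "\<And>x. x \<in> topspace K \<Longrightarrow> \<exists>j. j \<in> {A, B} \<and> x \<in> j \<and> f x = f x" using cl(3) by blast
qed (use assms in auto)

lemma parallel_Un:
  assumes P: "flat_surface P" and Q: "flat_surface Q"
    and cl: "closedin K A" "closedin K B" "topspace K = A \<union> B"
    and par: "parallel (subtopology K A) P f Q g" "parallel (subtopology K B) P f Q g"
  shows "parallel K P f Q g"
proof (rule parallelI)
  show "continuous_map K (surface_top P) f"
    by (rule continuous_map_Un_closed[OF _ _ cl]) (use par in \<open>auto simp: parallel_def\<close>)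
  show "continuous_map K (surface_top Q) g"
    by (rule continuous_map_Un_closed[OF _ _ cl]) (use par in \<open>auto simp: parallel_def\<close>)
  fix k assume k: "k \<in> topspace K"
  then have pts: "f k \<in> points P" "g k \<in> points Q"
    using cl(3) par[THEN parallel_in_points(1)] par[THEN parallel_in_points(2)] by auto
  obtain U \<phi> where U: "(U, \<phi>) \<in> atlas P" "f k \<in> U" using flat_chart_at[OF P] pts by metis
  obtain V \<psi> where V: "(V, \<psi>) \<in> atlas Q" "g k \<in> V" using flat_chart_at[OF Q] pts by metis
  have ex: "\<exists>N. openin K N \<and> k \<in> N \<and>
      (\<forall>k'\<in>N \<inter> C. f k' \<in> U \<and> g k' \<in> V \<and> \<phi> (f k') - \<psi> (g k') = \<phi> (f k) - \<psi> (g k))"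
    if C: "closedin K C" "parallel (subtopology K C) P f Q g" for C
  proof (cases "k \<in> C")
    case True
    then have kC: "k \<in> topspace (subtopology K C)" using k by simp
    obtain N where N: "openin (subtopology K C) N" "k \<in> N" "parallel_in_charts N U \<phi> f V \<psi> g"
      by (rule parallel_in_given_charts[OF P Q C(2) kC U V])
    then obtain N' where N': "openin K N'" "N = N' \<inter> C" by (auto simp: openin_subtopology)
    have "\<forall>k'\<in>N' \<inter> C. f k' \<in> U \<and> g k' \<in> V \<and> \<phi> (f k') - \<psi> (g k') = \<phi> (f k) - \<psi> (g k)"
      unfolding N'(2)[symmetric]
      by (intro ballI conjI) (erule parallel_in_chartsD[OF N(3) _ N(2)])+
    moreover have "k \<in> N'" using N(2) N'(2) by blast
    ultimately show ?thesis using N'(1) by blast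
  next
    case False
    then show ?thesis using k C(1) by (intro exI[of _ "topspace K - C"]) auto
  qed
  obtain M N where M: "openin K M" "k \<in> M" "\<forall>k'\<in>M \<inter> A. f k' \<in> U \<and> g k' \<in> V \<and> \<phi> (f k') - \<psi> (g k') = \<phi> (f k) - \<psi> (g k)"
     and N: "openin K N" "k \<in> N" "\<forall>k'\<in>N \<inter> B. f k' \<in> U \<and> g k' \<in> V \<and> \<phi> (f k') - \<psi> (g k') = \<phi> (f k) - \<psi> (g k)"
    using ex[OF cl(1) par(1)] ex[OF cl(2) par(2)] by (elim exE conjE) (rule that)
  have "\<forall>k'\<in>M \<inter> N. f k' \<in> U \<and> g k' \<in> V \<and> \<phi> (f k') - \<psi> (g k') = \<phi> (f k) - \<psi> (g k)"
    using M(3) N(3) cl(3) openin_subset[OF M(1)] by blast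
  then have "parallel_in_charts (M \<inter> N) U \<phi> f V \<psi> g"
    unfolding parallel_in_charts_def image_subset_iff by blast
  moreover have "openin K (M \<inter> N)" "k \<in> M \<inter> N" using M N by auto
  ultimately show "\<exists>U \<phi> V \<psi> N. (U, \<phi>) \<in> atlas P \<and> (V, \<psi>) \<in> atlas Q \<and> openin K N \<and> k \<in> N \<and>
       parallel_in_charts N U \<phi> f V \<psi> g"
    using U(1) V(1) by blast
qed

lemma parallel_subset:
  assumes "parallel (top_of_set K) P f Q g" "L \<subseteq> K"
  shows "parallel (top_of_set L) P f Q g"
proof -
  have "continuous_map (top_of_set L) (top_of_set K) id"
    using assms(2) by (auto simp: continuous_map_in_subtopology)
  from parallel_compose[OF assms(1) this] show ?thesis by (simp only: comp_id)
qed

lemma parallel_plane_shift: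
  assumes "continuous_map K euclidean f"
  shows "parallel K plane (\<lambda>k. f k + w) plane f"
proof (rule parallelI)
  show "continuous_map K (surface_top plane) (\<lambda>k. f k + w)" "continuous_map K (surface_top plane) f"
    using assms by (auto intro: continuous_map_add)
  fix k assume "k \<in> topspace K"
  moreover have "parallel_in_charts (topspace K) UNIV (\<lambda>x. x) (\<lambda>k. f k + w) UNIV (\<lambda>x. x) f"
    unfolding parallel_in_charts_def by auto
  ultimately show "\<exists>U \<phi> V \<psi> N. (U, \<phi>) \<in> atlas plane \<and> (V, \<psi>) \<in> atlas plane \<and>
      openin K N \<and> k \<in> N \<and> parallel_in_charts N U \<phi> (\<lambda>k. f k + w) V \<psi> f"
    by (intro exI[of _ UNIV] exI[of _ "\<lambda>x. x"] exI[of _ "topspace K"]) simp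
qed

lemma parallel_shift:
  assumes P: "flat_surface P" and par: "parallel K P f plane (\<lambda>k. g k + w)" and g: "continuous_map K euclidean g"
  shows "parallel K P f plane g"
  using parallel_trans[OF P flat_plane flat_plane par parallel_plane_shift[OF g]] .

section \<open>Tubes around paths\<close>

text \<open>The point \<open>e (\<tau>, v)\<close> is obtained from \<open>\<alpha> \<tau>\<close> by the straight translation \<open>v\<close>, which is possible for all \<open>v\<close>
shorter than \<open>r\<close>, uniformly along the path; \<open>a\<close> is the path \<open>\<alpha>\<close> developed in the plane.\<close>

definition tube ::
  "'a pointed_surface \<Rightarrow> 'a set \<Rightarrow> (real \<Rightarrow> 'a) \<Rightarrow> real \<Rightarrow> real \<Rightarrow> real \<Rightarrow> (real \<times> (real^2) \<Rightarrow> 'a) \<Rightarrow> (real \<Rightarrow> real^2) \<Rightarrow> bool"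
  where "tube P W \<alpha> s t r e a \<longleftrightarrow>
    0 < r \<and> continuous_on {s..t} a \<and>
    parallel (top_of_set ({s..t} \<times> ball 0 r)) P e plane (\<lambda>(\<tau>, v). a \<tau> + v) \<and>
    (\<forall>\<tau>\<in>{s..t}. e (\<tau>, 0) = \<alpha> \<tau>) \<and> e ` ({s..t} \<times> ball 0 r) \<subseteq> W"

lemma tube_shrink:
  assumes tube: "tube P W \<alpha> s t r e a" and r': "0 < r'" "r' \<le> r"
  shows "tube P W \<alpha> s t r' e a"
proof -
  have sub: "{s..t} \<times> ball 0 r' \<subseteq> {s..t} \<times> ball (0::real^2) r"
    using r' by auto
  have "parallel (top_of_set ({s..t} \<times> ball 0 r)) P e plane (\<lambda>(\<tau>, v). a \<tau> + v)"
    using tube by (simp add: tube_def)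
  from parallel_subset[OF this sub]
  show ?thesis
    using tube r' sub unfolding tube_def by blast
qed

lemma tube_local:
  assumes P: "flat_surface P" and W: "openin (surface_top P) W"
    and \<alpha>: "continuous_map (top_of_set {s..t}) (subtopology (surface_top P) W) \<alpha>"
    and \<tau>0: "\<tau>0 \<in> {s..t}"
  obtains d where "0 < d"
    "\<And>a b. a \<le> \<tau>0 \<Longrightarrow> \<tau>0 \<le> b \<Longrightarrow> b - a < d \<Longrightarrow> s \<le> a \<Longrightarrow> b \<le> t \<Longrightarrow> \<exists>r e c. tube P W \<alpha> a b r e c"
proof -
  let ?X = "surface_top P"
  have \<alpha>': "continuous_map (top_of_set {s..t}) ?X \<alpha>" and \<alpha>W: "\<alpha> ` {s..t} \<subseteq> W"
    using \<alpha> by (auto simp: continuous_map_in_subtopology)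
  have xW: "\<alpha> \<tau>0 \<in> W" using \<alpha>W \<tau>0 by blast
  then have "\<alpha> \<tau>0 \<in> points P" using W openin_subset by blast
  then obtain U \<phi> where U: "(U, \<phi>) \<in> atlas P" "\<alpha> \<tau>0 \<in> U" using flat_chart_at[OF P] by metis
  obtain V g where V: "openin ?X V" "\<alpha> \<tau>0 \<in> V" "V \<subseteq> U \<inter> W" "open (\<phi> ` V)"
      and g: "homeomorphic_maps (subtopology ?X V) (top_of_set (\<phi> ` V)) \<phi> g"
    by (rule flat_chart_local_inverse[OF P U xW W])
  have VP: "V \<subseteq> points P" using V(1) by (rule openin_subset)
  have gc: "continuous_map (top_of_set (\<phi> ` V)) (subtopology ?X V) g"
    and \<phi>c: "continuous_map (subtopology ?X V) euclidean \<phi>"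
    and \<phi>g: "\<And>p. p \<in> \<phi> ` V \<Longrightarrow> \<phi> (g p) = p" and g\<phi>: "\<And>y. y \<in> V \<Longrightarrow> g (\<phi> y) = y"
    using g VP by (auto simp: homeomorphic_maps_def continuous_map_in_subtopology)
  obtain R where R: "R > 0" "ball (\<phi> (\<alpha> \<tau>0)) R \<subseteq> \<phi> ` V"
    using V(2,4) by (meson imageI open_contains_ball)
  define r where "r = R / 2"
  have r: "r > 0" using R by (simp add: r_def)
  define O' where "O' = {y \<in> topspace (subtopology ?X V). \<phi> y \<in> ball (\<phi> (\<alpha> \<tau>0)) r}"
  have "openin (subtopology ?X V) O'"
    unfolding O'_def by (rule openin_continuous_map_preimage[OF \<phi>c]) auto
  then have "openin ?X O'" using V(1) by (rule openin_trans_full)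
  from openin_continuous_map_preimage[OF \<alpha>' this]
  have "openin (top_of_set {s..t}) {\<tau> \<in> {s..t}. \<alpha> \<tau> \<in> O'}" by simp
  moreover have "\<tau>0 \<in> {\<tau> \<in> {s..t}. \<alpha> \<tau> \<in> O'}" using \<tau>0 V(2) VP r by (auto simp: O'_def)
  ultimately obtain d where d: "d > 0" "ball \<tau>0 d \<inter> {s..t} \<subseteq> {\<tau> \<in> {s..t}. \<alpha> \<tau> \<in> O'}"
    unfolding openin_contains_ball by meson
  show thesis
  proof (rule that[OF d(1)])
    fix a b assume ab: "a \<le> \<tau>0" "\<tau>0 \<le> b" "b - a < d" "s \<le> a" "b \<le> t"
    have in_ball: "\<alpha> \<tau> \<in> V" "\<phi> (\<alpha> \<tau>) \<in> ball (\<phi> (\<alpha> \<tau>0)) r" if "\<tau> \<in> {a..b}" for \<tau>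
    proof -
      have "\<tau> \<in> ball \<tau>0 d \<inter> {s..t}" using that ab by (auto simp: dist_real_def)
      then have "\<alpha> \<tau> \<in> O'" using d(2) by blast
      then show "\<alpha> \<tau> \<in> V" "\<phi> (\<alpha> \<tau>) \<in> ball (\<phi> (\<alpha> \<tau>0)) r" by (auto simp: O'_def)
    qed
    have in_V: "\<phi> (\<alpha> \<tau>) + v \<in> \<phi> ` V" if "\<tau> \<in> {a..b}" "v \<in> ball 0 r" for \<tau> v
    proof -
      have "dist (\<phi> (\<alpha> \<tau>0)) (\<phi> (\<alpha> \<tau>) + v) \<le> dist (\<phi> (\<alpha> \<tau>0)) (\<phi> (\<alpha> \<tau>)) + norm v"
        by (metis add_diff_cancel_left' dist_norm dist_triangle norm_minus_commute)
      also have "\<dots> < R" using in_ball(2)[OF that(1)] that(2) by (simp add: r_def)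
      finally show ?thesis using R(2) by auto
    qed
    let ?K = "{a..b} \<times> ball (0::real^2) r"
    define e where "e = (\<lambda>(\<tau>, v). g (\<phi> (\<alpha> \<tau>) + v))"
    have "continuous_map (top_of_set {a..b}) (subtopology ?X V) \<alpha>"
      using continuous_map_from_subtopology_mono[OF \<alpha>', of "{a..b}"] ab in_ball
      by (auto simp: continuous_map_in_subtopology)
    from continuous_map_compose[OF this \<phi>c]
    have c: "continuous_on {a..b} (\<lambda>\<tau>. \<phi> (\<alpha> \<tau>))" by (simp add: o_def)
    have c2: "continuous_on ?K (\<lambda>(\<tau>, v). \<phi> (\<alpha> \<tau>) + v)"
      unfolding split_beta
      by (intro continuous_intros continuous_on_compose2[OF c]) auto
    have "continuous_map (top_of_set ?K) (top_of_set (\<phi> ` V)) (\<lambda>(\<tau>, v). \<phi> (\<alpha> \<tau>) + v)"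
      using c2 in_V by (auto simp: continuous_map_in_subtopology)
    from continuous_map_compose[OF this gc]
    have ce: "continuous_map (top_of_set ?K) (subtopology ?X V) e"
      by (simp add: e_def o_def split_def)
    have eV: "e ` ?K \<subseteq> V" using ce by (auto simp: continuous_map_in_subtopology)
    have "parallel (top_of_set ?K) P e plane (\<lambda>(\<tau>, v). \<phi> (\<alpha> \<tau>) + v)"
    proof (rule parallelI)
      show "continuous_map (top_of_set ?K) ?X e" using ce by (simp add: continuous_map_in_subtopology)
      show "continuous_map (top_of_set ?K) (surface_top plane) (\<lambda>(\<tau>, v). \<phi> (\<alpha> \<tau>) + v)" using c2 by simp
      fix k assume k: "k \<in> topspace (top_of_set ?K)"
      have "parallel_in_charts ?K U \<phi> e UNIV (\<lambda>x. x) (\<lambda>(\<tau>, v). \<phi> (\<alpha> \<tau>) + v)"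
        unfolding parallel_in_charts_def using eV V(3) \<phi>g in_V
        by (intro conjI exI[of _ 0]) (auto simp: e_def)
      then show "\<exists>U \<phi>' V \<psi> N. (U, \<phi>') \<in> atlas P \<and> (V, \<psi>) \<in> atlas plane \<and>
          openin (top_of_set ?K) N \<and> k \<in> N \<and> parallel_in_charts N U \<phi>' e V \<psi> (\<lambda>(\<tau>, v). \<phi> (\<alpha> \<tau>) + v)"
        using U(1) k by (intro exI[of _ U] exI[of _ \<phi>] exI[of _ UNIV] exI[of _ "\<lambda>x. x"] exI[of _ ?K]) simp
    qed
    then have "tube P W \<alpha> a b r e (\<lambda>\<tau>. \<phi> (\<alpha> \<tau>))"
      unfolding tube_def using r c eV V(3) g\<phi> in_ball(1) by (auto simp: e_def)
    then show "\<exists>r e c. tube P W \<alpha> a b r e c" by blast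
  qed
qed

text \<open>At the common end \<open>b\<close> both tubes are parallel to the identity of the ball and agree at its centre, hence
they agree. The developed paths are fitted together by a translation.\<close>

lemma tube_join:
  assumes P: "flat_surface P" and ab: "a \<le> b" "b \<le> c"
    and tubes: "tube P W \<alpha> a b r1 e1 c1" "tube P W \<alpha> b c r2 e2 c2"
  shows "\<exists>r e d. tube P W \<alpha> a c r e d"
proof -
  define r where "r = min r1 r2"
  have r: "0 < r" "r \<le> r1" "r \<le> r2" using tubes by (auto simp: r_def tube_def)
  note t1 = tube_shrink[OF tubes(1) r(1,2)] and t2 = tube_shrink[OF tubes(2) r(1,3)]
  let ?B = "ball (0::real^2) r"
  have p1: "parallel (top_of_set ({a..b} \<times> ?B)) P e1 plane (\<lambda>(\<tau>, v). c1 \<tau> + v)"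
    and p2: "parallel (top_of_set ({b..c} \<times> ?B)) P e2 plane (\<lambda>(\<tau>, v). c2 \<tau> + v)"
    using t1 t2 by (simp_all add: tube_def)
  define e where "e = (\<lambda>(\<tau>, v). if \<tau> \<le> b then e1 (\<tau>, v) else e2 (\<tau>, v))"
  define d where "d = (\<lambda>\<tau>. if \<tau> \<le> b then c1 \<tau> else c2 \<tau> + (c1 b - c2 b))"
  have agree: "e1 (b, v) = e2 (b, v)" if "v \<in> ?B" for v
  proof -
    have \<kappa>: "continuous_map (top_of_set ?B) (top_of_set (S \<times> ?B)) (\<lambda>v. (b, v))" if "b \<in> S" for S
      using that by (auto simp: continuous_map_in_subtopology intro!: continuous_intros)
    let ?Q1 = "top_of_set ?B"
    have q1: "parallel ?Q1 P (e1 \<circ> Pair b) plane ((\<lambda>(\<tau>, v). c1 \<tau> + v) \<circ> Pair b)"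
      using parallel_compose[OF p1 \<kappa>] ab by simp
    have q2: "parallel ?Q1 P (e2 \<circ> Pair b) plane ((\<lambda>(\<tau>, v). c2 \<tau> + v) \<circ> Pair b)"
      using parallel_compose[OF p2 \<kappa>] ab by simp
    have "parallel ?Q1 plane (\<lambda>v. c1 b + v + (c2 b - c1 b)) plane (\<lambda>v. c1 b + v)"
      by (rule parallel_plane_shift) (auto intro!: continuous_intros)
    then have q3: "parallel ?Q1 plane ((\<lambda>(\<tau>, v). c2 \<tau> + v) \<circ> Pair b) plane ((\<lambda>(\<tau>, v). c1 \<tau> + v) \<circ> Pair b)"
      by (rule parallel_cong) simp_all
    have "(e1 \<circ> Pair b) v = (e2 \<circ> Pair b) v"
    proof (rule parallel_unique[OF P flat_plane q1 parallel_trans[OF P flat_plane flat_plane q2 q3]])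
      show "connected_space ?Q1" by (simp add: connected_space_subtopology)
      show "(e1 \<circ> Pair b) 0 = (e2 \<circ> Pair b) 0" using t1 t2 ab by (simp add: tube_def)
    qed (use that r in auto)
    then show ?thesis by simp
  qed
  have "parallel (top_of_set ({a..c} \<times> ?B)) P e plane (\<lambda>(\<tau>, v). d \<tau> + v)"
  proof (rule parallel_Un[OF P flat_plane])
    let ?K = "top_of_set ({a..c} \<times> ?B)"
    show "topspace ?K = ({a..b} \<times> ?B) \<union> ({b..c} \<times> ?B)" using ab by auto
    have "closedin ?K (({a..c} \<times> ?B) \<inter> ({a..b} \<times> UNIV))"
      by (rule closedin_closed_Int) (simp add: closed_Times)
    moreover have "({a..c} \<times> ?B) \<inter> ({a..b} \<times> UNIV) = {a..b} \<times> ?B" using ab by auto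
    ultimately show "closedin ?K ({a..b} \<times> ?B)" by simp
    have "closedin ?K (({a..c} \<times> ?B) \<inter> ({b..c} \<times> UNIV))"
      by (rule closedin_closed_Int) (simp add: closed_Times)
    moreover have "({a..c} \<times> ?B) \<inter> ({b..c} \<times> UNIV) = {b..c} \<times> ?B" using ab by auto
    ultimately show "closedin ?K ({b..c} \<times> ?B)" by simp
    have s1: "subtopology ?K ({a..b} \<times> ?B) = top_of_set ({a..b} \<times> ?B)"
      and s2: "subtopology ?K ({b..c} \<times> ?B) = top_of_set ({b..c} \<times> ?B)"
      using ab by (auto simp: subtopology_subtopology intro!: arg_cong[where f = "subtopology euclidean"])
    show "parallel (subtopology ?K ({a..b} \<times> ?B)) P e plane (\<lambda>(\<tau>, v). d \<tau> + v)"
      unfolding s1 by (rule parallel_cong[OF p1]) (auto simp: e_def d_def)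
    have "parallel (top_of_set ({b..c} \<times> ?B)) plane (\<lambda>k. (case k of (\<tau>, v) \<Rightarrow> c2 \<tau> + v) + (c1 b - c2 b)) plane (\<lambda>(\<tau>, v). c2 \<tau> + v)"
      by (rule parallel_plane_shift) (use parallel_continuous(2)[OF p2] in simp)
    from parallel_trans[OF P flat_plane flat_plane p2 parallel_sym[OF this]]
    show "parallel (subtopology ?K ({b..c} \<times> ?B)) P e plane (\<lambda>(\<tau>, v). d \<tau> + v)"
      unfolding s2 by (rule parallel_cong) (auto simp: e_def d_def agree)
  qed
  moreover have "continuous_on {a..c} d"
  proof -
    have "continuous_on ({a..b} \<union> {b..c}) (\<lambda>\<tau>. if \<tau> \<le> b then c1 \<tau> else c2 \<tau> + (c1 b - c2 b))"
      using t1 t2 by (intro continuous_on_If) (auto simp: tube_def intro!: continuous_intros)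
    then show ?thesis using ab by (simp add: d_def ivl_disj_un_two_touch)
  qed
  moreover have "\<forall>\<tau>\<in>{a..c}. e (\<tau>, 0) = \<alpha> \<tau>" using t1 t2 by (auto simp: e_def tube_def)
  moreover have "e ` ({a..c} \<times> ?B) \<subseteq> W"
  proof -
    have "e1 (\<tau>, v) \<in> W" if "a \<le> \<tau>" "\<tau> \<le> b" "v \<in> ?B" for \<tau> v
      using t1 that by (auto simp: tube_def image_subset_iff)
    moreover have "e2 (\<tau>, v) \<in> W" if "b \<le> \<tau>" "\<tau> \<le> c" "v \<in> ?B" for \<tau> v
      using t2 that by (auto simp: tube_def image_subset_iff)
    ultimately show ?thesis by (auto simp: e_def)
  qed
  ultimately have "tube P W \<alpha> a c r e d" using r(1) by (simp add: tube_def)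
  then show ?thesis by blast
qed

text \<open>Short pieces of the path lie in one chart, where translation is addition of vectors; by compactness of
the interval finitely many pieces can be joined.\<close>

lemma tube_exists:
  assumes P: "flat_surface P" and W: "openin (surface_top P) W"
    and \<alpha>: "continuous_map (top_of_set {s..t}) (subtopology (surface_top P) W) \<alpha>" and st: "s \<le> t"
  obtains r e a where "tube P W \<alpha> s t r e a"
proof -
  have "s \<le> s \<and> t \<le> t \<longrightarrow> (\<exists>r e c. tube P W \<alpha> s t r e c)"
  proof (rule Bolzano[OF st, where P = "\<lambda>a b. s \<le> a \<and> b \<le> t \<longrightarrow> (\<exists>r e c. tube P W \<alpha> a b r e c)"])
    fix a b c assume *: "s \<le> a \<and> b \<le> t \<longrightarrow> (\<exists>r e d. tube P W \<alpha> a b r e d)"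
      "s \<le> b \<and> c \<le> t \<longrightarrow> (\<exists>r e d. tube P W \<alpha> b c r e d)" "a \<le> b" "b \<le> c"
    show "s \<le> a \<and> c \<le> t \<longrightarrow> (\<exists>r e d. tube P W \<alpha> a c r e d)"
    proof
      assume "s \<le> a \<and> c \<le> t"
      then obtain r1 e1 d1 r2 e2 d2 where "tube P W \<alpha> a b r1 e1 d1" "tube P W \<alpha> b c r2 e2 d2"
        using * by fastforce
      then show "\<exists>r e d. tube P W \<alpha> a c r e d" by (rule tube_join[OF P *(3,4)])
    qed
  next
    fix x assume "s \<le> x" "x \<le> t"
    then have "x \<in> {s..t}" by simp
    then obtain d where "0 < d" "\<And>a b. a \<le> x \<Longrightarrow> x \<le> b \<Longrightarrow> b - a < d \<Longrightarrow> s \<le> a \<Longrightarrow> b \<le> t \<Longrightarrow> \<exists>r e c. tube P W \<alpha> a b r e c"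
      using tube_local[OF P W \<alpha>] by metis
    then show "\<exists>d>0. \<forall>a b. a \<le> x \<and> x \<le> b \<and> b - a < d \<longrightarrow> s \<le> a \<and> b \<le> t \<longrightarrow> (\<exists>r e c. tube P W \<alpha> a b r e c)"
      by blast
  qed
  then show thesis using that by blast
qed

text \<open>Developed paths are determined up to translation only.\<close>

lemma tube_normalize:
  assumes P: "flat_surface P" and tube: "tube P W \<alpha> s t r e a"
  shows "tube P W \<alpha> s t r e (\<lambda>\<tau>. a \<tau> - w)"
proof -
  let ?K = "{s..t} \<times> ball (0::real^2) r"
  have a: "continuous_on {s..t} a" using tube by (simp add: tube_def)
  have par: "parallel (top_of_set ?K) P e plane (\<lambda>(\<tau>, v). a \<tau> + v)" using tube by (simp add: tube_def)
  have "parallel (top_of_set ?K) P e plane (\<lambda>(\<tau>, v). (a \<tau> - w) + v)"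
  proof (rule parallel_shift[OF P parallel_cong[OF par]])
    show "continuous_map (top_of_set ?K) euclidean (\<lambda>(\<tau>, v). a \<tau> - w + v)"
      unfolding split_beta by (simp, intro continuous_intros continuous_on_compose2[OF a]) auto
  qed auto
  then show ?thesis using tube by (simp add: tube_def continuous_on_diff)
qed

text \<open>The main use of a tube: a map \<open>f\<close> into the plane that follows the developed path with an error less than the radius is lifted to the
surface as a family of short translates of points of the path.\<close>

lemma tube_parallel:
  fixes K :: "'k::topological_space set"
  assumes tube: "tube P W \<alpha> s t r e a"
    and \<tau>: "continuous_on K \<tau>" "\<And>k. k \<in> K \<Longrightarrow> \<tau> k \<in> {s..t}" and f: "continuous_on K f"
    and close: "\<And>k. k \<in> K \<Longrightarrow> norm (f k - a (\<tau> k)) < r"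
  shows "parallel (top_of_set K) P (\<lambda>k. e (\<tau> k, f k - a (\<tau> k))) plane f"
    and "k \<in> K \<Longrightarrow> e (\<tau> k, f k - a (\<tau> k)) \<in> W"
proof -
  have a: "continuous_on {s..t} a" and par: "parallel (top_of_set ({s..t} \<times> ball 0 r)) P e plane (\<lambda>(\<tau>, v). a \<tau> + v)"
    and im: "e ` ({s..t} \<times> ball 0 r) \<subseteq> W"
    using tube by (simp_all add: tube_def)
  have sub: "(\<lambda>k. (\<tau> k, f k - a (\<tau> k))) ` K \<subseteq> {s..t} \<times> ball 0 r" using \<tau>(2) close by auto
  have "continuous_on K (\<lambda>k. (\<tau> k, f k - a (\<tau> k)))"
    by (intro continuous_on_Pair continuous_on_diff \<tau>(1) f continuous_on_compose2[OF a \<tau>(1)]) (use \<tau>(2) in auto)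
  with sub have "continuous_map (top_of_set K) (top_of_set ({s..t} \<times> ball 0 r)) (\<lambda>k. (\<tau> k, f k - a (\<tau> k)))"
    by (auto simp: continuous_map_in_subtopology)
  from parallel_compose[OF par this]
  show "parallel (top_of_set K) P (\<lambda>k. e (\<tau> k, f k - a (\<tau> k))) plane f" by (rule parallel_cong) auto
  show "e (\<tau> k, f k - a (\<tau> k)) \<in> W" if "k \<in> K" using im sub that by blast
qed

section \<open>Disks in translation surfaces\<close>

text \<open>Invariance of domain for surfaces, by the classical theorem in charts.\<close>

lemma open_image_of_planar_embedding:
  fixes g :: "real^2 \<Rightarrow> 'a"
  assumes P: "flat_surface P" and B: "open B" and g: "continuous_map (top_of_set B) (surface_top P) g"
    and inj: "inj_on g B"
  shows "openin (surface_top P) (g ` B)"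
proof (subst openin_subopen, intro ballI)
  let ?X = "surface_top P"
  fix x assume "x \<in> g ` B"
  then obtain b where b: "b \<in> B" "x = g b" by blast
  have "x \<in> points P" using g b by (auto simp: continuous_map_def)
  then obtain U \<phi> where U: "(U, \<phi>) \<in> atlas P" "x \<in> U" using flat_chart_at[OF P] by metis
  obtain V h where V: "openin ?X V" "x \<in> V" "V \<subseteq> U \<inter> U" "open (\<phi> ` V)"
      and h: "homeomorphic_maps (subtopology ?X V) (top_of_set (\<phi> ` V)) \<phi> h"
    by (rule flat_chart_local_inverse[OF P U U(2) flat_chart_openin[OF P U(1)]])
  have VP: "V \<subseteq> points P" using V(1) by (rule openin_subset)
  have \<phi>c: "continuous_map (subtopology ?X V) euclidean \<phi>" and h\<phi>: "\<And>y. y \<in> V \<Longrightarrow> h (\<phi> y) = y"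
    using h VP by (auto simp: homeomorphic_maps_def continuous_map_in_subtopology)
  define N where "N = {b \<in> B. g b \<in> V}"
  have "openin (top_of_set B) N"
    using openin_continuous_map_preimage[OF g V(1)] by (simp add: N_def)
  then have N: "open N" using B openin_open_trans by blast
  have "continuous_map (top_of_set N) (subtopology ?X V) g"
    using continuous_map_from_subtopology_mono[OF g, of N] by (auto simp: N_def continuous_map_in_subtopology)
  from continuous_map_compose[OF this \<phi>c] have "continuous_on N (\<phi> \<circ> g)" by simp
  moreover have "inj_on (\<phi> \<circ> g) N"
  proof (rule inj_onI)
    fix x y assume xy: "x \<in> N" "y \<in> N" "(\<phi> \<circ> g) x = (\<phi> \<circ> g) y"
    then have "h (\<phi> (g x)) = h (\<phi> (g y))" by simp
    moreover have "h (\<phi> (g x)) = g x" "h (\<phi> (g y)) = g y" using xy(1,2) by (auto simp: N_def intro: h\<phi>)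
    ultimately have "g x = g y" by simp
    then show "x = y" using inj xy by (auto simp: N_def inj_on_def)
  qed
  ultimately have op: "open ((\<phi> \<circ> g) ` N)" using N by (intro invariance_of_domain)
  define T where "T = {y \<in> topspace (subtopology ?X V). \<phi> y \<in> (\<phi> \<circ> g) ` N}"
  have "openin (subtopology ?X V) T"
    unfolding T_def by (rule openin_continuous_map_preimage[OF \<phi>c]) (use op in simp)
  then have "openin ?X T" using V(1) by (rule openin_trans_full)
  moreover have "x \<in> T" using b V(2) VP by (auto simp: T_def N_def)
  moreover have "T \<subseteq> g ` B"
  proof
    fix y assume "y \<in> T"
    then obtain c where "c \<in> N" "\<phi> y = \<phi> (g c)" "y \<in> V" by (auto simp: T_def)
    then have "y = g c" using h\<phi> by (metis (no_types, lifting) N_def mem_Collect_eq)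
    then show "y \<in> g ` B" using \<open>c \<in> N\<close> by (auto simp: N_def)
  qed
  ultimately show "\<exists>T. openin ?X T \<and> x \<in> T \<and> T \<subseteq> g ` B" by blast
qed

lemma open_disk_openin:
  assumes P: "flat_surface P" and U: "open_disk P U"
  shows "openin (surface_top P) U"
proof -
  let ?X = "surface_top P"
  have UP: "U \<subseteq> points P"
    using U path_connectedin_subset_topspace unfolding open_disk_def PC_def by blast
  obtain f g where fg: "homeomorphic_maps (subtopology ?X U) (top_of_set (ball (0::real^2) 1)) f g"
    using U unfolding open_disk_def homeomorphic_space_def by blast
  have "g ` ball 0 1 = U"
  proof -
    have "homeomorphic_map (top_of_set (ball (0::real^2) 1)) (subtopology ?X U) g"
      using fg homeomorphic_maps_map by blast
    from homeomorphic_imp_surjective_map[OF this] show ?thesis using UP by auto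
  qed
  moreover have "openin ?X (g ` ball 0 1)"
  proof (rule open_image_of_planar_embedding[OF P])
    show "continuous_map (top_of_set (ball 0 1)) ?X g"
      using fg by (auto simp: homeomorphic_maps_def continuous_map_in_subtopology)
    show "inj_on g (ball 0 1)"
      using fg by (auto simp: homeomorphic_maps_def intro!: inj_on_inverseI[where g = f])
  qed auto
  ultimately show ?thesis by simp
qed

text \<open>By invariance of domain the interior contains the image of the open unit ball. In the coordinates of the closed
unit ball it therefore consists of the open ball and some boundary points, and any such set is star-shaped about the origin.\<close>

lemma closed_disk_interior_path_connected:
  assumes P: "flat_surface P" and D: "closed_disk P D"
  shows "path_connectedin (surface_top P) (surface_top P interior_of D)"
proof -
  let ?X = "surface_top P" and ?I = "surface_top P interior_of D"
  have DP: "D \<subseteq> points P" using D by (simp add: closed_disk_def)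
  obtain f g where fg: "homeomorphic_maps (subtopology ?X D) (top_of_set (cball (0::real^2) 1)) f g"
    using D unfolding closed_disk_def homeomorphic_space_def by blast
  have gc: "continuous_map (top_of_set (cball (0::real^2) 1)) ?X g" and gD: "g ` cball 0 1 \<subseteq> D"
    and gf: "\<And>y. y \<in> D \<Longrightarrow> g (f y) = y" and f1: "\<And>y. y \<in> D \<Longrightarrow> f y \<in> cball 0 1"
    and fgp: "\<And>p. p \<in> cball 0 1 \<Longrightarrow> f (g p) = p"
  proof -
    have tD: "topspace (subtopology ?X D) = D" using DP by (simp add: Int_absorb1)
    have g: "continuous_map (top_of_set (cball (0::real^2) 1)) (subtopology ?X D) g"
      and f: "continuous_map (subtopology ?X D) (top_of_set (cball (0::real^2) 1)) f"
      using fg by (simp_all only: homeomorphic_maps_def)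
    show "continuous_map (top_of_set (cball (0::real^2) 1)) ?X g"
      using g by (rule continuous_map_into_fulltopology)
    show "g ` cball 0 1 \<subseteq> D" using continuous_map_image_subset_topspace[OF g] tD by simp
    show "f y \<in> cball 0 1" if "y \<in> D" for y
      using continuous_map_image_subset_topspace[OF f] tD that by auto
    show "g (f y) = y" if "y \<in> D" for y using fg tD that by (simp only: homeomorphic_maps_def)
    show "f (g p) = p" if "p \<in> cball 0 1" for p
      using fg that unfolding homeomorphic_maps_def topspace_euclidean_subtopology by blast
  qed
  define C where "C = {p \<in> cball 0 1. g p \<in> ?I}"
  have gC: "g ` C = ?I"
  proof
    show "?I \<subseteq> g ` C"
    proof
      fix y assume y: "y \<in> ?I"
      have yD: "y \<in> D" using y interior_of_subset[of ?X D] by blast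
      have "f y \<in> C" unfolding C_def using y f1[OF yD] by (simp only: gf[OF yD] mem_Collect_eq)
      with gf[OF yD, symmetric] show "y \<in> g ` C" by (rule image_eqI)
    qed
  qed (auto simp: C_def)
  have "openin ?X (g ` ball 0 1)"
  proof (rule open_image_of_planar_embedding[OF P])
    show "continuous_map (top_of_set (ball 0 1)) ?X g"
      using continuous_map_from_subtopology_mono[OF gc] by (simp add: ball_subset_cball)
    show "inj_on g (ball 0 1)"
      by (rule inj_on_inverseI[where g = f]) (simp add: fgp)
  qed auto
  moreover have "g ` ball 0 1 \<subseteq> D" using gD ball_subset_cball by blast
  ultimately have "g ` ball 0 1 \<subseteq> ?I" by (rule interior_of_maximal[rotated])
  then have ballC: "ball 0 1 \<subseteq> C" by (auto simp: C_def)
  have "starlike C"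
    unfolding starlike_def
  proof (intro bexI[of _ 0] ballI)
    show "0 \<in> C" using ballC by auto
    fix x assume x: "x \<in> C"
    have "open_segment 0 x \<subseteq> interior (cball (0::real^2) 1)"
      by (rule in_interior_closure_convex_segment) (use x in \<open>auto simp: C_def\<close>)
    then show "closed_segment 0 x \<subseteq> C"
      using ballC x by (auto simp: closed_segment_eq_open)
  qed
  then have "path_connected C" by (rule starlike_imp_path_connected)
  moreover have "continuous_map (top_of_set C) ?X g"
    by (rule continuous_map_from_subtopology_mono[OF gc]) (auto simp: C_def)
  ultimately have "path_connectedin ?X (g ` topspace (top_of_set C))"
    by (intro path_connectedin_continuous_map_image[of "top_of_set C"]) (auto simp: path_connectedin_subtopology)
  then show ?thesis by (simp add: gC)
qed

text \<open>A map parallel to an injective planar map is itself locally injective, and invariance of domain applies.\<close>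

lemma parallel_plane_local_open:
  fixes C :: "(real^2) set"
  assumes P: "flat_surface P" and C: "open C" "p \<in> C" and par: "parallel (top_of_set C) P f plane g"
    and inj: "inj_on g C"
  obtains N where "open N" "p \<in> N" "N \<subseteq> C" "openin (surface_top P) (f ` N)"
proof -
  have p: "p \<in> topspace (top_of_set C)" using C by simp
  obtain U \<phi> V \<psi> N where N: "(U, \<phi>) \<in> atlas P" "(V, \<psi>) \<in> atlas plane" "openin (top_of_set C) N" "p \<in> N"
    "parallel_in_charts N U \<phi> f V \<psi> g"
    by (rule parallel_locally[OF par p])
  obtain c where c: "\<forall>k\<in>N. \<phi> (f k) - \<psi> (g k) = c"
    using N(5) unfolding parallel_in_charts_def by (elim conjE exE)
  have \<psi>: "\<psi> = (\<lambda>x. x)" using N(2) by simp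
  have NC: "N \<subseteq> C" "open N" using N(3) C(1) openin_open_trans openin_imp_subset by blast+
  have "inj_on f N"
  proof (rule inj_onI)
    fix x y assume xy: "x \<in> N" "y \<in> N" "f x = f y"
    have "\<phi> (f x) - g x = \<phi> (f y) - g y" using bspec[OF c xy(1)] bspec[OF c xy(2)] by (simp add: \<psi>)
    then have "g x = g y" using xy(3) by simp
    then show "x = y" using inj NC(1) xy(1,2) by (auto simp: inj_on_def)
  qed
  moreover have "continuous_map (top_of_set N) (surface_top P) f"
    using continuous_map_from_subtopology_mono[OF parallel_continuous(1)[OF par] NC(1)] .
  ultimately have "openin (surface_top P) (f ` N)"
    by (intro open_image_of_planar_embedding[OF P NC(2)])
  then show thesis using that NC N(4) by blast
qed

lemma path_connectedin_path:
  fixes s t :: real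
  assumes A: "path_connectedin X A" and xy: "x \<in> A" "y \<in> A" and st: "s < t"
  shows "\<exists>\<gamma>. continuous_map (top_of_set {s..t}) (subtopology X A) \<gamma> \<and> \<gamma> s = x \<and> \<gamma> t = y"
proof -
  obtain g where g: "pathin X g" "g \<in> {0..1} \<rightarrow> A" "g 0 = x" "g 1 = y"
    using A xy unfolding path_connectedin by blast
  have gc: "continuous_map (top_of_set {0..1::real}) (subtopology X A) g"
    using g(1,2) by (auto simp: pathin_def continuous_map_in_subtopology)
  have "continuous_map (top_of_set {s..t}) (top_of_set {0..1::real}) (\<lambda>\<tau>. (\<tau> - s) / (t - s))"
    using st by (auto simp: continuous_map_in_subtopology divide_simps intro!: continuous_intros)
  from continuous_map_compose[OF this gc] show ?thesis
    using st g(3,4) by (intro exI[of _ "g \<circ> (\<lambda>\<tau>. (\<tau> - s) / (t - s))"]) simp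
qed

section \<open>Isomorphisms\<close>

lemma flat_chart_subset: "flat_surface P \<Longrightarrow> (U, \<phi>) \<in> atlas P \<Longrightarrow> U \<subseteq> points P"
  using flat_chart_openin openin_subset by blast

text \<open>A pushed chart is described by its values at image points, so that the inverse of \<open>h\<close> disappears from the
arguments about isomorphisms.\<close>

lemma mem_push_atlas_iff:
  assumes P: "flat_surface P" and inj: "inj_on h (points P)"
  shows "(V, \<psi>) \<in> push_atlas (points P) h (atlas P) \<longleftrightarrow>
    (\<exists>U \<phi>. (U, \<phi>) \<in> atlas P \<and> V = h ` U \<and> \<psi> \<in> extensional V \<and> (\<forall>x\<in>U. \<psi> (h x) = \<phi> x))"
proof
  assume "(V, \<psi>) \<in> push_atlas (points P) h (atlas P)"
  then obtain U \<phi> where U: "(U, \<phi>) \<in> atlas P" "V = h ` U"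
      "\<psi> = restrict (\<phi> \<circ> inv_into (points P) h) (h ` U)"
    by (auto simp: push_atlas_def)
  moreover have "inv_into (points P) h (h x) = x" if "x \<in> U" for x
    using inv_into_f_f[OF inj] flat_chart_subset[OF P U(1)] that by blast
  ultimately show "\<exists>U \<phi>. (U, \<phi>) \<in> atlas P \<and> V = h ` U \<and> \<psi> \<in> extensional V \<and> (\<forall>x\<in>U. \<psi> (h x) = \<phi> x)"
    by (intro exI[of _ U] exI[of _ \<phi>]) simp
next
  assume "\<exists>U \<phi>. (U, \<phi>) \<in> atlas P \<and> V = h ` U \<and> \<psi> \<in> extensional V \<and> (\<forall>x\<in>U. \<psi> (h x) = \<phi> x)"
  then obtain U \<phi> where U: "(U, \<phi>) \<in> atlas P" "V = h ` U" "\<psi> \<in> extensional V" "\<forall>x\<in>U. \<psi> (h x) = \<phi> x"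
    by blast
  have "\<psi> = restrict (\<phi> \<circ> inv_into (points P) h) (h ` U)"
  proof
    fix y show "\<psi> y = restrict (\<phi> \<circ> inv_into (points P) h) (h ` U) y"
    proof (cases "y \<in> h ` U")
      case True
      then obtain x where x: "x \<in> U" "y = h x" by blast
      then have "inv_into (points P) h y = x"
        using inv_into_f_f[OF inj] flat_chart_subset[OF P U(1)] by blast
      then show ?thesis using True U(4) x by simp
    next
      case False
      then show ?thesis using U(2,3) by (simp add: extensional_def)
    qed
  qed
  then show "(V, \<psi>) \<in> push_atlas (points P) h (atlas P)"
    using U(1,2) unfolding push_atlas_def by (intro image_eqI[of _ _ "(U, \<phi>)"]) auto
qed

lemma isomorphism_iff:
  assumes P: "flat_surface P"
  shows "isomorphism P Q h \<longleftrightarrow>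
    homeomorphic_map (surface_top P) (surface_top Q) h \<and> h (basepoint P) = basepoint Q \<and>
    (\<forall>V \<psi>. (V, \<psi>) \<in> atlas Q \<longleftrightarrow>
      (\<exists>U \<phi>. (U, \<phi>) \<in> atlas P \<and> V = h ` U \<and> \<psi> \<in> extensional V \<and> (\<forall>x\<in>U. \<psi> (h x) = \<phi> x)))"
proof -
  have eq: "(atlas Q = push_atlas (points P) h (atlas P)) \<longleftrightarrow>
      (\<forall>V \<psi>. (V, \<psi>) \<in> atlas Q \<longleftrightarrow> (V, \<psi>) \<in> push_atlas (points P) h (atlas P))"
    by auto
  show ?thesis
  proof (cases "homeomorphic_map (surface_top P) (surface_top Q) h")
    case True
    show ?thesis
      unfolding isomorphism_def eq mem_push_atlas_iff[OF P homeomorphic_imp_injective_map[OF True]] ..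
  qed (simp add: isomorphism_def)
qed

lemma isomorphism_chart:
  assumes P: "flat_surface P" and iso: "isomorphism P Q h" and V: "(V, \<psi>) \<in> atlas Q"
  obtains U \<phi> where "(U, \<phi>) \<in> atlas P" "V = h ` U" "\<psi> \<in> extensional V" "\<forall>x\<in>U. \<psi> (h x) = \<phi> x"
  using iso V unfolding isomorphism_iff[OF P] by blast

lemma isomorphism_chartI:
  assumes "flat_surface P" "isomorphism P Q h" "(U, \<phi>) \<in> atlas P" "\<psi> \<in> extensional (h ` U)"
    "\<forall>x\<in>U. \<psi> (h x) = \<phi> x"
  shows "(h ` U, \<psi>) \<in> atlas Q"
  using assms(2-) unfolding isomorphism_iff[OF assms(1)] by blast

lemma isomorphism_push_chart:
  assumes P: "flat_surface P" and iso: "isomorphism P Q h" and U: "(U, \<phi>) \<in> atlas P"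
  obtains \<psi> where "(h ` U, \<psi>) \<in> atlas Q" "\<psi> \<in> extensional (h ` U)" "\<forall>x\<in>U. \<psi> (h x) = \<phi> x"
proof -
  have inj: "inj_on h (points P)"
    using iso homeomorphic_imp_injective_map unfolding isomorphism_def by blast
  define \<psi> where "\<psi> = restrict (\<phi> \<circ> inv_into (points P) h) (h ` U)"
  have "\<forall>x\<in>U. \<psi> (h x) = \<phi> x"
    using inv_into_f_f[OF inj] flat_chart_subset[OF P U] by (auto simp: \<psi>_def)
  moreover have "\<psi> \<in> extensional (h ` U)" by (simp add: \<psi>_def)
  ultimately show thesis using that isomorphism_chartI[OF P iso U] by blast
qed

lemma isomorphism_homeomorphic_map:
  "isomorphism P Q h \<Longrightarrow> homeomorphic_map (surface_top P) (surface_top Q) h"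
  by (simp add: isomorphism_def)

lemma isomorphism_inj_on: "isomorphism P Q h \<Longrightarrow> inj_on h (points P)"
  using homeomorphic_imp_injective_map unfolding isomorphism_def by blast

lemma isomorphism_image: "isomorphism P Q h \<Longrightarrow> h ` points P = points Q"
  using homeomorphic_imp_surjective_map unfolding isomorphism_def by blast

lemma isomorphism_id:
  assumes P: "flat_surface P" shows "isomorphism P P id"
  unfolding isomorphism_iff[OF P]
proof (intro conjI allI)
  fix V \<psi>
  show "(V, \<psi>) \<in> atlas P \<longleftrightarrow> (\<exists>U \<phi>. (U, \<phi>) \<in> atlas P \<and> V = id ` U \<and> \<psi> \<in> extensional V \<and> (\<forall>x\<in>U. \<psi> (id x) = \<phi> x))"
  proof
    assume "(V, \<psi>) \<in> atlas P"
    then show "\<exists>U \<phi>. (U, \<phi>) \<in> atlas P \<and> V = id ` U \<and> \<psi> \<in> extensional V \<and> (\<forall>x\<in>U. \<psi> (id x) = \<phi> x)"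
      using flat_chart_extensional[OF P] by auto
  next
    assume "\<exists>U \<phi>. (U, \<phi>) \<in> atlas P \<and> V = id ` U \<and> \<psi> \<in> extensional V \<and> (\<forall>x\<in>U. \<psi> (id x) = \<phi> x)"
    then obtain \<phi> where "(V, \<phi>) \<in> atlas P" "\<psi> \<in> extensional V" "\<forall>x\<in>V. \<psi> x = \<phi> x" by auto
    moreover from this have "\<psi> = \<phi>" using flat_chart_extensional[OF P] extensionalityI by metis
    ultimately show "(V, \<psi>) \<in> atlas P" by simp
  qed
qed auto

lemma isomorphism_sym:
  assumes P: "flat_surface P" and Q: "flat_surface Q" and iso: "isomorphism P Q h"
  shows "isomorphism Q P (inv_into (points P) h)"
  unfolding isomorphism_iff[OF Q]
proof (intro conjI allI)
  let ?k = "inv_into (points P) h"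
  have k: "?k (h x) = x" if "x \<in> points P" for x
    using inv_into_f_f[OF isomorphism_inj_on[OF iso] that] .
  obtain g where g: "homeomorphic_maps (surface_top P) (surface_top Q) h g"
    using isomorphism_homeomorphic_map[OF iso] homeomorphic_map_maps by blast
  have "homeomorphic_map (surface_top Q) (surface_top P) g"
    using g homeomorphic_maps_map by blast
  moreover have "g y = ?k y" if "y \<in> points Q" for y
  proof -
    have "y \<in> h ` points P" using isomorphism_image[OF iso] that by simp
    then obtain x where x: "y = h x" "x \<in> points P" by (rule imageE)
    have "g (h x) = x" using g x(2) unfolding homeomorphic_maps_def by blast
    then show ?thesis using k[OF x(2)] x(1) by (simp only:)
  qed
  ultimately show "homeomorphic_map (surface_top Q) (surface_top P) ?k" by (rule homeomorphic_map_eq)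
  show "?k (basepoint Q) = basepoint P"
    using k[OF flat_basepoint[OF P]] iso by (simp add: isomorphism_def)
  fix U \<phi>
  show "(U, \<phi>) \<in> atlas P \<longleftrightarrow>
    (\<exists>V \<psi>. (V, \<psi>) \<in> atlas Q \<and> U = ?k ` V \<and> \<phi> \<in> extensional U \<and> (\<forall>y\<in>V. \<phi> (?k y) = \<psi> y))"
  proof
    assume U: "(U, \<phi>) \<in> atlas P"
    have kU: "?k (h x) = x" if "x \<in> U" for x using k flat_chart_subset[OF P U] that by blast
    obtain \<psi> where \<psi>: "(h ` U, \<psi>) \<in> atlas Q" "\<psi> \<in> extensional (h ` U)" "\<forall>x\<in>U. \<psi> (h x) = \<phi> x"
      by (rule isomorphism_push_chart[OF P iso U])
    have "U = ?k ` h ` U" using kU by (force simp: image_image)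
    moreover have "\<forall>y\<in>h ` U. \<phi> (?k y) = \<psi> y" using kU \<psi>(3) by auto
    ultimately show "\<exists>V \<psi>. (V, \<psi>) \<in> atlas Q \<and> U = ?k ` V \<and> \<phi> \<in> extensional U \<and> (\<forall>y\<in>V. \<phi> (?k y) = \<psi> y)"
      using \<psi>(1) flat_chart_extensional[OF P U] by blast
  next
    assume "\<exists>V \<psi>. (V, \<psi>) \<in> atlas Q \<and> U = ?k ` V \<and> \<phi> \<in> extensional U \<and> (\<forall>y\<in>V. \<phi> (?k y) = \<psi> y)"
    then obtain V \<psi> where V: "(V, \<psi>) \<in> atlas Q" "U = ?k ` V" "\<phi> \<in> extensional U" "\<forall>y\<in>V. \<phi> (?k y) = \<psi> y"
      by blast
    obtain U' \<phi>' where U': "(U', \<phi>') \<in> atlas P" "V = h ` U'" "\<forall>x\<in>U'. \<psi> (h x) = \<phi>' x"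
      by (rule isomorphism_chart[OF P iso V(1)])
    have kU: "?k (h x) = x" if "x \<in> U'" for x using k flat_chart_subset[OF P U'(1)] that by blast
    have "U = U'" using V(2) U'(2) kU by (force simp: image_image)
    moreover have "\<phi> = \<phi>'"
    proof (rule extensionalityI)
      show "\<phi> \<in> extensional U" "\<phi>' \<in> extensional U"
        using V(3) flat_chart_extensional[OF P U'(1)] \<open>U = U'\<close> by auto
      fix x assume "x \<in> U"
      then have x: "x \<in> U'" using \<open>U = U'\<close> by simp
      have "\<phi> (?k (h x)) = \<psi> (h x)" using V(4) U'(2) x by blast
      then show "\<phi> x = \<phi>' x" using U'(3) kU[OF x] x by simp
    qed
    ultimately show "(U, \<phi>) \<in> atlas P" using U'(1) by simp
  qed
qed

lemma isomorphism_trans: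
  assumes P: "flat_surface P" and Q: "flat_surface Q" and iso: "isomorphism P Q h" "isomorphism Q R g"
  shows "isomorphism P R (g \<circ> h)"
  unfolding isomorphism_iff[OF P]
proof (intro conjI allI)
  show "homeomorphic_map (surface_top P) (surface_top R) (g \<circ> h)"
    by (rule homeomorphic_map_compose[OF iso[THEN isomorphism_homeomorphic_map]])
  show "(g \<circ> h) (basepoint P) = basepoint R" using iso by (simp add: isomorphism_def)
  fix W \<xi>
  show "(W, \<xi>) \<in> atlas R \<longleftrightarrow>
    (\<exists>U \<phi>. (U, \<phi>) \<in> atlas P \<and> W = (g \<circ> h) ` U \<and> \<xi> \<in> extensional W \<and> (\<forall>x\<in>U. \<xi> ((g \<circ> h) x) = \<phi> x))"
  proof
    assume W: "(W, \<xi>) \<in> atlas R"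
    obtain V \<psi> where V: "(V, \<psi>) \<in> atlas Q" "W = g ` V" "\<xi> \<in> extensional W" "\<forall>x\<in>V. \<xi> (g x) = \<psi> x"
      by (rule isomorphism_chart[OF Q iso(2) W])
    obtain U \<phi> where U: "(U, \<phi>) \<in> atlas P" "V = h ` U" "\<forall>x\<in>U. \<psi> (h x) = \<phi> x"
      by (rule isomorphism_chart[OF P iso(1) V(1)])
    show "\<exists>U \<phi>. (U, \<phi>) \<in> atlas P \<and> W = (g \<circ> h) ` U \<and> \<xi> \<in> extensional W \<and> (\<forall>x\<in>U. \<xi> ((g \<circ> h) x) = \<phi> x)"
      using U V by (intro exI[of _ U] exI[of _ \<phi>]) (simp add: image_image)
  next
    assume "\<exists>U \<phi>. (U, \<phi>) \<in> atlas P \<and> W = (g \<circ> h) ` U \<and> \<xi> \<in> extensional W \<and> (\<forall>x\<in>U. \<xi> ((g \<circ> h) x) = \<phi> x)"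
    then obtain U \<phi> where U: "(U, \<phi>) \<in> atlas P" "W = (g \<circ> h) ` U" "\<xi> \<in> extensional W" "\<forall>x\<in>U. \<xi> ((g \<circ> h) x) = \<phi> x"
      by blast
    obtain \<psi> where \<psi>: "(h ` U, \<psi>) \<in> atlas Q" "\<forall>x\<in>U. \<psi> (h x) = \<phi> x"
      by (rule isomorphism_push_chart[OF P iso(1) U(1)])
    have W: "W = g ` h ` U" using U(2) by (simp add: image_image)
    show "(W, \<xi>) \<in> atlas R"
      using isomorphism_chartI[OF Q iso(2) \<psi>(1)] U(3,4) \<psi>(2) unfolding W by simp
  qed
qed

lemma flat_isomorphic:
  assumes P: "flat_surface P" and iso: "isomorphism P Q h"
  shows "flat_surface Q"
proof -
  let ?X = "surface_top P" and ?Y = "surface_top Q"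
  note hom = isomorphism_homeomorphic_map[OF iso]
  have inj: "inj_on h (points P)" by (rule isomorphism_inj_on[OF iso])
  have hopen: "openin ?Y (h ` U)" if "openin ?X U" for U
    using homeomorphic_map_openness[OF hom openin_subset[OF that]] that by simp
  obtain k where k: "homeomorphic_maps ?X ?Y h k" using hom homeomorphic_map_maps by blast
  then have khom: "homeomorphic_map ?Y ?X k" using homeomorphic_maps_map by blast
  have kh: "k (h x) = x" if "x \<in> points P" for x using k that by (simp add: homeomorphic_maps_def)
  have local: "local_homeomorphism_on ?Y V \<psi>" if V: "(V, \<psi>) \<in> atlas Q" for V \<psi>
    unfolding local_homeomorphism_on_def
  proof
    fix y assume y: "y \<in> V"
    obtain U \<phi> where U: "(U, \<phi>) \<in> atlas P" "V = h ` U" "\<forall>x\<in>U. \<psi> (h x) = \<phi> x"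
      by (rule isomorphism_chart[OF P iso V])
    then obtain x where x: "x \<in> U" "y = h x" using y by blast
    obtain W where W: "openin ?X W" "x \<in> W" "W \<subseteq> U" "open (\<phi> ` W)"
        "homeomorphic_map (subtopology ?X W) (top_of_set (\<phi> ` W)) \<phi>"
      using flat_chart_local_homeomorphism[OF P U(1)] x(1) unfolding local_homeomorphism_on_def by meson
    have WP: "W \<subseteq> points P" using W(1) by (rule openin_subset)
    have im: "\<psi> ` h ` W = \<phi> ` W" unfolding image_image using U(3) W(3) by (intro image_cong) auto
    have "k ` (topspace ?Y \<inter> h ` W) = topspace ?X \<inter> W"
    proof -
      have "h ` W \<subseteq> points Q" using image_mono[OF WP, of h] isomorphism_image[OF iso] by simp
      moreover have "k ` h ` W = (\<lambda>x. x) ` W"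
        unfolding image_image by (rule image_cong) (use kh WP in auto)
      ultimately show ?thesis using WP by (simp add: Int_absorb1)
    qed
    then have "homeomorphic_map (subtopology ?Y (h ` W)) (subtopology ?X W) k"
      by (rule homeomorphic_map_subtopologies[OF khom])
    from homeomorphic_map_compose[OF this W(5)]
    have "homeomorphic_map (subtopology ?Y (h ` W)) (top_of_set (\<phi> ` W)) (\<phi> \<circ> k)" .
    then have "homeomorphic_map (subtopology ?Y (h ` W)) (top_of_set (\<phi> ` W)) \<psi>"
    proof (rule homeomorphic_map_eq)
      fix z assume "z \<in> topspace (subtopology ?Y (h ` W))"
      then obtain w where w: "w \<in> W" "z = h w" by auto
      then have "k z = w" "\<psi> z = \<phi> w" using kh WP U(3) W(3) by auto
      then show "(\<phi> \<circ> k) z = \<psi> z" by simp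
    qed
    then show "\<exists>V'. openin ?Y V' \<and> y \<in> V' \<and> V' \<subseteq> V \<and> open (\<psi> ` V') \<and>
       homeomorphic_map (subtopology ?Y V') (top_of_set (\<psi> ` V')) \<psi>"
      using hopen[OF W(1)] W x U(2) im by (intro exI[of _ "h ` W"]) auto
  qed
  have compat: "\<exists>W. openin ?Y W \<and> y \<in> W \<and> W \<subseteq> V1 \<inter> V2 \<and> (\<forall>z\<in>W. \<psi>1 z - \<psi>2 z = \<psi>1 y - \<psi>2 y)"
    if V: "(V1, \<psi>1) \<in> atlas Q" "(V2, \<psi>2) \<in> atlas Q" and y: "y \<in> V1 \<inter> V2" for V1 \<psi>1 V2 \<psi>2 y
  proof -
    obtain U1 \<phi>1 where U1: "(U1, \<phi>1) \<in> atlas P" "V1 = h ` U1" "\<forall>x\<in>U1. \<psi>1 (h x) = \<phi>1 x"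
      by (rule isomorphism_chart[OF P iso V(1)])
    obtain U2 \<phi>2 where U2: "(U2, \<phi>2) \<in> atlas P" "V2 = h ` U2" "\<forall>x\<in>U2. \<psi>2 (h x) = \<phi>2 x"
      by (rule isomorphism_chart[OF P iso V(2)])
    obtain x where x: "x \<in> U1" "y = h x" using U1 y by blast
    moreover obtain x' where "x' \<in> U2" "y = h x'" using U2 y by blast
    ultimately have x2: "x \<in> U2"
      using inj flat_chart_subset[OF P U1(1)] flat_chart_subset[OF P U2(1)] by (metis inj_onD subsetD)
    obtain W where W: "openin ?X W" "x \<in> W" "W \<subseteq> U1 \<inter> U2" "\<forall>y\<in>W. \<phi>1 y - \<phi>2 y = \<phi>1 x - \<phi>2 x"
      by (rule flat_charts_compatible[OF P U1(1) U2(1) x(1) x2])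
    have "\<psi>1 (h w) - \<psi>2 (h w) = \<psi>1 y - \<psi>2 y" if "w \<in> W" for w
    proof -
      have "w \<in> U1" "w \<in> U2" using that W(3) by auto
      then have "\<psi>1 (h w) - \<psi>2 (h w) = \<phi>1 w - \<phi>2 w" using U1(3) U2(3) by simp
      also have "\<dots> = \<phi>1 x - \<phi>2 x" by (rule bspec[OF W(4) that])
      also have "\<dots> = \<psi>1 y - \<psi>2 y" using U1(3) U2(3) x x2 by simp
      finally show ?thesis .
    qed
    then have "\<forall>z\<in>h ` W. \<psi>1 z - \<psi>2 z = \<psi>1 y - \<psi>2 y" by (metis (no_types, lifting) imageE)
    then show ?thesis using hopen[OF W(1)] W(2,3) x(2) U1(2) U2(2) by (intro exI[of _ "h ` W"] conjI) blast+
  qed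
  show ?thesis
    unfolding flat_surface_def
  proof (intro conjI)
    show "Hausdorff_space ?Y"
      using flat_Hausdorff[OF P] homeomorphic_Hausdorff_space[OF homeomorphic_map_imp_homeomorphic_space[OF hom]] by simp
    show "basepoint Q \<in> points Q"
      using imageI[OF flat_basepoint[OF P], of h] iso by (simp add: isomorphism_image[OF iso] isomorphism_def)
    show "\<forall>(V, \<psi>)\<in>atlas Q. openin ?Y V \<and> \<psi> \<in> extensional V \<and> local_homeomorphism_on ?Y V \<psi>"
    proof (intro ballI case_prodI2 conjI)
      fix V \<psi> c assume c: "c \<in> atlas Q" "c = (V, \<psi>)"
      then have V: "(V, \<psi>) \<in> atlas Q" by simp
      obtain U \<phi> where U: "(U, \<phi>) \<in> atlas P" "V = h ` U" "\<psi> \<in> extensional V"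
        by (rule isomorphism_chart[OF P iso V])
      show "openin ?Y V" using hopen flat_chart_openin[OF P U(1)] U(2) by simp
      show "\<psi> \<in> extensional V" by fact
      show "local_homeomorphism_on ?Y V \<psi>" by (rule local[OF V])
    qed
    show "(\<Union>(V, \<psi>)\<in>atlas Q. V) = points Q"
    proof
      show "(\<Union>(V, \<psi>)\<in>atlas Q. V) \<subseteq> points Q"
      proof clarify
        fix y V \<psi> assume "(V, \<psi>) \<in> atlas Q" and y: "y \<in> V"
        from isomorphism_chart[OF P iso this(1)] obtain U \<phi> where U: "(U, \<phi>) \<in> atlas P" "V = h ` U" .
        then have "y \<in> h ` points P" using y image_mono[OF flat_chart_subset[OF P U(1)], of h] by blast
        then show "y \<in> points Q" by (simp add: isomorphism_image[OF iso])
      qed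
      show "points Q \<subseteq> (\<Union>(V, \<psi>)\<in>atlas Q. V)"
      proof
        fix y assume "y \<in> points Q"
        then have "y \<in> h ` points P" using isomorphism_image[OF iso] by simp
        then obtain x where x: "y = h x" "x \<in> points P" by (rule imageE)
        obtain U \<phi> where U: "(U, \<phi>) \<in> atlas P" "x \<in> U" by (rule flat_chart_at[OF P x(2)])
        obtain \<psi> where "(h ` U, \<psi>) \<in> atlas Q" by (rule isomorphism_push_chart[OF P iso U(1)])
        then show "y \<in> (\<Union>(V, \<psi>)\<in>atlas Q. V)" using U(2) x(1) by blast
      qed
    qed
    show "\<forall>(V1, \<psi>1)\<in>atlas Q. \<forall>(V2, \<psi>2)\<in>atlas Q. \<forall>y\<in>V1 \<inter> V2.
       \<exists>W. openin ?Y W \<and> y \<in> W \<and> W \<subseteq> V1 \<inter> V2 \<and> (\<forall>z\<in>W. \<psi>1 z - \<psi>2 z = \<psi>1 y - \<psi>2 y)"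
    proof (intro ballI case_prodI2)
      fix V1 \<psi>1 V2 \<psi>2 c d y assume "c \<in> atlas Q" "c = (V1, \<psi>1)" "d \<in> atlas Q" "d = (V2, \<psi>2)" "y \<in> V1 \<inter> V2"
      then show "\<exists>W. openin ?Y W \<and> y \<in> W \<and> W \<subseteq> V1 \<inter> V2 \<and> (\<forall>z\<in>W. \<psi>1 z - \<psi>2 z = \<psi>1 y - \<psi>2 y)"
        by (intro compat) simp_all
    qed
  qed
qed

text \<open>The coordinates of a point in a chart and of its image in the pushed chart are the same.\<close>

lemma isomorphism_parallel:
  assumes P: "flat_surface P" and iso: "isomorphism P Q h"
  shows "parallel (surface_top P) P id Q h"
proof (rule parallelI)
  show "continuous_map (surface_top P) (surface_top P) id" by simp
  show "continuous_map (surface_top P) (surface_top Q) h"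
    using isomorphism_homeomorphic_map[OF iso] by (rule homeomorphic_imp_continuous_map)
  fix x assume x: "x \<in> points P"
  obtain U \<phi> where U: "(U, \<phi>) \<in> atlas P" "x \<in> U" by (rule flat_chart_at[OF P x])
  obtain \<psi> where \<psi>: "(h ` U, \<psi>) \<in> atlas Q" "\<forall>x\<in>U. \<psi> (h x) = \<phi> x"
    by (rule isomorphism_push_chart[OF P iso U(1)])
  have "parallel_in_charts U U \<phi> id (h ` U) \<psi> h"
    unfolding parallel_in_charts_def using \<psi>(2) by (intro conjI exI[of _ 0]) auto
  then show "\<exists>U \<phi> V \<psi> N. (U, \<phi>) \<in> atlas P \<and> (V, \<psi>) \<in> atlas Q \<and> openin (surface_top P) N \<and> x \<in> N \<and>
      parallel_in_charts N U \<phi> id V \<psi> h"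
    using U \<psi>(1) flat_chart_openin[OF P U(1)] by blast
qed

text \<open>An automorphism is parallel to the identity and agrees with it at the basepoint.\<close>

lemma automorphism_trivial:
  assumes P: "flat_surface P" and conn: "connected_space (surface_top P)"
    and iso: "isomorphism P P h" and x: "x \<in> points P"
  shows "h x = x"
proof -
  have "h x = id x"
  proof (rule parallel_unique[OF P P _ _ conn flat_basepoint[OF P] _ x])
    show "parallel (surface_top P) P h P id" by (rule parallel_sym[OF isomorphism_parallel[OF P iso]])
    show "parallel (surface_top P) P id P id" by (rule isomorphism_parallel[OF P isomorphism_id[OF P]])
    show "h (basepoint P) = id (basepoint P)" using iso by (simp add: isomorphism_def)
  qed
  then show ?thesis by simp
qed

lemma homeomorphic_map_pullback:
  assumes inj: "inj_on h (topspace X)"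
  shows "homeomorphic_map X (pullback_topology (h ` topspace X) (inv_into (topspace X) h) X) h"
proof -
  let ?Y = "pullback_topology (h ` topspace X) (inv_into (topspace X) h) X"
  have kh: "inv_into (topspace X) h (h x) = x" if "x \<in> topspace X" for x
    using inv_into_f_f[OF inj that] .
  have "continuous_map X ?Y h"
  proof (rule continuous_map_pullback')
    show "continuous_map X X (inv_into (topspace X) h \<circ> h)"
      by (rule continuous_map_eq[OF continuous_map_id]) (simp add: kh)
  qed auto
  moreover have "continuous_map ?Y X (inv_into (topspace X) h)"
    using continuous_map_pullback[OF continuous_map_id, of "h ` topspace X" "inv_into (topspace X) h" X]
    by (simp only: id_comp)
  moreover have "topspace ?Y = h ` topspace X"
    using kh by (auto simp: topspace_pullback_topology)
  ultimately have "homeomorphic_maps X ?Y h (inv_into (topspace X) h)"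
    using kh by (auto simp: homeomorphic_maps_def)
  then show ?thesis using homeomorphic_map_maps by blast
qed

lemma isomorphism_push_surface:
  assumes "inj_on h (points P)"
  shows "isomorphism P (push_surface h P) h"
  using homeomorphic_map_pullback[OF assms] by (simp add: isomorphism_def push_surface_def)

section \<open>Fibers of the projection\<close>

lemma pointed_translation_structure_connected:
  "pointed_translation_structure P \<Longrightarrow> connected_space (surface_top P)"
  unfolding pointed_translation_structure_def translation_structure_def oriented_surface_def by blast

lemma mem_iso_class_self: "pointed_translation_structure P \<Longrightarrow> P \<in> iso_class P"
  using isomorphism_id flat_surface_if_translation_structure unfolding iso_class_def by blast

lemma iso_class_eq:
  assumes P: "pointed_translation_structure P" and Q: "Q \<in> iso_class P"
  shows "iso_class Q = iso_class P"
proof -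
  have PQ: "flat_surface P" "flat_surface Q" and ptsQ: "pointed_translation_structure Q"
    using P Q flat_surface_if_translation_structure unfolding iso_class_def by auto
  obtain h where h: "isomorphism P Q h" using Q unfolding iso_class_def by blast
  note h' = isomorphism_sym[OF PQ h]
  have "(\<exists>f. isomorphism Q R f) \<longleftrightarrow> (\<exists>f. isomorphism P R f)" for R
    using isomorphism_trans[OF PQ h] isomorphism_trans[OF PQ(2,1) h'] by blast
  then show ?thesis unfolding iso_class_def by blast
qed

text \<open>If two points define the same class, an automorphism takes one to the other.\<close>

lemma inj_on_iso_class_point:
  assumes P: "pointed_translation_structure P"
  shows "inj_on (iso_class_point P) (points P)"
proof (rule inj_onI)
  note flat = flat_surface_if_translation_structure[OF P]
  fix x y assume xy: "x \<in> points P" "y \<in> points P" "iso_class_point P x = iso_class_point P y"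
  have "(P, x) \<in> iso_class_point P x"
    using P xy(1) isomorphism_id[OF flat] unfolding iso_class_point_def by auto
  then obtain h where "isomorphism P P h" "h y = x"
    unfolding xy(3) unfolding iso_class_point_def by blast
  then show "x = y"
    using automorphism_trivial[OF flat pointed_translation_structure_connected[OF P]] xy(2) by metis
qed

lemma proj_iso_class_point:
  assumes x: "x \<in> points P"
  shows "proj (iso_class_point P x) = iso_class P"
proof -
  have "h x \<in> points Q" if "isomorphism P Q h" for Q h
    using isomorphism_image[OF that] x by blast
  then show ?thesis unfolding proj_def iso_class_point_def iso_class_def by force
qed

lemma fiber_isomorphism:
  assumes S: "S \<in> \<M>"
  obtains P where "pointed_translation_structure P" "iso_class P = S" "isomorphism P (fiber S) (iso_class_point P)"
proof -
  obtain P0 where P0: "pointed_translation_structure P0" "S = iso_class P0"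
    using S unfolding moduli_def by blast
  define P where "P = (SOME P. P \<in> S)"
  have PS: "P \<in> S" unfolding P_def using mem_iso_class_self[OF P0(1)] P0(2) someI_ex by metis
  then have P: "pointed_translation_structure P" unfolding P0(2) iso_class_def by blast
  moreover have "iso_class P = S" using iso_class_eq[OF P0(1)] PS P0(2) by simp
  moreover have "isomorphism P (fiber S) (iso_class_point P)"
    using isomorphism_push_surface[OF inj_on_iso_class_point[OF P]]
    by (simp add: fiber_def Let_def flip: P_def)
  ultimately show thesis by (rule that)
qed

lemma flat_fiber:
  assumes "S \<in> \<M>" shows "flat_surface (fiber S)"
proof -
  obtain P where "pointed_translation_structure P" "isomorphism P (fiber S) (iso_class_point P)"
    by (rule fiber_isomorphism[OF assms])
  then show ?thesis using flat_isomorphic flat_surface_if_translation_structure by blast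
qed

lemma points_fiber:
  assumes S: "S \<in> \<M>" and e: "e \<in> points (fiber S)"
  shows "e \<in> \<E>" "proj e = S"
proof -
  obtain P where P: "pointed_translation_structure P" "iso_class P = S" "isomorphism P (fiber S) (iso_class_point P)"
    by (rule fiber_isomorphism[OF S])
  obtain x where x: "x \<in> points P" "e = iso_class_point P x"
    using e isomorphism_image[OF P(3)] by blast
  show "e \<in> \<E>" using P(1) x unfolding universal_def by blast
  show "proj e = S" using proj_iso_class_point[OF x(1)] x(2) P(2) by simp
qed

text \<open>The fiber is built from a chosen representative of the class; this relates it to a given one.\<close>

lemma isomorphism_to_fiber:
  assumes P: "pointed_translation_structure P"
  obtains \<kappa> where "isomorphism P (fiber (iso_class P)) \<kappa>"
proof -
  have "iso_class P \<in> \<M>" using P unfolding moduli_def by blast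
  then obtain Q where Q: "pointed_translation_structure Q" "iso_class Q = iso_class P"
      "isomorphism Q (fiber (iso_class P)) (iso_class_point Q)"
    by (rule fiber_isomorphism)
  have "Q \<in> iso_class P" using mem_iso_class_self[OF Q(1)] Q(2) by simp
  then obtain h where "isomorphism P Q h" unfolding iso_class_def by blast
  then have "isomorphism P (fiber (iso_class P)) (iso_class_point Q \<circ> h)"
    by (rule isomorphism_trans[OF P[THEN flat_surface_if_translation_structure]
          Q(1)[THEN flat_surface_if_translation_structure] _ Q(3)])
  then show thesis by (rule that)
qed

section \<open>Immersions\<close>

lemma immersion_parallel:
  assumes P: "flat_surface P" and imm: "immersion P A Q B \<iota>"
  shows "parallel (subtopology (surface_top P) A) P id Q \<iota>"
proof (rule parallelI)
  let ?K = "subtopology (surface_top P) A"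
  show "continuous_map ?K (surface_top P) id" by (simp add: continuous_map_from_subtopology)
  have c: "continuous_map ?K (subtopology (surface_top Q) B) \<iota>"
    using imm by (simp add: immersion_def)
  then show "continuous_map ?K (surface_top Q) \<iota>" by (rule continuous_map_into_fulltopology)
  fix s assume s: "s \<in> topspace ?K"
  then have sA: "s \<in> A" by simp
  have "\<forall>s\<in>A. \<exists>(U, \<phi>)\<in>atlas P. \<exists>(V, \<psi>)\<in>atlas Q. \<exists>v.
       s \<in> U \<and> \<iota> ` (U \<inter> A) \<subseteq> V \<and> (\<forall>s'\<in>U \<inter> A. \<psi> (\<iota> s') = v + \<phi> s')"
    using imm by (simp add: immersion_def)
  then obtain U \<phi> V \<psi> v where U: "(U, \<phi>) \<in> atlas P" "(V, \<psi>) \<in> atlas Q" "s \<in> U" "\<iota> ` (U \<inter> A) \<subseteq> V"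
      "\<forall>s'\<in>U \<inter> A. \<psi> (\<iota> s') = v + \<phi> s'"
    using sA by fastforce
  have "parallel_in_charts (U \<inter> A) U \<phi> id V \<psi> \<iota>"
    unfolding parallel_in_charts_def using U(4,5) by (intro conjI exI[of _ "- v"]) auto
  moreover have "openin ?K (U \<inter> A)"
    using flat_chart_openin[OF P U(1)] by (auto simp: openin_subtopology)
  ultimately show "\<exists>U \<phi> V \<psi> N. (U, \<phi>) \<in> atlas P \<and> (V, \<psi>) \<in> atlas Q \<and> openin ?K N \<and> s \<in> N \<and>
      parallel_in_charts N U \<phi> id V \<psi> \<iota>"
    using U(1-3) sA by blast
qed

lemma immersion_unique:
  assumes P: "flat_surface P" and Q: "flat_surface Q"
    and imm: "immersion P A Q B \<iota>" "immersion P A Q B \<iota>'"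
  shows "\<iota> = \<iota>'"
proof (rule extensionalityI)
  show "\<iota> \<in> extensional A" "\<iota>' \<in> extensional A" using imm by (simp_all add: immersion_def)
  have A: "path_connectedin (surface_top P) A" "basepoint P \<in> A"
    using imm by (simp_all add: immersion_def PC_def)
  have AP: "A \<subseteq> points P" using A(1) path_connectedin_subset_topspace by blast
  fix a assume a: "a \<in> A"
  show "\<iota> a = \<iota>' a"
  proof (rule parallel_unique[OF Q P, where f = \<iota> and f' = \<iota>' and k = a])
    let ?K = "subtopology (surface_top P) A"
    show "parallel ?K Q \<iota> P id" "parallel ?K Q \<iota>' P id"
      using imm immersion_parallel[OF P] parallel_sym by blast+
    show "connected_space ?K"
      using A(1) path_connectedin_imp_connectedin connectedin_def by blast
    show "basepoint P \<in> topspace ?K" "a \<in> topspace ?K" using A(2) AP a by auto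
    show "\<iota> (basepoint P) = \<iota>' (basepoint P)" using imm by (simp add: immersion_def)
  qed
qed

lemma the_immersion_eq:
  assumes "flat_surface P" "flat_surface Q" "immersion P A Q B \<iota>"
  shows "the_immersion P A Q B = \<iota>"
  unfolding the_immersion_def using assms immersion_unique by (intro the_equality) blast+

text \<open>An immersion has to map a whole chart domain, intersected with \<open>A\<close>, into one chart of the target. To
construct immersions one therefore needs arbitrarily small chart domains in the source.\<close>

definition restrictable :: "'a pointed_surface \<Rightarrow> bool"
  where "restrictable P \<longleftrightarrow>
    (\<forall>U \<phi> N. (U, \<phi>) \<in> atlas P \<and> openin (surface_top P) N \<longrightarrow> (U \<inter> N, restrict \<phi> (U \<inter> N)) \<in> atlas P)"

lemma restrictable_isomorphic:
  assumes P: "flat_surface P" and r: "restrictable P" and iso: "isomorphism P Q h"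
  shows "restrictable Q"
  unfolding restrictable_def
proof (intro allI impI, elim conjE)
  fix V \<psi> N assume V: "(V, \<psi>) \<in> atlas Q" and N: "openin (surface_top Q) N"
  obtain U \<phi> where U: "(U, \<phi>) \<in> atlas P" "V = h ` U" "\<forall>x\<in>U. \<psi> (h x) = \<phi> x"
    by (rule isomorphism_chart[OF P iso V])
  define M where "M = {x \<in> points P. h x \<in> N}"
  have "openin (surface_top P) M"
    unfolding M_def using openin_continuous_map_preimage
      [OF homeomorphic_imp_continuous_map[OF isomorphism_homeomorphic_map[OF iso]] N] .
  then have UM: "(U \<inter> M, restrict \<phi> (U \<inter> M)) \<in> atlas P" using r U(1) unfolding restrictable_def by blast
  have im: "h ` (U \<inter> M) = V \<inter> N"
    using U(2) flat_chart_subset[OF P U(1)] unfolding M_def by blast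
  have "(h ` (U \<inter> M), restrict \<psi> (V \<inter> N)) \<in> atlas Q"
  proof (rule isomorphism_chartI[OF P iso UM])
    show "restrict \<psi> (V \<inter> N) \<in> extensional (h ` (U \<inter> M))" by (simp add: im)
    show "\<forall>x\<in>U \<inter> M. restrict \<psi> (V \<inter> N) (h x) = restrict \<phi> (U \<inter> M) x"
    proof
      fix x assume x: "x \<in> U \<inter> M"
      then have "h x \<in> V \<inter> N" using im by blast
      then show "restrict \<psi> (V \<inter> N) (h x) = restrict \<phi> (U \<inter> M) x" using U(3) x by simp
    qed
  qed
  then show "(V \<inter> N, restrict \<psi> (V \<inter> N)) \<in> atlas Q" by (simp add: im)
qed

lemma immersion_if_parallel:
  assumes P: "flat_surface P" "restrictable P" and A: "A \<in> PC P"
    and par: "parallel (subtopology (surface_top P) A) P id Q \<iota>"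
    and base: "\<iota> (basepoint P) = basepoint Q" and ext: "\<iota> \<in> extensional A"
  shows "immersion P A Q (points Q) \<iota>"
  unfolding immersion_def
proof (intro conjI ballI)
  let ?K = "subtopology (surface_top P) A"
  have AP: "A \<subseteq> points P" using A path_connectedin_subset_topspace unfolding PC_def by blast
  show "continuous_map ?K (subtopology (surface_top Q) (points Q)) \<iota>"
    using parallel_continuous(2)[OF par] by simp
  fix s assume s: "s \<in> A"
  then have "s \<in> topspace ?K" using AP by auto
  then obtain U \<phi> V \<psi> N where N: "(U, \<phi>) \<in> atlas P" "(V, \<psi>) \<in> atlas Q" "openin ?K N" "s \<in> N"
    "parallel_in_charts N U \<phi> id V \<psi> \<iota>"
    by (rule parallel_locally[OF par])
  obtain N' where N': "openin (surface_top P) N'" "N = N' \<inter> A" using N(3) by (auto simp: openin_subtopology)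
  have U': "(U \<inter> N', restrict \<phi> (U \<inter> N')) \<in> atlas P" using P(2) N(1) N'(1) unfolding restrictable_def by blast
  obtain c where c: "\<forall>k\<in>N. \<phi> (id k) - \<psi> (\<iota> k) = c" and im: "\<iota> ` N \<subseteq> V" "id ` N \<subseteq> U"
    using N(5) unfolding parallel_in_charts_def by (elim conjE exE)
  have "s \<in> U \<inter> N'" using N(4) im(2) N'(2) by auto
  moreover have "\<iota> ` (U \<inter> N' \<inter> A) \<subseteq> V" using im(1) N'(2) by blast
  moreover have "\<psi> (\<iota> s') = - c + restrict \<phi> (U \<inter> N') s'" if s': "s' \<in> U \<inter> N' \<inter> A" for s'
  proof -
    have "\<phi> (id s') - \<psi> (\<iota> s') = c" using c s' N'(2) by blast
    then show ?thesis using s' by (auto simp: algebra_simps)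
  qed
  ultimately show "\<exists>(U, \<phi>)\<in>atlas P. \<exists>(V, \<psi>)\<in>atlas Q. \<exists>v. s \<in> U \<and> \<iota> ` (U \<inter> A) \<subseteq> V \<and> (\<forall>s'\<in>U \<inter> A. \<psi> (\<iota> s') = v + \<phi> s')"
    using N(2) by (intro bexI[OF _ U'] case_prodI bexI[OF _ N(2)] exI[of _ "- c"] conjI ballI) simp_all
qed (use A base ext in auto)

lemma immersion_compose_parallel:
  assumes flat: "flat_surface P" "flat_surface Q" "flat_surface R" and imm: "immersion P A Q B \<iota>"
    and par: "parallel K P f R g" and f: "f ` topspace K \<subseteq> A"
  shows "parallel K Q (\<iota> \<circ> f) R g"
proof -
  have "continuous_map K (subtopology (surface_top P) A) f"
    using parallel_continuous(1)[OF par] f by (auto simp: continuous_map_in_subtopology)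
  from parallel_compose[OF immersion_parallel[OF flat(1) imm] this]
  have "parallel K P f Q (\<iota> \<circ> f)" by (simp only: id_comp)
  from parallel_trans[OF flat(2,1,3) parallel_sym[OF this] par] show ?thesis .
qed

section \<open>Surfaces given by a developing map\<close>

text \<open>The translation atlas for which \<open>dev\<close> is a global developing map. Membership is a condition on
single charts, which makes the atlas maximal by construction.\<close>

definition developed_atlas :: "'a topology \<Rightarrow> ('a \<Rightarrow> real^2) \<Rightarrow> ('a set \<times> ('a \<Rightarrow> real^2)) set"
  where "developed_atlas X dev = {(U, \<phi>). openin X U \<and> \<phi> \<in> extensional U \<and>
    (\<forall>x\<in>U. \<exists>N c. openin X N \<and> x \<in> N \<and> N \<subseteq> U \<and> (\<forall>y\<in>N. \<phi> y - dev y = c))}"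

lemma developed_atlasD:
  assumes "(U, \<phi>) \<in> developed_atlas X dev"
  shows "openin X U" "\<phi> \<in> extensional U"
    "x \<in> U \<Longrightarrow> \<exists>N c. openin X N \<and> x \<in> N \<and> N \<subseteq> U \<and> (\<forall>y\<in>N. \<phi> y - dev y = c)"
  using assms unfolding developed_atlas_def by auto

lemma restrict_mem_developed_atlas:
  assumes "openin X U"
  shows "(U, restrict dev U) \<in> developed_atlas X dev"
  unfolding developed_atlas_def using assms by (auto intro!: exI[of _ U])

lemma complex_of_plane_inverse [simp]:
  "plane_of_complex (complex_of_plane p) = p" "complex_of_plane (plane_of_complex z) = z"
  by (simp_all add: plane_of_complex_def complex_of_plane_def vec_eq_iff forall_2 complex_eq_iff)

lemma complex_of_plane_linear [simp]:
  "complex_of_plane (p + q) = complex_of_plane p + complex_of_plane q"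
  "plane_of_complex (z + w) = plane_of_complex z + plane_of_complex w"
  "plane_of_complex (z - w) = plane_of_complex z - plane_of_complex w"
  by (simp_all add: plane_of_complex_def complex_of_plane_def vec_eq_iff forall_2 complex_eq_iff)

lemma norm_plane_of_complex [simp]: "norm (plane_of_complex z) = cmod z"
  by (simp add: plane_of_complex_def norm_vec_def L2_set_def sum_2 cmod_def)

lemma continuous_on_plane_of_complex: "continuous_on S plane_of_complex"
proof -
  have "dist (plane_of_complex z) (plane_of_complex w) = dist z w" for z w
    by (simp only: dist_norm norm_plane_of_complex flip: complex_of_plane_linear(3))
  then show ?thesis by (auto simp: continuous_on_iff)
qed

lemma continuous_on_complex_of_plane: "continuous_on S complex_of_plane"
  unfolding complex_of_plane_def Complex_eq by (intro continuous_intros)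

text \<open>Near each point the map takes small circles to translates of themselves, of winding number 1 about the translated centre.\<close>

lemma orientation_preserving_on_translations:
  assumes "\<And>p. p \<in> W \<Longrightarrow> \<exists>N c. open N \<and> p \<in> N \<and> (\<forall>q\<in>N. f q = q + c)"
  shows "orientation_preserving_on W f"
  unfolding orientation_preserving_on_def
proof
  fix p assume "p \<in> W"
  then obtain N c where N: "open N" "p \<in> N" "\<forall>q\<in>N. f q = q + c" using assms by blast
  obtain e where e: "e > 0" "ball p e \<subseteq> N" using N(1,2) open_contains_ball by blast
  have "winding_number (complex_of_plane \<circ> f \<circ> plane_of_complex \<circ> circlepath (complex_of_plane p) r)
         (complex_of_plane (f p)) = 1" if r: "0 < r" "r < e" for r
  proof -
    have "(complex_of_plane \<circ> f \<circ> plane_of_complex \<circ> circlepath (complex_of_plane p) r) t =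
        circlepath (complex_of_plane p + complex_of_plane c) r t" for t
    proof -
      let ?z = "circlepath (complex_of_plane p) r t"
      have "cmod (?z - complex_of_plane p) = r" using r by (simp add: circlepath norm_mult)
      then have "norm (plane_of_complex ?z - p) = r"
        by (metis complex_of_plane_inverse(1) complex_of_plane_linear(3) norm_plane_of_complex)
      then have "plane_of_complex ?z \<in> N" using e(2) r by (auto simp: dist_norm norm_minus_commute)
      then have "f (plane_of_complex ?z) = plane_of_complex ?z + c" using N(3) by blast
      then show ?thesis by (simp add: circlepath)
    qed
    then have "complex_of_plane \<circ> f \<circ> plane_of_complex \<circ> circlepath (complex_of_plane p) r =
        circlepath (complex_of_plane p + complex_of_plane c) r" by blast
    moreover have "complex_of_plane (f p) = complex_of_plane p + complex_of_plane c"
      using N(2,3) by simp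
    ultimately show ?thesis using r by (simp add: winding_number_circlepath_centre)
  qed
  then show "\<forall>\<^sub>F r in at_right 0. winding_number (complex_of_plane \<circ> f \<circ> plane_of_complex \<circ> circlepath (complex_of_plane p) r)
         (complex_of_plane (f p)) = 1"
    using e(1) unfolding eventually_at_right_field by blast
qed

text \<open>The restrictions of \<open>dev\<close> to open sets on which it is a homeomorphism form an oriented atlas whose transition functions
are identities. A chart compatible with the restriction of \<open>dev\<close> to the whole space differs from it by locally constant vectors,
and so is in the atlas already.\<close>

lemma developed_translation_structure:
  assumes conn: "connected_space X" and haus: "Hausdorff_space X" and count: "second_countable_space X"
    and dev: "local_homeomorphism_on X (topspace X) dev"
  shows "translation_structure X (developed_atlas X dev)"
proof -
  define \<Omega> where "\<Omega> = {(V, \<psi>). \<psi> = dev \<and> openin X V \<and> open (dev ` V) \<and>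
    homeomorphic_map (subtopology X V) (top_of_set (dev ` V)) dev}"
  have dev_at: "\<exists>V. (V, dev) \<in> \<Omega> \<and> x \<in> V" if "x \<in> topspace X" for x
    using dev that unfolding local_homeomorphism_on_def \<Omega>_def by blast
  have dev_inv: "dev (inv_into V dev q) = q" if "q \<in> dev ` V" for V q
    using that by (rule f_inv_into_f)
  have "orientation_preserving_on (dev ` (V \<inter> V')) (dev \<circ> inv_into V dev)"
    if V: "(V, dev) \<in> \<Omega>" for V V'
  proof (rule orientation_preserving_on_translations)
    fix p assume "p \<in> dev ` (V \<inter> V')"
    then show "\<exists>N c. open N \<and> p \<in> N \<and> (\<forall>q\<in>N. (dev \<circ> inv_into V dev) q = q + c)"
      using V dev_inv unfolding \<Omega>_def by (intro exI[of _ "dev ` V"] exI[of _ 0]) auto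
  qed
  then have orient: "oriented_atlas X \<Omega>"
    using dev_at openin_subset unfolding oriented_atlas_def \<Omega>_def by fastforce
  have charts_oriented: "orientation_preserving_on (dev ` (U \<inter> V)) (\<phi> \<circ> inv_into V dev)"
    if U: "(U, \<phi>) \<in> developed_atlas X dev" and V: "(V, dev) \<in> \<Omega>" for U \<phi> V
  proof (rule orientation_preserving_on_translations)
    fix p assume "p \<in> dev ` (U \<inter> V)"
    then obtain x where x: "x \<in> U" "x \<in> V" "p = dev x" by blast
    obtain N c where N: "openin X N" "x \<in> N" "N \<subseteq> U" "\<forall>y\<in>N. \<phi> y - dev y = c"
      using developed_atlasD(3)[OF U x(1)] by blast
    have V': "openin X V" "open (dev ` V)" "homeomorphic_map (subtopology X V) (top_of_set (dev ` V)) dev"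
      using V by (auto simp: \<Omega>_def)
    have "V \<subseteq> topspace X" using V'(1) by (rule openin_subset)
    then have inj: "inj_on dev V"
      using homeomorphic_imp_injective_map[OF V'(3)] by (simp add: Int_absorb1)
    have "(\<phi> \<circ> inv_into V dev) q = q + c" if q: "q \<in> dev ` (V \<inter> N)" for q
    proof -
      obtain y where y: "y \<in> V" "y \<in> N" "q = dev y" using q by blast
      have "\<phi> y - dev y = c" using N(4) y(2) by blast
      then show ?thesis using inv_into_f_f[OF inj y(1)] y(3) by (auto simp: algebra_simps)
    qed
    then show "\<exists>N c. open N \<and> p \<in> N \<and> (\<forall>q\<in>N. (\<phi> \<circ> inv_into V dev) q = q + c)"
      using homeomorphic_chart_restrict(2)[OF V' N(1)] x N(2)
      by (intro exI[of _ "dev ` (V \<inter> N)"] exI[of _ c]) auto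
  qed
  have local_hom: "local_homeomorphism_on X U \<phi>" if U: "(U, \<phi>) \<in> developed_atlas X dev" for U \<phi>
    unfolding local_homeomorphism_on_def
  proof
    fix x assume x: "x \<in> U"
    obtain N c where N: "openin X N" "x \<in> N" "N \<subseteq> U" "\<forall>y\<in>N. \<phi> y - dev y = c"
      using developed_atlasD(3)[OF U x] by blast
    have "x \<in> topspace X" using N(1,2) openin_subset by blast
    then obtain V where V: "(V, dev) \<in> \<Omega>" "x \<in> V" using dev_at by blast
    have V': "openin X V" "open (dev ` V)" "homeomorphic_map (subtopology X V) (top_of_set (dev ` V)) dev"
      using V by (auto simp: \<Omega>_def)
    note W = homeomorphic_chart_restrict[OF V' N(1)]
    let ?W = "V \<inter> N"
    have eq: "\<phi> y = c + dev y" if "y \<in> ?W" for y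
      using N(4) that by (metis IntD2 diff_eq_eq)
    have im: "\<phi> ` ?W = (+) c ` dev ` ?W" unfolding image_image using eq by (intro image_cong) auto
    have "homeomorphic_map (top_of_set (dev ` ?W)) (top_of_set ((+) c ` dev ` ?W)) ((+) c)"
      unfolding homeomorphic_map_maps
      by (rule exI[of _ "\<lambda>p. p - c"])
        (auto simp: homeomorphic_maps_def continuous_map_in_subtopology intro!: continuous_intros)
    from homeomorphic_map_compose[OF W(3) this]
    have "homeomorphic_map (subtopology X ?W) (top_of_set (\<phi> ` ?W)) \<phi>"
      unfolding im by (rule homeomorphic_map_eq) (simp add: eq)
    moreover have "open (\<phi> ` ?W)" unfolding im using W(2) by (rule open_translation)
    ultimately show "\<exists>V. openin X V \<and> x \<in> V \<and> V \<subseteq> U \<and> open (\<phi> ` V) \<and> homeomorphic_map (subtopology X V) (top_of_set (\<phi> ` V)) \<phi>"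
      using W(1) V(2) N(2,3) by (intro exI[of _ ?W]) auto
  qed
  have compat: "\<exists>W. openin X W \<and> x \<in> W \<and> W \<subseteq> U \<inter> V \<and> (\<forall>y\<in>W. \<phi> y - \<psi> y = \<phi> x - \<psi> x)"
    if U: "(U, \<phi>) \<in> developed_atlas X dev" and V: "(V, \<psi>) \<in> developed_atlas X dev" and x: "x \<in> U \<inter> V" for U \<phi> V \<psi> x
  proof -
    obtain N c where N: "openin X N" "x \<in> N" "N \<subseteq> U" "\<forall>y\<in>N. \<phi> y - dev y = c"
      using developed_atlasD(3)[OF U] x by blast
    obtain M d where M: "openin X M" "x \<in> M" "M \<subseteq> V" "\<forall>y\<in>M. \<psi> y - dev y = d"
      using developed_atlasD(3)[OF V] x by blast
    have eq: "\<phi> y - \<psi> y = c - d" if "y \<in> N" "y \<in> M" for y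
    proof -
      have "(\<phi> y - dev y) - (\<psi> y - dev y) = c - d" using N(4) M(4) that by (simp only:)
      then show ?thesis by simp
    qed
    have "\<forall>y\<in>N \<inter> M. \<phi> y - \<psi> y = \<phi> x - \<psi> x"
      using eq N(2) M(2) by (metis IntD1 IntD2)
    moreover have "openin X (N \<inter> M)" "x \<in> N \<inter> M" "N \<inter> M \<subseteq> U \<inter> V" using N(1-3) M(1-3) by auto
    ultimately show ?thesis by blast
  qed
  have cover: "(\<Union>(U, \<phi>)\<in>developed_atlas X dev. U) = topspace X"
  proof
    show "(\<Union>(U, \<phi>)\<in>developed_atlas X dev. U) \<subseteq> topspace X"
    proof clarify
      fix x U \<phi> assume U: "(U, \<phi>) \<in> developed_atlas X dev" and x: "x \<in> U"
      show "x \<in> topspace X" using openin_subset[OF developed_atlasD(1)[OF U]] x by blast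
    qed
    show "topspace X \<subseteq> (\<Union>(U, \<phi>)\<in>developed_atlas X dev. U)"
      using restrict_mem_developed_atlas[OF openin_topspace, of X dev] by blast
  qed
  have atlas: "translation_atlas X \<Omega> (developed_atlas X dev)"
    unfolding translation_atlas_def
  proof (intro conjI ballI case_prodI2)
    fix c U \<phi> assume "c \<in> developed_atlas X dev" "c = (U, \<phi>)"
    then have U: "(U, \<phi>) \<in> developed_atlas X dev" by simp
    show "openin X U" "\<phi> \<in> extensional U" "local_homeomorphism_on X U \<phi>"
      using developed_atlasD(1,2)[OF U] local_hom[OF U] by blast+
    fix d V \<psi> assume "d \<in> \<Omega>" "d = (V, \<psi>)"
    then have "(V, dev) \<in> \<Omega>" "\<psi> = dev" by (auto simp: \<Omega>_def)
    then show "orientation_preserving_on (\<psi> ` (U \<inter> V)) (\<phi> \<circ> inv_into V \<psi>)"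
      using charts_oriented[OF U] by simp
  next
    fix c U \<phi> d V \<psi> x assume "c \<in> developed_atlas X dev" "c = (U, \<phi>)" "d \<in> developed_atlas X dev" "d = (V, \<psi>)" "x \<in> U \<inter> V"
    then show "\<exists>W. openin X W \<and> x \<in> W \<and> W \<subseteq> U \<inter> V \<and> (\<forall>y\<in>W. \<phi> y - \<psi> y = \<phi> x - \<psi> x)"
      by (intro compat) simp_all
  qed (rule cover)
  have "A' \<subseteq> developed_atlas X dev" if A': "translation_atlas X \<Omega> A'" "developed_atlas X dev \<subseteq> A'" for A'
  proof (rule subrelI)
    fix U \<phi> assume U: "(U, \<phi>) \<in> A'"
    have "openin X U \<and> \<phi> \<in> extensional U"
      using A'(1) U unfolding translation_atlas_def by fast
    moreover have "\<exists>N c. openin X N \<and> x \<in> N \<and> N \<subseteq> U \<and> (\<forall>y\<in>N. \<phi> y - dev y = c)" if x: "x \<in> U" for x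
    proof -
      have D: "(topspace X, restrict dev (topspace X)) \<in> A'"
        using A'(2) restrict_mem_developed_atlas[OF openin_topspace] by blast
      have all: "\<forall>(U, \<phi>)\<in>A'. \<forall>(V, \<psi>)\<in>A'. \<forall>x\<in>U \<inter> V.
          \<exists>W. openin X W \<and> x \<in> W \<and> W \<subseteq> U \<inter> V \<and> (\<forall>y\<in>W. \<phi> y - \<psi> y = \<phi> x - \<psi> x)"
        using A'(1) unfolding translation_atlas_def by (elim conjE)
      have xX: "x \<in> U \<inter> topspace X" using x calculation openin_subset by blast
      from bspec[OF bspec[OF bspec[OF all U, unfolded prod.case] D, unfolded prod.case] xX]
      obtain W where W: "openin X W" "x \<in> W" "W \<subseteq> U \<inter> topspace X"
        "\<forall>y\<in>W. \<phi> y - restrict dev (topspace X) y = \<phi> x - restrict dev (topspace X) x"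
        by (elim exE conjE)
      have "\<phi> y - dev y = \<phi> x - restrict dev (topspace X) x" if "y \<in> W" for y
      proof -
        have "restrict dev (topspace X) y = dev y" using that W(3) by auto
        then show ?thesis using bspec[OF W(4) that] by (simp only:)
      qed
      then show ?thesis using W(1-3) by blast
    qed
    ultimately show "(U, \<phi>) \<in> developed_atlas X dev" unfolding developed_atlas_def by blast
  qed
  then have "maximal_translation_atlas X \<Omega> (developed_atlas X dev)"
    using atlas unfolding maximal_translation_atlas_def by blast
  then show ?thesis
    using conn haus count orient unfolding translation_structure_def oriented_surface_def by blast
qed

lemma developed_restrictable:
  "restrictable \<lparr> surface_top = X, basepoint = x0, atlas = developed_atlas X dev \<rparr>"
  unfolding restrictable_def
proof (simp, intro allI impI, elim conjE)
  fix U \<phi> N assume U: "(U, \<phi>) \<in> developed_atlas X dev" and N: "openin X N"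
  have "\<exists>M c. openin X M \<and> x \<in> M \<and> M \<subseteq> U \<inter> N \<and> (\<forall>y\<in>M. restrict \<phi> (U \<inter> N) y - dev y = c)" if x: "x \<in> U \<inter> N" for x
  proof -
    obtain M c where M: "openin X M" "x \<in> M" "M \<subseteq> U" "\<forall>y\<in>M. \<phi> y - dev y = c"
      using developed_atlasD(3)[OF U] x by blast
    then show ?thesis using N x by (intro exI[of _ "M \<inter> N"] exI[of _ c]) auto
  qed
  then show "(U \<inter> N, restrict \<phi> (U \<inter> N)) \<in> developed_atlas X dev"
    using developed_atlasD(1)[OF U] N unfolding developed_atlas_def by auto
qed

lemma developed_parallel:
  assumes dev: "local_homeomorphism_on X (topspace X) dev"
  shows "parallel X \<lparr> surface_top = X, basepoint = x0, atlas = developed_atlas X dev \<rparr> id plane dev"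
proof (rule parallelI)
  show "continuous_map X (surface_top plane) dev"
  proof (simp add: continuous_map_def, intro allI impI)
    fix T :: "(real^2) set" assume T: "open T"
    show "openin X {x \<in> topspace X. dev x \<in> T}"
    proof (subst openin_subopen, intro ballI)
      fix x assume x: "x \<in> {x \<in> topspace X. dev x \<in> T}"
      then obtain V where V: "openin X V" "x \<in> V" "homeomorphic_map (subtopology X V) (top_of_set (dev ` V)) dev"
        using dev unfolding local_homeomorphism_on_def by blast
      have c: "continuous_map (subtopology X V) euclidean dev"
        using homeomorphic_imp_continuous_map[OF V(3)] by (rule continuous_map_into_fulltopology)
      have "openin (subtopology X V) {x \<in> topspace (subtopology X V). dev x \<in> T}"
        by (rule openin_continuous_map_preimage[OF c]) (simp add: T)
      then have "openin X {x \<in> topspace (subtopology X V). dev x \<in> T}"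
        using V(1) by (rule openin_trans_full)
      then show "\<exists>S. openin X S \<and> x \<in> S \<and> S \<subseteq> {x \<in> topspace X. dev x \<in> T}"
        using x V(2) by (intro exI[of _ "{x \<in> topspace (subtopology X V). dev x \<in> T}"]) auto
    qed
  qed
  show "continuous_map X (surface_top \<lparr> surface_top = X, basepoint = x0, atlas = developed_atlas X dev \<rparr>) id" by simp
  fix x assume x: "x \<in> topspace X"
  have "parallel_in_charts (topspace X) (topspace X) (restrict dev (topspace X)) id UNIV (\<lambda>x. x) dev"
    unfolding parallel_in_charts_def by (intro conjI exI[of _ 0]) auto
  then show "\<exists>U \<phi> V \<psi> N. (U, \<phi>) \<in> atlas \<lparr> surface_top = X, basepoint = x0, atlas = developed_atlas X dev \<rparr> \<and>
      (V, \<psi>) \<in> atlas plane \<and> openin X N \<and> x \<in> N \<and> parallel_in_charts N U \<phi> id V \<psi> dev"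
    using restrict_mem_developed_atlas[OF openin_topspace] x by fastforce
qed

lemma homeomorphism_imp_homeomorphic_maps:
  "homeomorphism S T f g \<Longrightarrow> homeomorphic_maps (top_of_set S) (top_of_set T) f g"
  unfolding homeomorphism_def homeomorphic_maps_def
  by (auto simp: continuous_map_in_subtopology)

text \<open>Points of \<open>\<M>\<close> are classes of surfaces made of real numbers, so planar surfaces have to be transported into
the reals.\<close>

lemma complex_inj_real:
  obtains j :: "complex \<Rightarrow> real" where "inj j"
proof -
  have "\<not> finite (UNIV :: real set)" by (rule infinite_UNIV_char_0)
  from card_of_Times_same_infinite[OF this]
  have "\<exists>f. bij_betw f ((UNIV :: real set) \<times> (UNIV :: real set)) (UNIV :: real set)"
    by (simp only: card_of_ordIso)
  then obtain f :: "real \<times> real \<Rightarrow> real" where f: "inj f"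
    by (auto simp: bij_betw_def)
  have "inj (\<lambda>z. f (Re z, Im z))"
  proof (rule injI)
    fix z w assume "f (Re z, Im z) = f (Re w, Im w)"
    from injD[OF f this] show "z = w" by (simp add: complex_eq_iff)
  qed
  then show thesis by (rule that)
qed

lemma second_countable_homeomorphic_image:
  fixes B :: "complex set"
  assumes hom: "homeomorphic_map (top_of_set B) X j"
  shows "second_countable_space X"
proof -
  obtain \<B> :: "complex set set" where \<B>: "countable \<B>" "topological_basis \<B>"
    using ex_countable_basis by blast
  have jopen: "openin X (j ` (B \<inter> b))" if "open b" for b
    using homeomorphic_map_openness[OF hom, of "B \<inter> b"] that by (simp add: openin_open_Int)
  show ?thesis
    unfolding second_countable_space_def
  proof (intro exI[of _ "(\<lambda>b. j ` (B \<inter> b)) ` \<B>"] conjI ballI allI impI)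
    show "countable ((\<lambda>b. j ` (B \<inter> b)) ` \<B>)" using \<B>(1) by simp
    fix C assume "C \<in> (\<lambda>b. j ` (B \<inter> b)) ` \<B>"
    then show "openin X C" using jopen topological_basis_open[OF \<B>(2)] by blast
  next
    fix V x assume V: "openin X V \<and> x \<in> V"
    have "openin (top_of_set B) {z \<in> topspace (top_of_set B). j z \<in> V}"
      by (rule openin_continuous_map_preimage[OF homeomorphic_imp_continuous_map[OF hom]]) (use V in simp)
    then obtain T where T: "open T" "{z \<in> B. j z \<in> V} = B \<inter> T"
      by (auto simp: openin_open)
    have "x \<in> topspace X" using V openin_subset by blast
    then have "x \<in> j ` B" using homeomorphic_imp_surjective_map[OF hom] by simp
    then obtain z where z: "x = j z" "z \<in> B" by (rule imageE)
    then have "z \<in> T" using T(2) V by blast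
    then obtain b where b: "b \<in> \<B>" "z \<in> b" "b \<subseteq> T"
      using topological_basisE[OF \<B>(2) T(1)] by blast
    have "j ` (B \<inter> b) \<subseteq> V" using T(2) b(3) by blast
    then show "\<exists>C\<in>(\<lambda>b. j ` (B \<inter> b)) ` \<B>. x \<in> C \<and> C \<subseteq> V"
      using b(1,2) z by (intro bexI[of _ "j ` (B \<inter> b)"]) auto
  qed
qed

lemma holomorphic_developing_map:
  assumes B: "open B" and F: "F holomorphic_on B" "\<And>z. z \<in> B \<Longrightarrow> deriv F z \<noteq> 0"
    and hom: "homeomorphic_maps (top_of_set B) X j k"
  shows "local_homeomorphism_on X (topspace X) (plane_of_complex \<circ> F \<circ> k)"
  unfolding local_homeomorphism_on_def
proof
  have jhom: "homeomorphic_map (top_of_set B) X j" and khom: "homeomorphic_map X (top_of_set B) k"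
    using hom homeomorphic_maps_map by blast+
  have kj: "k (j z) = z" if "z \<in> B" for z using hom that by (simp add: homeomorphic_maps_def)
  fix x assume "x \<in> topspace X"
  then have "x \<in> j ` B" using homeomorphic_imp_surjective_map[OF jhom] by simp
  then obtain z where z: "x = j z" "z \<in> B" by (rule imageE)
  obtain r where r: "r > 0" "ball z r \<subseteq> B" "inj_on F (ball z r)"
    using has_complex_derivative_locally_injective[OF F(1) z(2) B F(2)[OF z(2)]] by blast
  let ?b = "ball z r" and ?f = "plane_of_complex \<circ> F"
  have inj: "inj_on ?f ?b"
    by (rule comp_inj_on[OF r(3) inj_on_inverseI[where g = complex_of_plane]]) simp
  have cont: "continuous_on ?b ?f"
    using holomorphic_on_imp_continuous_on[OF holomorphic_on_subset[OF F(1) r(2)]]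
    by (intro continuous_on_compose continuous_on_plane_of_complex)
  have open_im: "open (?f ` ?b)"
    by (rule invariance_of_domain_gen[OF _ cont inj]) auto
  obtain g where "homeomorphism ?b (?f ` ?b) ?f g"
    by (rule invariance_of_domain_homeomorphism[OF _ cont _ inj]) auto
  then have fhom: "homeomorphic_map (top_of_set ?b) (top_of_set (?f ` ?b)) ?f"
    using homeomorphism_imp_homeomorphic_maps homeomorphic_maps_imp_map by blast
  define V where "V = j ` ?b"
  have Vopen: "openin X V"
    using homeomorphic_map_openness[OF jhom, of ?b] r(2) B by (simp add: V_def open_openin_trans open_subset)
  have VX: "V \<subseteq> topspace X" using Vopen by (rule openin_subset)
  have kV: "k ` V = ?b"
    unfolding V_def image_image using kj r(2) by (force simp: image_iff)
  have im: "(?f \<circ> k) ` V = ?f ` ?b" by (simp only: image_comp[symmetric] kV)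
  have "k ` (topspace X \<inter> V) = topspace (top_of_set B) \<inter> ?b"
    using kV VX r(2) by (simp add: Int_absorb1)
  from homeomorphic_map_subtopologies[OF khom this]
  have "homeomorphic_map (subtopology X V) (top_of_set ?b) k"
    using r(2) by (simp add: subtopology_subtopology Int_absorb1)
  from homeomorphic_map_compose[OF this fhom]
  have "homeomorphic_map (subtopology X V) (top_of_set ((?f \<circ> k) ` V)) (?f \<circ> k)"
    unfolding im .
  moreover have "open ((?f \<circ> k) ` V)" unfolding im by (rule open_im)
  moreover have "x \<in> V" using z r(1) by (simp add: V_def)
  ultimately show "\<exists>V. openin X V \<and> x \<in> V \<and> V \<subseteq> topspace X \<and> open ((?f \<circ> k) ` V) \<and>
      homeomorphic_map (subtopology X V) (top_of_set ((?f \<circ> k) ` V)) (?f \<circ> k)"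
    using Vopen VX by blast
qed

text \<open>A holomorphic map without critical points is a local homeomorphism, and so defines a translation structure on its
domain. The map \<open>\<kappa>\<close> is the passage from the domain to the fiber over its class.\<close>

lemma planar_surface_in_moduli:
  assumes B: "open B" "connected B" "z0 \<in> B"
    and F: "F holomorphic_on B" "\<And>z. z \<in> B \<Longrightarrow> deriv F z \<noteq> 0"
  obtains T \<kappa> where "T \<in> \<M>" "homeomorphic_map (top_of_set B) (surface_top (fiber T)) \<kappa>"
    "basepoint (fiber T) = \<kappa> z0" "restrictable (fiber T)"
    "parallel (top_of_set B) (fiber T) \<kappa> plane (plane_of_complex \<circ> F)"
proof -
  obtain j :: "complex \<Rightarrow> real" where j: "inj j" by (rule complex_inj_real)
  define X where "X = pullback_topology (j ` B) (inv_into B j) (top_of_set B)"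
  have jhom: "homeomorphic_map (top_of_set B) X j"
    using homeomorphic_map_pullback[of j "top_of_set B"] inj_on_subset[OF j] by (simp add: X_def)
  then obtain k where jk: "homeomorphic_maps (top_of_set B) X j k" using homeomorphic_map_maps by blast
  let ?dev = "plane_of_complex \<circ> F \<circ> k"
  have dev: "local_homeomorphism_on X (topspace X) ?dev"
    by (rule holomorphic_developing_map[OF B(1) F jk])
  define Y where "Y = \<lparr> surface_top = X, basepoint = j z0, atlas = developed_atlas X ?dev \<rparr>"
  have space: "top_of_set B homeomorphic_space X"
    using jhom by (rule homeomorphic_map_imp_homeomorphic_space)
  have "translation_structure X (developed_atlas X ?dev)"
  proof (rule developed_translation_structure[OF _ _ second_countable_homeomorphic_image[OF jhom] dev])
    show "connected_space X"
      using homeomorphic_connected_space[OF space] B(2) by (simp add: connected_space_subtopology)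
    show "Hausdorff_space X"
      using homeomorphic_Hausdorff_space[OF space] Hausdorff_space_subtopology[OF Hausdorff_space_euclidean] by blast
  qed
  moreover have "j z0 \<in> topspace X" using homeomorphic_imp_surjective_map[OF jhom] B(3) by auto
  ultimately have Y: "pointed_translation_structure Y"
    by (simp add: pointed_translation_structure_def Y_def)
  note flatY = flat_surface_if_translation_structure[OF Y]
  obtain h where h: "isomorphism Y (fiber (iso_class Y)) h" by (rule isomorphism_to_fiber[OF Y])
  have flat: "flat_surface (fiber (iso_class Y))" by (rule flat_isomorphic[OF flatY h])
  have jc: "continuous_map (top_of_set B) X j" using jhom by (rule homeomorphic_imp_continuous_map)
  have YX: "surface_top Y = X" by (simp add: Y_def)
  show thesis
  proof (rule that)
    show "iso_class Y \<in> \<M>" using Y unfolding moduli_def by blast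
    show "homeomorphic_map (top_of_set B) (surface_top (fiber (iso_class Y))) (h \<circ> j)"
      using homeomorphic_map_compose[OF jhom] isomorphism_homeomorphic_map[OF h] unfolding YX by blast
    show "basepoint (fiber (iso_class Y)) = (h \<circ> j) z0"
      using h by (simp add: isomorphism_def Y_def)
    have "restrictable Y" unfolding Y_def by (rule developed_restrictable)
    then show "restrictable (fiber (iso_class Y))" by (rule restrictable_isomorphic[OF flatY _ h])
    have "parallel X Y id plane ?dev" unfolding Y_def by (rule developed_parallel[OF dev])
    from parallel_trans[OF flat flatY flat_plane parallel_sym[OF isomorphism_parallel[OF flatY h, unfolded YX]] this]
    have "parallel X (fiber (iso_class Y)) h plane ?dev" .
    from parallel_compose[OF this jc]
    show "parallel (top_of_set B) (fiber (iso_class Y)) (h \<circ> j) plane (plane_of_complex \<circ> F)"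
      by (rule parallel_cong) (use jk in \<open>simp_all add: homeomorphic_maps_def\<close>)
  qed
qed

lemma convex_body_closed_disk:
  fixes B D :: "complex set"
  assumes hom: "homeomorphic_map (top_of_set B) (surface_top P) \<kappa>" and DB: "D \<subseteq> B"
    and D: "convex D" "compact D" and B: "open B" and base: "z0 \<in> interior D" "basepoint P = \<kappa> z0"
  shows "closed_disk P (\<kappa> ` D)"
    and "\<And>N. open N \<Longrightarrow> N \<subseteq> D \<Longrightarrow> openin (surface_top P) (\<kappa> ` N) \<and> \<kappa> ` N \<subseteq> surface_top P interior_of (\<kappa> ` D)"
    and "\<kappa> ` D \<in> PC P"
proof -
  let ?X = "surface_top P"
  have sub: "\<kappa> ` D \<subseteq> points P"
    using homeomorphic_imp_surjective_map[OF hom] DB by auto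
  have open_im: "openin ?X (\<kappa> ` N) \<and> \<kappa> ` N \<subseteq> ?X interior_of (\<kappa> ` D)" if N: "open N" "N \<subseteq> D" for N
  proof -
    have "openin (top_of_set B) N" using N DB by (simp add: open_subset)
    then have "openin ?X (\<kappa> ` N)"
      using homeomorphic_map_openness[OF hom, of N] N DB by auto
    then show ?thesis using N(2) by (simp add: image_mono interior_of_maximal)
  qed
  then show "\<And>N. open N \<Longrightarrow> N \<subseteq> D \<Longrightarrow> openin ?X (\<kappa> ` N) \<and> \<kappa> ` N \<subseteq> ?X interior_of (\<kappa> ` D)" .
  have inj: "inj_on \<kappa> B" using homeomorphic_imp_injective_map[OF hom] by simp
  have "\<kappa> ` (topspace (top_of_set B) \<inter> D) = topspace ?X \<inter> \<kappa> ` D"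
    using sub DB by (simp add: Int_absorb1)
  from homeomorphic_map_subtopologies[OF hom this]
  have homD: "homeomorphic_map (top_of_set D) (subtopology ?X (\<kappa> ` D)) \<kappa>"
    using DB by (simp add: subtopology_subtopology Int_absorb1)
  have "D homeomorphic cball (0::real^2) 1"
  proof (rule homeomorphic_convex_compact_sets[OF D])
    have "aff_dim D = 2" using aff_dim_nonempty_interior[of D] base(1) by auto
    moreover have "aff_dim (cball (0::real^2) 1) = 2"
      using aff_dim_nonempty_interior[of "cball (0::real^2) 1"] by simp
    ultimately show "aff_dim D = aff_dim (cball (0::real^2) 1)" by simp
  qed auto
  then have "top_of_set D homeomorphic_space top_of_set (cball (0::real^2) 1)"
    unfolding homeomorphic_def homeomorphic_space_def
    using homeomorphism_imp_homeomorphic_maps by blast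
  then have "subtopology ?X (\<kappa> ` D) homeomorphic_space top_of_set (cball (0::real^2) 1)"
    using homeomorphic_map_imp_homeomorphic_space[OF homD] homeomorphic_space_sym homeomorphic_space_trans by blast
  moreover have "basepoint P \<in> ?X interior_of (\<kappa> ` D)"
    using open_im[of "interior D"] base interior_subset by blast
  ultimately show "closed_disk P (\<kappa> ` D)" using sub by (simp add: closed_disk_def)
  have "path_connectedin (top_of_set B) D"
    using convex_imp_path_connected[OF D(1)] DB by (simp add: path_connectedin_subtopology)
  then have "path_connectedin ?X (\<kappa> ` D)"
    using path_connectedin_continuous_map_image[OF homeomorphic_imp_continuous_map[OF hom]] by blast
  then show "\<kappa> ` D \<in> PC P" using base interior_subset unfolding PC_def by blast
qed

section \<open>Holomorphic developing maps along a path\<close>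

lemma complex_polynomial_approximation:
  fixes c :: "real \<Rightarrow> complex"
  assumes c: "continuous_on {a..b} c" and \<epsilon>: "\<epsilon> > 0"
  obtains p where "\<And>t. t \<in> {a..b} \<Longrightarrow> cmod (poly p (of_real t) - c t) < \<epsilon>"
proof -
  have real_poly: "\<exists>p :: complex poly. \<forall>t. poly p (of_real t) = of_real (g t)"
    if g: "real_polynomial_function g" for g :: "real \<Rightarrow> real"
  proof -
    obtain u n where u: "g = (\<lambda>x. \<Sum>i\<le>n. u i * x ^ i)"
      using real_polynomial_function_imp_sum[OF g] by (elim exE)
    have "poly (\<Sum>i\<le>n. monom (complex_of_real (u i)) i) (of_real t) = of_real (g t)" for t
      by (simp add: u poly_sum poly_monom)
    then show ?thesis by blast
  qed
  obtain g where g: "real_polynomial_function g" "\<And>t. t \<in> {a..b} \<Longrightarrow> \<bar>Re (c t) - g t\<bar> < \<epsilon> / 2"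
    by (rule Stone_Weierstrass_real_polynomial_function[of "{a..b}" "\<lambda>t. Re (c t)" "\<epsilon> / 2"])
      (use c \<epsilon> in \<open>auto intro: continuous_intros\<close>)
  obtain h where h: "real_polynomial_function h" "\<And>t. t \<in> {a..b} \<Longrightarrow> \<bar>Im (c t) - h t\<bar> < \<epsilon> / 2"
    by (rule Stone_Weierstrass_real_polynomial_function[of "{a..b}" "\<lambda>t. Im (c t)" "\<epsilon> / 2"])
      (use c \<epsilon> in \<open>auto intro: continuous_intros\<close>)
  obtain p q :: "complex poly" where p: "\<forall>t. poly p (of_real t) = of_real (g t)"
      and q: "\<forall>t. poly q (of_real t) = of_real (h t)"
    using real_poly[OF g(1)] real_poly[OF h(1)] by blast
  show thesis
  proof (rule that)
    fix t assume t: "t \<in> {a..b}"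
    have "cmod (poly (p + smult \<i> q) (of_real t) - c t) \<le> \<bar>g t - Re (c t)\<bar> + \<bar>h t - Im (c t)\<bar>"
      using cmod_le[of "poly (p + smult \<i> q) (of_real t) - c t"] p q by simp
    also have "\<dots> < \<epsilon>" using g(2)[OF t] h(2)[OF t] by (simp add: abs_minus_commute)
    finally show "cmod (poly (p + smult \<i> q) (of_real t) - c t) < \<epsilon>" .
  qed
qed

lemma small_positive_avoiding_finite:
  fixes d :: real
  assumes "finite A" "d > 0"
  obtains x where "0 < x" "x < d" "x \<notin> A"
proof -
  have "infinite ({0<..<d} - A)" using assms by (simp add: infinite_Ioo Diff_infinite_finite)
  then have "{0<..<d} - A \<noteq> {}" by (rule infinite_imp_nonempty)
  then obtain x where "x \<in> {0<..<d} - A" by blast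
  then show thesis by (intro that[of x]) auto
qed

text \<open>Start from a polynomial \<open>p\<^sub>0\<close> that is uniformly close to the path (Weierstrass) and subtract a small affine function to correct the end
values. Let \<open>m = (z - a) (z - b)\<close>. A small multiple \<open>l m\<close> is added to make the derivative nonzero at both
ends without changing the end values. Finally, substitute \<open>q = z + \<i> y m\<close> with a small real \<open>y\<close>: this bends the interval off
the real line but keeps its ends. Only finitely many values of \<open>y\<close> make the bent interval
meet the finite set of critical points, and \<open>q\<close> itself has no critical point on the interval because
the real part of its derivative is 1 there.\<close>

lemma polynomial_path_without_critical_points:
  fixes c :: "real \<Rightarrow> complex"
  assumes ab: "a < b" and c: "continuous_on {a..b} c" and \<epsilon>: "\<epsilon> > 0"
  obtains F where "F holomorphic_on UNIV" "F (of_real a) = c a" "F (of_real b) = c b"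
    "\<And>t. t \<in> {a..b} \<Longrightarrow> cmod (F (of_real t) - c t) < \<epsilon>"
    "\<And>t. t \<in> {a..b} \<Longrightarrow> deriv F (of_real t) \<noteq> 0"
proof -
  define e where "e = \<epsilon> / 8"
  have e: "e > 0" using \<epsilon> by (simp add: e_def)
  obtain p0 where p0: "\<And>t. t \<in> {a..b} \<Longrightarrow> cmod (poly p0 (of_real t) - c t) < e"
    using complex_polynomial_approximation[OF c e] by blast
  define ea where "ea = poly p0 (of_real a) - c a"
  define eb where "eb = poly p0 (of_real b) - c b"
  have small: "cmod ea < e" "cmod eb < e"
    using p0[of a] p0[of b] ab by (auto simp: ea_def eb_def)
  \<comment> \<open>The affine function interpolating the errors at the two ends; as a convex combination of
    them it is as small as they are.\<close>
  define L where "L = smult (1 / of_real (b - a)) [: of_real b * ea - of_real a * eb, eb - ea :]"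
  have L: "poly L (of_real t) = of_real ((b - t) / (b - a)) * ea + of_real ((t - a) / (b - a)) * eb" for t
  proof -
    have "complex_of_real b - complex_of_real a \<noteq> 0" using ab by (simp flip: of_real_diff)
    then show ?thesis by (simp add: L_def divide_simps) (simp add: algebra_simps)
  qed
  define p1 where "p1 = p0 - L"
  have p1_ends: "poly p1 (of_real a) = c a" "poly p1 (of_real b) = c b"
    unfolding p1_def using ab by (simp_all add: L ea_def eb_def)
  have p1: "cmod (poly p1 (of_real t) - c t) < 2 * e" if t: "t \<in> {a..b}" for t
  proof -
    define s where "s = (t - a) / (b - a)"
    have s: "0 \<le> s" "s \<le> 1" using t ab by (auto simp: s_def divide_simps)
    have s': "(b - t) / (b - a) = 1 - s" using ab by (simp add: s_def field_simps)
    have "cmod (poly L (of_real t)) \<le> cmod (of_real (1 - s) * ea) + cmod (of_real s * eb)"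
      unfolding L s' s_def[symmetric] by (rule norm_triangle_ineq)
    also have "\<dots> = (1 - s) * cmod ea + s * cmod eb"
      using s by (simp only: norm_mult norm_of_real abs_of_nonneg diff_ge_0_iff_ge)
    also have "\<dots> \<le> (1 - s) * e + s * e"
      using s small by (intro add_mono mult_left_mono) auto
    also have "\<dots> = e" by (simp add: algebra_simps)
    finally have "cmod (poly L (of_real t)) \<le> e" .
    moreover have eq: "poly p1 (of_real t) - c t = (poly p0 (of_real t) - c t) - poly L (of_real t)"
      by (simp add: p1_def)
    ultimately show ?thesis
      unfolding eq using norm_triangle_ineq4[of "poly p0 (of_real t) - c t" "poly L (of_real t)"] p0[OF t] by linarith
  qed
  define m :: "complex poly" where "m = [: - of_real a, 1 :] * [: - of_real b, 1 :]"
  have m: "poly m (of_real t) = of_real ((t - a) * (t - b))" for t by (simp add: m_def algebra_simps)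
  have m': "poly (pderiv m) (of_real t) = of_real (2 * t - a - b)" for t
    by (simp add: m_def pderiv_mult pderiv_pCons)
  have m_bound: "\<bar>(t - a) * (t - b)\<bar> \<le> (b - a)\<^sup>2" if "t \<in> {a..b}" for t
    unfolding abs_mult power2_eq_square using that by (intro mult_mono) auto
  have sq: "(b - a)\<^sup>2 > 0" using ab by simp
  define Z1 where "Z1 = {x. complex_of_real x = poly (pderiv p1) (of_real a) / of_real (b - a)} \<union>
      {x. complex_of_real x = - poly (pderiv p1) (of_real b) / of_real (b - a)}"
  have single: "finite {x. complex_of_real x = w}" for w
    by (rule finite_subset[of _ "{Re w}"]) auto
  obtain l where l: "0 < l" "l < e / (b - a)\<^sup>2" "l \<notin> Z1"
    by (rule small_positive_avoiding_finite[of Z1 "e / (b - a)\<^sup>2"]) (use single e sq in \<open>auto simp: Z1_def\<close>)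
  define p2 where "p2 = p1 + smult (of_real l) m"
  have p2_ends: "poly p2 (of_real a) = c a" "poly p2 (of_real b) = c b"
    by (simp_all add: p2_def m p1_ends)
  have nz: "complex_of_real (b - a) \<noteq> 0" using ab by simp
  have "poly (pderiv p2) (of_real a) = poly (pderiv p1) (of_real a) - of_real l * of_real (b - a)"
    by (simp add: p2_def pderiv_add pderiv_smult m' algebra_simps)
  then have p2a: "poly (pderiv p2) (of_real a) \<noteq> 0"
    using l(3) nz by (auto simp: Z1_def field_simps)
  have "poly (pderiv p2) (of_real b) = poly (pderiv p1) (of_real b) + of_real l * of_real (b - a)"
    by (simp add: p2_def pderiv_add pderiv_smult m' algebra_simps)
  moreover have "complex_of_real l \<noteq> - poly (pderiv p1) (of_real b) / of_real (b - a)"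
    using l(3) by (auto simp: Z1_def)
  ultimately have p2b: "poly (pderiv p2) (of_real b) \<noteq> 0"
    using nz by (metis add_eq_0_iff minus_divide_left nonzero_eq_divide_eq add.commute)
  have p2: "cmod (poly p2 (of_real t) - c t) < 3 * e" if t: "t \<in> {a..b}" for t
  proof -
    have "cmod (of_real l * poly m (of_real t)) = l * \<bar>(t - a) * (t - b)\<bar>"
      unfolding m norm_mult norm_of_real using l(1) by simp
    also have "\<dots> \<le> l * (b - a)\<^sup>2" using m_bound[OF t] l(1) by (intro mult_left_mono) auto
    also have "\<dots> < e" using l(2) sq by (simp add: pos_less_divide_eq)
    finally have "cmod (of_real l * poly m (of_real t)) < e" .
    moreover have eq: "poly p2 (of_real t) - c t = (poly p1 (of_real t) - c t) + of_real l * poly m (of_real t)"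
      by (simp add: p2_def)
    ultimately show ?thesis
      unfolding eq using norm_triangle_ineq[of "poly p1 (of_real t) - c t" "of_real l * poly m (of_real t)"] p1[OF t] by linarith
  qed
  define R where "R = \<bar>a\<bar> + \<bar>b\<bar> + 1"
  have "uniformly_continuous_on (cball 0 R) (poly p2)"
    by (intro compact_uniformly_continuous continuous_intros) auto
  then obtain d where d: "d > 0" "\<And>z w. z \<in> cball 0 R \<Longrightarrow> w \<in> cball 0 R \<Longrightarrow> dist w z < d \<Longrightarrow> dist (poly p2 w) (poly p2 z) < e"
    using e unfolding uniformly_continuous_on_def by metis
  \<comment> \<open>The points of the bent interval have the form \<open>t + \<i> y (t - a) (t - b)\<close>; if one is a critical
    point, its coordinates determine \<open>y\<close>.\<close>
  define Z2 where "Z2 = (\<lambda>z. Im z / ((Re z - a) * (Re z - b))) ` {z. poly (pderiv p2) z = 0}"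
  have "pderiv p2 \<noteq> 0" using p2a by auto
  then have "finite Z2" unfolding Z2_def by (intro finite_imageI poly_roots_finite)
  then obtain y where y: "0 < y" "y < min d 1 / (b - a)\<^sup>2" "y \<notin> Z2"
    using small_positive_avoiding_finite[of Z2 "min d 1 / (b - a)\<^sup>2"] d(1) sq by auto
  define q where "q = [: 0, 1 :] + smult (\<i> * of_real y) m"
  have q: "poly q (of_real t) = Complex t (y * ((t - a) * (t - b)))" for t
    by (simp add: q_def m complex_eq_iff)
  define F where "F = (\<lambda>z. poly p2 (poly q z))"
  have DF: "(F has_field_derivative poly (pderiv p2) (poly q z) * poly (pderiv q) z) (at z)" for z
    unfolding F_def by (rule DERIV_chain2[OF poly_DERIV poly_DERIV])
  then have F': "deriv F z = poly (pderiv p2) (poly q z) * poly (pderiv q) z" for z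
    by (rule DERIV_imp_deriv)
  show thesis
  proof (rule that)
    show "F holomorphic_on UNIV"
      using DF by (auto simp: holomorphic_on_open)
    have "poly q (of_real a) = of_real a" "poly q (of_real b) = of_real b"
      by (simp_all add: q complex_eq_iff)
    then show "F (of_real a) = c a" "F (of_real b) = c b" by (simp_all add: F_def p2_ends)
    fix t assume t: "t \<in> {a..b}"
    have dqt: "dist (poly q (of_real t)) (of_real t) < min d 1"
    proof -
      have eq: "poly q (of_real t) - of_real t = \<i> * of_real (y * ((t - a) * (t - b)))"
        by (simp add: q complex_eq_iff)
      then have "dist (poly q (of_real t)) (of_real t) = y * \<bar>(t - a) * (t - b)\<bar>"
        unfolding dist_norm eq norm_mult norm_of_real using y(1) by (simp add: abs_mult)
      also have "\<dots> \<le> y * (b - a)\<^sup>2" using m_bound[OF t] y(1) by (intro mult_left_mono) auto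
      also have "\<dots> < min d 1" using y(2) sq by (simp add: pos_less_divide_eq)
      finally show ?thesis .
    qed
    have tR: "cmod (of_real t) \<le> \<bar>a\<bar> + \<bar>b\<bar>" using t by auto
    have "cmod (poly q (of_real t)) \<le> cmod (of_real t) + dist (poly q (of_real t)) (of_real t)"
      unfolding dist_norm by (metis add.commute diff_add_cancel norm_triangle_ineq)
    then have "poly q (of_real t) \<in> cball 0 R" "complex_of_real t \<in> cball 0 R"
      using dqt tR by (auto simp: R_def)
    then have "dist (F (of_real t)) (poly p2 (of_real t)) < e"
      unfolding F_def using d(2) dqt by simp
    then show "cmod (F (of_real t) - c t) < \<epsilon>"
      using norm_triangle_ineq[of "F (of_real t) - poly p2 (of_real t)" "poly p2 (of_real t) - c t"] p2[OF t] \<epsilon>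
      by (simp add: dist_norm e_def)
    have "poly (pderiv q) (of_real t) = 1 + \<i> * of_real y * of_real (2 * t - a - b)"
      by (simp add: q_def pderiv_add pderiv_smult pderiv_pCons m')
    then have "Re (poly (pderiv q) (of_real t)) = 1" by simp
    then have q'0: "poly (pderiv q) (of_real t) \<noteq> 0" by (metis zero_complex.simps(1) zero_neq_one)
    have "poly (pderiv p2) (poly q (of_real t)) \<noteq> 0"
    proof (cases "t = a \<or> t = b")
      case True
      then have "poly q (of_real t) = of_real t" by (auto simp: q complex_eq_iff)
      then show ?thesis using p2a p2b True by auto
    next
      case False
      then have nz: "(t - a) * (t - b) \<noteq> 0" by simp
      show ?thesis
      proof
        assume "poly (pderiv p2) (poly q (of_real t)) = 0"
        then have "Im (poly q (of_real t)) / ((Re (poly q (of_real t)) - a) * (Re (poly q (of_real t)) - b)) \<in> Z2"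
          unfolding Z2_def by blast
        moreover have "Im (poly q (of_real t)) / ((Re (poly q (of_real t)) - a) * (Re (poly q (of_real t)) - b)) = y"
          using nz by (simp add: q)
        ultimately show False using y(3) by simp
      qed
    qed
    then show "deriv F (of_real t) \<noteq> 0" using q'0 by (simp add: F')
  qed
qed

lemma strip_inside_open:
  assumes O': "open S" "complex_of_real ` {s..t} \<subseteq> S" and st: "s \<le> t"
  obtains \<delta> where "\<delta> > 0" "\<And>z. s - \<delta> < Re z \<Longrightarrow> Re z < t + \<delta> \<Longrightarrow> \<bar>Im z\<bar> < \<delta> \<Longrightarrow> z \<in> S"
proof -
  have "compact (complex_of_real ` {s..t})"
    by (intro compact_continuous_image continuous_intros) auto
  then obtain \<epsilon> where \<epsilon>: "\<epsilon> > 0" "(\<Union>x\<in>complex_of_real ` {s..t}. ball x \<epsilon>) \<subseteq> S"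
    using compact_subset_open_imp_ball_epsilon_subset[OF _ O'] by metis
  have "z \<in> S" if z: "s - \<epsilon> / 2 < Re z" "Re z < t + \<epsilon> / 2" "\<bar>Im z\<bar> < \<epsilon> / 2" for z
  proof -
    define x where "x = max s (min t (Re z))"
    have x: "x \<in> {s..t}" "\<bar>Re z - x\<bar> < \<epsilon> / 2" using z st \<epsilon>(1) by (auto simp: x_def max_def min_def)
    have "cmod (z - of_real x) \<le> \<bar>Re z - x\<bar> + \<bar>Im z\<bar>" using cmod_le[of "z - of_real x"] by simp
    also have "\<dots> < \<epsilon>" using x(2) z(3) by simp
    finally have "z \<in> ball (of_real x) \<epsilon>" by (simp add: dist_norm norm_minus_commute)
    then show ?thesis using \<epsilon>(2) x(1) by blast
  qed
  then show thesis using that[of "\<epsilon> / 2"] \<epsilon>(1) by simp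
qed

text \<open>The developed loop consists of \<open>a1\<close> on \<open>[-1, 0]\<close> and \<open>a2\<close> on \<open>[0, 1]\<close>, and then pauses at its end
on \<open>[1, 2]\<close>. Because of the pause, points of the strip near 2 lie over the same point of the path
as 2 does, and so are compared with the end of the loop by a single straight translation. The value at 0 is left free: it is close to
the developed path, which is sufficient in the middle of the loop.\<close>

lemma developing_map_along_path:
  fixes a1 a2 :: "real \<Rightarrow> real^2"
  assumes a1: "continuous_on {-1..0} a1" "a1 0 = 0" and a2: "continuous_on {0..1} a2" "a2 0 = 0" and r: "r > 0"
  obtains F \<delta> where "0 < \<delta>" "\<delta> < 1" "F holomorphic_on UNIV"
    "plane_of_complex (F (-1)) = a1 (-1)" "plane_of_complex (F 2) = a2 1"
    "\<And>z. -1 - \<delta> < Re z \<Longrightarrow> Re z < 2 + \<delta> \<Longrightarrow> \<bar>Im z\<bar> < \<delta> \<Longrightarrow> deriv F z \<noteq> 0"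
    "\<And>z. -1 - \<delta> < Re z \<Longrightarrow> Re z < \<delta> \<Longrightarrow> \<bar>Im z\<bar> < \<delta> \<Longrightarrow>
      norm (plane_of_complex (F z) - a1 (max (-1) (min 0 (Re z)))) < r"
    "\<And>z. - \<delta> < Re z \<Longrightarrow> Re z < 2 + \<delta> \<Longrightarrow> \<bar>Im z\<bar> < \<delta> \<Longrightarrow>
      norm (plane_of_complex (F z) - a2 (max 0 (min 1 (Re z)))) < r"
proof -
  have c1: "continuous_on S (\<lambda>x. a1 (max (-1) (min 0 (h x))))" if "continuous_on S h" for S :: "complex set" and h
    by (rule continuous_on_compose2[OF a1(1)]) (use that in \<open>auto intro!: continuous_intros\<close>)
  have c2: "continuous_on S (\<lambda>x. a2 (max 0 (min 1 (h x))))" if "continuous_on S h" for S :: "complex set" and h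
    by (rule continuous_on_compose2[OF a2(1)]) (use that in \<open>auto intro!: continuous_intros\<close>)
  \<comment> \<open>One summand vanishes on each side of 0, as its argument is clipped to 0.\<close>
  define c where "c t = complex_of_plane (a1 (max (-1) (min 0 t)) + a2 (max 0 (min 1 t)))" for t
  have "continuous_on {-1..2} (\<lambda>t. a1 (max (-1) (min 0 t)) + a2 (max 0 (min 1 t)))"
    by (intro continuous_on_add continuous_on_compose2[OF a1(1)] continuous_on_compose2[OF a2(1)] continuous_intros) auto
  then have c: "continuous_on {-1..2} c"
    unfolding c_def by (rule continuous_on_compose2[OF continuous_on_complex_of_plane[of UNIV]]) auto
  have lt: "(-1::real) < 2" by simp
  obtain F where F: "F holomorphic_on UNIV" "F (of_real (-1)) = c (-1)" "F (of_real 2) = c 2"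
    "\<And>t. t \<in> {-1..2} \<Longrightarrow> cmod (F (of_real t) - c t) < r"
    "\<And>t. t \<in> {-1..2} \<Longrightarrow> deriv F (of_real t) \<noteq> 0"
    by (rule polynomial_path_without_critical_points[OF lt c r]) (rule that)
  have Fc: "continuous_on UNIV F" using F(1) by (rule holomorphic_on_imp_continuous_on)
  have pF: "continuous_on UNIV (\<lambda>z. plane_of_complex (F z))"
    by (rule continuous_on_compose2[OF continuous_on_plane_of_complex[of UNIV] Fc]) auto
  define S0 where "S0 = {z. deriv F z \<noteq> 0}"
  define S1 where "S1 = {z. norm (plane_of_complex (F z) - a1 (max (-1) (min 0 (Re z)))) < r}"
  define S2 where "S2 = {z. norm (plane_of_complex (F z) - a2 (max 0 (min 1 (Re z)))) < r}"
  have "deriv F holomorphic_on UNIV" using F(1) by (rule holomorphic_deriv) simp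
  then have S0: "open S0"
    unfolding S0_def using holomorphic_on_imp_continuous_on by (intro open_Collect_neq continuous_intros) auto
  have S1: "open S1" and S2: "open S2"
    unfolding S1_def S2_def
    by (intro open_Collect_less continuous_on_norm continuous_on_diff pF c1 c2 continuous_intros)+
  have near: "norm (plane_of_complex (F (of_real t)) - plane_of_complex (c t)) < r" if "t \<in> {-1..2}" for t
    using F(4)[OF that] by (simp flip: complex_of_plane_linear(3))
  have "complex_of_real ` {-1..2} \<subseteq> S0" using F(5) by (auto simp: S0_def)
  from strip_inside_open[OF S0 this] obtain \<delta>0 where \<delta>0: "\<delta>0 > 0"
      "\<And>z. -1 - \<delta>0 < Re z \<Longrightarrow> Re z < 2 + \<delta>0 \<Longrightarrow> \<bar>Im z\<bar> < \<delta>0 \<Longrightarrow> z \<in> S0" by auto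
  have "complex_of_real ` {-1..0} \<subseteq> S1"
  proof clarify
    fix t :: real assume t: "t \<in> {-1..0}"
    then have "plane_of_complex (c t) = a1 (max (-1) (min 0 t))" using a2(2) by (simp add: c_def)
    then show "complex_of_real t \<in> S1" using near[of t] t by (simp add: S1_def)
  qed
  from strip_inside_open[OF S1 this] obtain \<delta>1 where \<delta>1: "\<delta>1 > 0"
      "\<And>z. -1 - \<delta>1 < Re z \<Longrightarrow> Re z < 0 + \<delta>1 \<Longrightarrow> \<bar>Im z\<bar> < \<delta>1 \<Longrightarrow> z \<in> S1" by auto
  have "complex_of_real ` {0..2} \<subseteq> S2"
  proof clarify
    fix t :: real assume t: "t \<in> {0..2}"
    then have "plane_of_complex (c t) = a2 (max 0 (min 1 t))" using a1(2) by (simp add: c_def)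
    then show "complex_of_real t \<in> S2" using near[of t] t by (simp add: S2_def)
  qed
  from strip_inside_open[OF S2 this] obtain \<delta>2 where \<delta>2: "\<delta>2 > 0"
      "\<And>z. 0 - \<delta>2 < Re z \<Longrightarrow> Re z < 2 + \<delta>2 \<Longrightarrow> \<bar>Im z\<bar> < \<delta>2 \<Longrightarrow> z \<in> S2" by auto
  define \<delta> where "\<delta> = min (1/2) (min \<delta>0 (min \<delta>1 \<delta>2))"
  have \<delta>: "0 < \<delta>" "\<delta> < 1" "\<delta> \<le> \<delta>0" "\<delta> \<le> \<delta>1" "\<delta> \<le> \<delta>2" using \<delta>0(1) \<delta>1(1) \<delta>2(1) by (auto simp: \<delta>_def)
  show thesis
  proof (rule that[OF \<delta>(1,2) F(1)])
    show "plane_of_complex (F (-1)) = a1 (-1)" using F(2) a2(2) by (simp add: c_def)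
    show "plane_of_complex (F 2) = a2 1" using F(3) a1(2) by (simp add: c_def)
    fix z assume im: "\<bar>Im z\<bar> < \<delta>"
    show "deriv F z \<noteq> 0" if "-1 - \<delta> < Re z" "Re z < 2 + \<delta>"
      using \<delta>0(2)[of z] that im \<delta> by (simp add: S0_def)
    show "norm (plane_of_complex (F z) - a1 (max (-1) (min 0 (Re z)))) < r" if "-1 - \<delta> < Re z" "Re z < \<delta>"
      using \<delta>1(2)[of z] that im \<delta> by (simp add: S1_def)
    show "norm (plane_of_complex (F z) - a2 (max 0 (min 1 (Re z)))) < r" if "- \<delta> < Re z" "Re z < 2 + \<delta>"
      using \<delta>2(2)[of z] that im \<delta> by (simp add: S2_def)
  qed
qed

section \<open>Continuity of the family of immersions\<close>

text \<open>The geometric core. The disk \<open>K\<close> is the thin rectangle \<open>E\<close> around the interval \<open>[-1, 2]\<close>, seen in the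
fiber through \<open>\<kappa>\<close>; \<open>f\<close> is its developing map. Its left part \<open>K1\<close> maps to \<open>U\<close> by \<open>j1\<close> and its right part \<open>K2\<close> maps to
\<open>D\<close> by \<open>j2 w\<close>, which includes a translation by \<open>- w\<close>. For the surface \<open>S\<^sub>0\<close> these maps with \<open>w = 0\<close> are glued to an immersion of
\<open>E\<close>. For a surface \<open>S\<close> nearby, an immersion of \<open>E\<close> is given and is compared with them, where \<open>w\<close> is
the displacement of the point of \<open>E\<close> that covers the basepoint of \<open>S\<close>.\<close>

lemma universal_plus_neighbourhood:
  assumes T: "T \<in> \<M>" and U: "open_disk (fiber T) U"
    and T': "T' \<in> \<M>" and D: "closed_disk (fiber T') D"
    and V: "openin (surface_top (fiber T')) V" "V \<subseteq> surface_top (fiber T') interior_of D"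
    and S0: "S0 \<in> \<M>" and iU0: "immersion (fiber T) U (fiber S0) (points (fiber S0)) iU0"
    and iD0: "immersion (fiber T') D (fiber S0) (points (fiber S0)) iD0"
    and u0: "u0 \<in> U" and d0: "d0 \<in> V" and meet: "iU0 u0 = iD0 d0"
  obtains X K N M where "X \<in> \<M>" "closed_disk (fiber X) K" "openin (surface_top (fiber X)) N"
    "N \<subseteq> surface_top (fiber X) interior_of K" "S0 \<in> moduli_plus X K N"
    "openin (surface_top (fiber T)) M" "u0 \<in> M"
    "\<And>S iU iD u. S \<in> moduli_plus X K N \<Longrightarrow> u \<in> M \<Longrightarrow>
      immersion (fiber T) U (fiber S) (points (fiber S)) iU \<Longrightarrow>
      immersion (fiber T') D (fiber S) (points (fiber S)) iD \<Longrightarrow> iU u \<in> iD ` V"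
proof -
  let ?P = "fiber T" and ?P' = "fiber T'"
  note flat = flat_fiber[OF T] and flat' = flat_fiber[OF T']
  define I where "I = surface_top ?P' interior_of D"
  have ID: "I \<subseteq> D" unfolding I_def by (rule interior_of_subset)
  have Iopen: "openin (surface_top ?P') I" unfolding I_def by simp
  have Uopen: "openin (surface_top ?P) U" by (rule open_disk_openin[OF flat U])
  have Upc: "path_connectedin (surface_top ?P) U" "basepoint ?P \<in> U"
    using U by (simp_all add: open_disk_def PC_def)
  have less_0: "(-1::real) < 0" by simp
  obtain \<alpha> where \<alpha>': "continuous_map (top_of_set {-1..0::real}) (subtopology (surface_top ?P) U) \<alpha> \<and>
      \<alpha> (-1) = basepoint ?P \<and> \<alpha> 0 = u0"
    using path_connectedin_path[OF Upc u0 less_0] by (rule exE)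
  then have \<alpha>: "continuous_map (top_of_set {-1..0::real}) (subtopology (surface_top ?P) U) \<alpha>" "\<alpha> (-1) = basepoint ?P" "\<alpha> 0 = u0"
    by simp_all
  have d0I: "d0 \<in> I" using d0 V(2) by (auto simp: I_def)
  have baseI: "basepoint ?P' \<in> I" using D by (simp add: closed_disk_def I_def)
  obtain \<beta> where \<beta>': "continuous_map (top_of_set {0..1::real}) (subtopology (surface_top ?P') I) \<beta> \<and>
      \<beta> 0 = d0 \<and> \<beta> 1 = basepoint ?P'"
    using path_connectedin_path[OF closed_disk_interior_path_connected[OF flat' D, folded I_def] d0I baseI zero_less_one]
    by (rule exE)
  then have \<beta>: "continuous_map (top_of_set {0..1::real}) (subtopology (surface_top ?P') I) \<beta>" "\<beta> 0 = d0" "\<beta> 1 = basepoint ?P'"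
    by simp_all
  have "(-1::real) \<le> 0" by simp
  from tube_exists[OF flat Uopen \<alpha>(1) this]
  obtain r1 e1 b1 where "tube ?P U \<alpha> (-1) 0 r1 e1 b1" .
  define a1 where "a1 \<tau> = b1 \<tau> - b1 0" for \<tau>
  have t1': "tube ?P U \<alpha> (-1) 0 r1 e1 a1"
    unfolding a1_def by (rule tube_normalize[OF flat \<open>tube ?P U \<alpha> (-1) 0 r1 e1 b1\<close>])
  have a10: "a1 0 = 0" by (simp add: a1_def)
  from tube_exists[OF flat' Iopen \<beta>(1) zero_le_one]
  obtain r2 e2 b2 where "tube ?P' I \<beta> 0 1 r2 e2 b2" .
  define a2 where "a2 \<tau> = b2 \<tau> - b2 0" for \<tau>
  have t2': "tube ?P' I \<beta> 0 1 r2 e2 a2"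
    unfolding a2_def by (rule tube_normalize[OF flat' \<open>tube ?P' I \<beta> 0 1 r2 e2 b2\<close>])
  have a20: "a2 0 = 0" by (simp add: a2_def)
  define r where "r = min r1 r2"
  have r: "0 < r" "r \<le> r1" "r \<le> r2" using t1' t2' by (auto simp: r_def tube_def)
  note t1 = tube_shrink[OF t1' r(1,2)] and t2 = tube_shrink[OF t2' r(1,3)]
  have a1: "continuous_on {-1..0} a1" and a2: "continuous_on {0..1} a2" using t1 t2 by (simp_all add: tube_def)
  have e1_path: "e1 (\<tau>, 0) = \<alpha> \<tau>" if "\<tau> \<in> {-1..0}" for \<tau> using t1 that by (simp add: tube_def)
  have e2_path: "e2 (\<tau>, 0) = \<beta> \<tau>" if "\<tau> \<in> {0..1}" for \<tau> using t2 that by (simp add: tube_def)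
  have cross1: "parallel (top_of_set (ball 0 r)) ?P (\<lambda>w. e1 (0, w)) plane (\<lambda>w. w)" "norm w < r \<Longrightarrow> e1 (0, w) \<in> U" for w
    using tube_parallel[OF t1, of "ball 0 r" "\<lambda>_. 0" "\<lambda>w. w"] by (simp_all add: a10)
  have cross2: "parallel (top_of_set (ball 0 r)) ?P' (\<lambda>w. e2 (0, w)) plane (\<lambda>w. w)" "norm w < r \<Longrightarrow> e2 (0, w) \<in> I" for w
    using tube_parallel[OF t2, of "ball 0 r" "\<lambda>_. 0" "\<lambda>w. w"] by (simp_all add: a20)
  let ?C = "ball (0::real^2) (r / 2)"
  have norm_diff: "norm (w - w0) < r" if "norm w < r / 2" "norm w0 < r / 2" for w w0 :: "real^2"
    using norm_triangle_ineq4[of w w0] that by linarith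
  have cross2': "parallel (top_of_set ?C) ?P' (\<lambda>w. e2 (0, w - w0)) plane (\<lambda>w. w)" if w0: "norm w0 < r / 2" for w0
  proof (rule parallel_shift[OF flat'])
    have "continuous_map (top_of_set ?C) (top_of_set (ball 0 r)) (\<lambda>w. w - w0)"
      using norm_diff w0 by (auto simp: continuous_map_in_subtopology intro!: continuous_intros)
    from parallel_compose[OF cross2(1) this]
    show "parallel (top_of_set ?C) ?P' (\<lambda>w. e2 (0, w - w0)) plane (\<lambda>w. w + (- w0))" by (simp add: o_def)
  qed simp
  \<comment> \<open>Across the middle of the loop: if the two immersions agree at one translate of the points
    \<open>u0\<close> and \<open>d0\<close>, up to the displacement \<open>w0\<close>, they agree at all short translates.\<close>
  have transfer: "iU (e1 (0, w)) = iD (e2 (0, w - w0))"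
    if Q: "flat_surface Q" and iU: "immersion ?P U Q (points Q) iU" and iD: "immersion ?P' D Q (points Q) iD"
      and w0: "norm w0 < r / 2" and w1: "norm w1 < r / 2" "iU (e1 (0, w1)) = iD (e2 (0, w1 - w0))"
      and w: "norm w < r / 2" for Q :: "universal_point pointed_surface" and iU iD w0 w1 w
  proof -
    have "?C \<subseteq> ball 0 r" using r(1) by auto
    from parallel_subset[OF cross1(1) this]
    have m1: "parallel (top_of_set ?C) Q (iU \<circ> (\<lambda>w. e1 (0, w))) plane (\<lambda>w. w)"
      by (rule immersion_compose_parallel[OF flat Q flat_plane iU]) (use cross1(2) r(1) in auto)
    have m2: "parallel (top_of_set ?C) Q (iD \<circ> (\<lambda>w. e2 (0, w - w0))) plane (\<lambda>w. w)"
      by (rule immersion_compose_parallel[OF flat' Q flat_plane iD cross2'[OF w0]])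
        (use cross2(2) norm_diff w0 ID in auto)
    have m3: "connected_space (top_of_set ?C)" by (simp add: connected_space_subtopology)
    have "(iU \<circ> (\<lambda>w. e1 (0, w))) w = (iD \<circ> (\<lambda>w. e2 (0, w - w0))) w"
      by (rule parallel_unique[OF Q flat_plane m1 m2 m3, where l = w1]) (use w1 w in simp_all)
    then show ?thesis by simp
  qed
  \<comment> \<open>The factor 2 leaves room for both the displacement \<open>w0\<close> and the distance from \<open>u0\<close>.\<close>
  obtain \<rho> where \<rho>: "0 < \<rho>" "\<rho> \<le> r / 2" "\<And>v. norm v < 2 * \<rho> \<Longrightarrow> e2 (0, v) \<in> V"
  proof -
    have "openin (top_of_set (ball 0 r)) {v \<in> ball 0 r. e2 (0, v) \<in> V}"
      using openin_continuous_map_preimage[OF parallel_continuous(1)[OF cross2(1)] V(1)] by simp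
    then have "open {v \<in> ball 0 r. e2 (0, v) \<in> V}" using openin_open_trans by blast
    moreover have "0 \<in> {v \<in> ball 0 r. e2 (0, v) \<in> V}" using e2_path[of 0] \<beta>(2) d0 r(1) by simp
    ultimately obtain d where d: "d > 0" "ball 0 d \<subseteq> {v \<in> ball 0 r. e2 (0, v) \<in> V}"
      by (rule openE)
    show thesis
    proof (rule that[of "min (r / 2) (d / 2)"])
      show "e2 (0, v) \<in> V" if "norm v < 2 * min (r / 2) (d / 2)" for v
      proof -
        have "v \<in> ball 0 d" using that by simp
        then show ?thesis using d(2) by blast
      qed
    qed (use d r(1) in simp_all)
  qed
  have half_pos: "r / 2 > 0" using r(1) by simp
  obtain F \<delta> where \<delta>: "0 < \<delta>" "\<delta> < 1" and F: "F holomorphic_on UNIV"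
    and F_ends: "plane_of_complex (F (-1)) = a1 (-1)" "plane_of_complex (F 2) = a2 1"
    and F': "\<And>z. -1 - \<delta> < Re z \<Longrightarrow> Re z < 2 + \<delta> \<Longrightarrow> \<bar>Im z\<bar> < \<delta> \<Longrightarrow> deriv F z \<noteq> 0"
    and Fa1: "\<And>z. -1 - \<delta> < Re z \<Longrightarrow> Re z < \<delta> \<Longrightarrow> \<bar>Im z\<bar> < \<delta> \<Longrightarrow>
      norm (plane_of_complex (F z) - a1 (max (-1) (min 0 (Re z)))) < r / 2"
    and Fa2: "\<And>z. - \<delta> < Re z \<Longrightarrow> Re z < 2 + \<delta> \<Longrightarrow> \<bar>Im z\<bar> < \<delta> \<Longrightarrow>
      norm (plane_of_complex (F z) - a2 (max 0 (min 1 (Re z)))) < r / 2"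
    by (rule developing_map_along_path[OF a1 a10 a2 a20 half_pos]) (rule that)
  define f where "f = plane_of_complex \<circ> F"
  have Fc: "continuous_on K F" for K
    using holomorphic_on_imp_continuous_on[OF F] continuous_on_subset by blast
  have fc: "continuous_on K f" for K
    unfolding f_def by (intro continuous_on_compose Fc continuous_on_plane_of_complex)
  define B where "B = box (Complex (-1 - \<delta>) (-\<delta>)) (Complex (2 + \<delta>) \<delta>)"
  \<comment> \<open>The developing map has its good properties on the open rectangle \<open>B\<close> of size \<open>\<delta>\<close>; half
    the size gives a closed rectangle inside.\<close>
  define h where "h = \<delta> / 2"
  have h: "0 < h" "h < \<delta>" "h < 1" using \<delta> by (auto simp: h_def)
  define E where "E = cbox (Complex (-1 - h) (-h)) (Complex (2 + h) h)"
  have E_iff: "z \<in> E \<longleftrightarrow> -1 - h \<le> Re z \<and> Re z \<le> 2 + h \<and> \<bar>Im z\<bar> \<le> h" for z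
    by (auto simp: E_def in_cbox_complex_iff)
  have B_iff: "z \<in> B \<longleftrightarrow> -1 - \<delta> < Re z \<and> Re z < 2 + \<delta> \<and> \<bar>Im z\<bar> < \<delta>" for z
    by (auto simp: B_def in_box_complex_iff)
  have intE_iff: "z \<in> interior E \<longleftrightarrow> -1 - h < Re z \<and> Re z < 2 + h \<and> \<bar>Im z\<bar> < h" for z
    by (auto simp: E_def interior_cbox in_box_complex_iff)
  have EB: "E \<subseteq> B" using h by (auto simp: E_iff B_iff)
  have E: "convex E" "compact E" by (simp_all add: E_def)
  have B: "open B" "connected B" "-1 \<in> B"
    unfolding B_def by (rule open_box, rule convex_connected[OF convex_box(2)])
      (use \<delta>(1) in \<open>simp add: in_box_complex_iff\<close>)
  obtain X \<kappa> where X: "X \<in> \<M>" and \<kappa>: "homeomorphic_map (top_of_set B) (surface_top (fiber X)) \<kappa>"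
    "basepoint (fiber X) = \<kappa> (-1)" "restrictable (fiber X)" "parallel (top_of_set B) (fiber X) \<kappa> plane f"
    unfolding f_def
    by (rule planar_surface_in_moduli[OF B holomorphic_on_subset[OF F subset_UNIV]]) (use F' B_iff in blast)
  let ?Y = "fiber X"
  note flatY = flat_fiber[OF X]
  have baseE: "-1 \<in> interior E" using h by (simp add: intE_iff)
  note disk = convex_body_closed_disk[OF \<kappa>(1) EB E B(1) baseE \<kappa>(2)]
  have \<kappa>E: "continuous_map (top_of_set E) (surface_top ?Y) \<kappa>"
    using continuous_map_from_subtopology_mono[OF homeomorphic_imp_continuous_map[OF \<kappa>(1)] EB] .
  obtain k where k: "homeomorphic_maps (top_of_set B) (surface_top ?Y) \<kappa> k"
    using \<kappa>(1) homeomorphic_map_maps by blast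
  have k\<kappa>: "k (\<kappa> z) = z" if "z \<in> E" for z using k that EB by (auto simp: homeomorphic_maps_def)
  define K1 where "K1 = E \<inter> {z. Re z \<le> h}"
  define K2 where "K2 = E \<inter> {z. - h \<le> Re z}"
  have conn: "connected_space (top_of_set K1)" "connected_space (top_of_set K2)" "connected_space (top_of_set (K1 \<inter> K2))"
    unfolding K1_def K2_def
    by (intro connected_space_subtopology connectedin_iff_connected[THEN iffD2] convex_connected
        convex_Int E(1) convex_halfspace_Re_le convex_halfspace_Re_ge)+
  have inK: "-1 \<in> K1" "0 \<in> K1" "0 \<in> K2" "2 \<in> K2" "2 \<notin> K1" using h by (auto simp: K1_def K2_def E_iff)
  define j1 where "j1 z = e1 (max (-1) (min 0 (Re z)), f z - a1 (max (-1) (min 0 (Re z))))" for z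
  define j2 where "j2 w z = e2 (max 0 (min 1 (Re z)), (f z - w) - a2 (max 0 (min 1 (Re z))))" for w z
  have j1: "parallel (top_of_set K1) ?P j1 plane f" "\<And>z. z \<in> K1 \<Longrightarrow> j1 z \<in> U"
  proof -
    have close: "norm (f z - a1 (max (-1) (min 0 (Re z)))) < r" if "z \<in> K1" for z
      using Fa1[of z] that h r(1) by (auto simp: K1_def E_iff f_def)
    have c: "continuous_on K1 (\<lambda>z. max (-1) (min 0 (Re z)))" by (intro continuous_intros)
    show "parallel (top_of_set K1) ?P j1 plane f"
      unfolding j1_def by (rule tube_parallel(1)[OF t1 c _ fc close]) auto
    show "j1 z \<in> U" if "z \<in> K1" for z
      unfolding j1_def by (rule tube_parallel(2)[OF t1 c _ fc close that]) auto
  qed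
  have j2: "parallel (top_of_set K2) ?P' (j2 w) plane f" "\<And>z. z \<in> K2 \<Longrightarrow> j2 w z \<in> D" if w: "norm w < r / 2" for w
  proof -
    have close: "norm ((f z - w) - a2 (max 0 (min 1 (Re z)))) < r" if "z \<in> K2" for z
    proof -
      have "norm (f z - a2 (max 0 (min 1 (Re z)))) < r / 2"
        using Fa2[of z] that h by (auto simp: K2_def E_iff f_def)
      from norm_diff[OF this w] show ?thesis by (simp add: algebra_simps)
    qed
    have c: "continuous_on K2 (\<lambda>z. max 0 (min 1 (Re z)))" by (intro continuous_intros)
    have fwc: "continuous_on K2 (\<lambda>z. f z - w)" by (intro continuous_intros fc)
    have "parallel (top_of_set K2) ?P' (j2 w) plane (\<lambda>z. f z - w)"
      unfolding j2_def by (rule tube_parallel(1)[OF t2 c _ fwc close]) auto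
    then have "parallel (top_of_set K2) ?P' (j2 w) plane (\<lambda>z. f z + (- w))" by simp
    then show "parallel (top_of_set K2) ?P' (j2 w) plane f"
      by (rule parallel_shift[OF flat']) (simp add: fc)
    show "j2 w z \<in> D" if "z \<in> K2" for z
    proof -
      have "j2 w z \<in> I" unfolding j2_def by (rule tube_parallel(2)[OF t2 c _ fwc close that]) auto
      then show ?thesis using ID by blast
    qed
  qed
  have j1_base: "j1 (-1) = basepoint ?P" using F_ends(1) e1_path[of "-1"] \<alpha>(2) by (simp add: j1_def f_def)
  have j_0: "j1 0 = e1 (0, f 0)" "j2 w 0 = e2 (0, f 0 - w)" for w by (simp_all add: j1_def j2_def a10 a20)
  have j2_end: "j2 (f z - f 2) z = basepoint ?P'" if "1 < Re z" for z
    using that F_ends(2) e2_path[of 1] \<beta>(3) by (simp add: j2_def f_def)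
  have f0: "norm (f 0) < r / 2" using Fa1[of 0] \<delta>(1) by (simp add: f_def a10)
  \<comment> \<open>Where the real part exceeds 1 the path is at its pause, so \<open>j2_end\<close> applies.\<close>
  define N where "N = interior E \<inter> {z. 1 < Re z} \<inter> {z. norm (f z - f 2) < \<rho>}"
  have N: "open N" "N \<subseteq> E" "2 \<in> N"
  proof -
    have "open {z. norm (f z - f 2) < \<rho>}" by (intro open_Collect_less continuous_intros fc)
    moreover have "open {z. 1 < Re z}" by (intro open_Collect_less continuous_intros)
    ultimately show "open N" unfolding N_def by (intro open_Int open_interior)
    show "N \<subseteq> E" unfolding N_def using interior_subset by blast
    show "2 \<in> N" using h \<rho>(1) by (simp add: N_def intE_iff)
  qed
  have M0_par: "parallel (top_of_set (ball 0 \<rho>)) ?P (\<lambda>w. e1 (0, w)) plane (\<lambda>w. w)"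
    by (rule parallel_subset[OF cross1(1)]) (use \<rho>(2) r(1) in auto)
  have "0 \<in> ball (0::real^2) \<rho>" "inj_on (\<lambda>w. w) (ball (0::real^2) \<rho>)" using \<rho>(1) by simp_all
  then obtain M0 where M0: "open M0" "0 \<in> M0" "M0 \<subseteq> ball 0 \<rho>"
      "openin (surface_top ?P) ((\<lambda>w. e1 (0, w)) ` M0)"
    by (rule parallel_plane_local_open[OF flat open_ball _ M0_par])
  have S0_plus: "S0 \<in> moduli_plus X (\<kappa> ` E) (\<kappa> ` N)"
  proof -
    let ?Q = "fiber S0"
    note Q = flat_fiber[OF S0]
    define G where "G z = (if z \<in> K1 then iU0 (j1 z) else iD0 (j2 0 z))" for z
    have r0: "norm (0::real^2) < r / 2" using r(1) by simp
    have base_eq: "iU0 (basepoint ?P) = basepoint ?Q" "iD0 (basepoint ?P') = basepoint ?Q"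
      using iU0 iD0 by (simp_all add: immersion_def)
    have inE: "-1 \<in> E" "2 \<in> E" using inK by (simp_all add: K1_def K2_def)
    have m1: "parallel (top_of_set K1) ?Q (iU0 \<circ> j1) plane f"
      by (rule immersion_compose_parallel[OF flat Q flat_plane iU0 j1(1)]) (use j1(2) in auto)
    have m2: "parallel (top_of_set K2) ?Q (iD0 \<circ> j2 0) plane f"
      by (rule immersion_compose_parallel[OF flat' Q flat_plane iD0 j2(1)[OF r0]]) (use j2(2)[OF r0] in auto)
    have "iU0 (e1 (0, f 0)) = iD0 (e2 (0, f 0 - 0))"
      by (rule transfer[OF Q iU0 iD0 r0 r0 _ f0])
        (use e1_path[of 0] e2_path[of 0] \<alpha>(3) \<beta>(2) meet in simp)
    then have at0: "(iU0 \<circ> j1) 0 = (iD0 \<circ> j2 0) 0" by (simp add: j_0)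
    have agree: "iU0 (j1 z) = iD0 (j2 0 z)" if z: "z \<in> K1" "z \<in> K2" for z
    proof -
      have "(iU0 \<circ> j1) z = (iD0 \<circ> j2 0) z"
        by (rule parallel_unique[OF Q flat_plane parallel_subset[OF m1] parallel_subset[OF m2] conn(3), where l = 0])
          (use at0 inK z in auto)
      then show ?thesis by simp
    qed
    have G: "parallel (top_of_set E) ?Q G plane f"
    proof (rule parallel_Un[OF Q flat_plane])
      show "closedin (top_of_set E) K1" unfolding K1_def
        by (rule closedin_closed_Int) (rule closed_halfspace_Re_le)
      show "closedin (top_of_set E) K2" unfolding K2_def
        by (rule closedin_closed_Int) (rule closed_halfspace_Re_ge)
      show "topspace (top_of_set E) = K1 \<union> K2" using h(1) by (auto simp: K1_def K2_def)
      have sub: "subtopology (top_of_set E) K1 = top_of_set K1" "subtopology (top_of_set E) K2 = top_of_set K2"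
        by (simp_all add: subtopology_subtopology K1_def K2_def)
      show "parallel (subtopology (top_of_set E) K1) ?Q G plane f"
        unfolding sub by (rule parallel_cong[OF m1]) (auto simp: G_def)
      show "parallel (subtopology (top_of_set E) K2) ?Q G plane f"
        unfolding sub by (rule parallel_cong[OF m2]) (auto simp: G_def agree)
    qed
    have "parallel (top_of_set E) ?Y \<kappa> ?Q G"
      by (rule parallel_trans[OF flatY flat_plane Q parallel_subset[OF \<kappa>(4) EB] parallel_sym[OF G]])
    moreover have "continuous_map (subtopology (surface_top ?Y) (\<kappa> ` E)) (top_of_set E) k"
    proof -
      have "continuous_map (surface_top ?Y) (top_of_set B) k" using k by (simp add: homeomorphic_maps_def)
      then have "continuous_map (subtopology (surface_top ?Y) (\<kappa> ` E)) euclidean k"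
        using continuous_map_into_fulltopology continuous_map_from_subtopology by blast
      then show ?thesis using k\<kappa> by (auto simp: continuous_map_in_subtopology)
    qed
    ultimately have "parallel (subtopology (surface_top ?Y) (\<kappa> ` E)) ?Y (\<kappa> \<circ> k) ?Q (G \<circ> k)"
      by (rule parallel_compose)
    then have "parallel (subtopology (surface_top ?Y) (\<kappa> ` E)) ?Y id ?Q (restrict (G \<circ> k) (\<kappa> ` E))"
      by (rule parallel_cong) (auto simp: k\<kappa>)
    moreover have "restrict (G \<circ> k) (\<kappa> ` E) (basepoint ?Y) = basepoint ?Q"
      using k\<kappa>[OF inE(1)] inE(1) by (simp add: \<kappa>(2) G_def inK(1) j1_base base_eq(1))
    ultimately have "immersion ?Y (\<kappa> ` E) ?Q (points ?Q) (restrict (G \<circ> k) (\<kappa> ` E))"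
      by (intro immersion_if_parallel[OF flatY \<kappa>(3) disk(3)]) simp_all
    moreover have "basepoint ?Q = restrict (G \<circ> k) (\<kappa> ` E) (\<kappa> 2)"
      using k\<kappa>[OF inE(2)] inE(2) j2_end[of 2] by (simp add: G_def inK(5) base_eq(2))
    then have "basepoint ?Q \<in> restrict (G \<circ> k) (\<kappa> ` E) ` \<kappa> ` N" using N(3) by blast
    ultimately show ?thesis using S0 unfolding moduli_plus_def by blast
  qed
  have near: "iU u \<in> iD ` V"
    if S: "S \<in> moduli_plus X (\<kappa> ` E) (\<kappa> ` N)" and u: "u \<in> (\<lambda>w. e1 (0, w)) ` M0"
      and iU: "immersion ?P U (fiber S) (points (fiber S)) iU" and iD: "immersion ?P' D (fiber S) (points (fiber S)) iD"
    for S iU iD u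
  proof -
    let ?Q = "fiber S"
    have SM: "S \<in> \<M>" using S by (simp add: moduli_plus_def)
    note Q = flat_fiber[OF SM]
    obtain \<iota> where \<iota>: "immersion ?Y (\<kappa> ` E) ?Q (points ?Q) \<iota>" "basepoint ?Q \<in> \<iota> ` \<kappa> ` N"
      using S by (auto simp: moduli_plus_def)
    then obtain z1 where z1: "z1 \<in> N" "\<iota> (\<kappa> z1) = basepoint ?Q" by auto
    \<comment> \<open>The displacement of the point \<open>z1\<close> over the basepoint from the end 2 of the loop.\<close>
    define w0 where "w0 = f z1 - f 2"
    have w0: "norm w0 < \<rho>" "norm w0 < r / 2" using z1(1) \<rho>(2) by (auto simp: N_def w0_def)
    have H: "parallel (top_of_set E) ?Q (\<iota> \<circ> \<kappa>) plane f"
      by (rule immersion_compose_parallel[OF flatY Q flat_plane \<iota>(1) parallel_subset[OF \<kappa>(4) EB]]) auto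
    have "(\<iota> \<circ> \<kappa>) 0 = (iU \<circ> j1) 0"
    proof (rule parallel_unique[OF Q flat_plane _ _ conn(1), where l = "-1"])
      show "parallel (top_of_set K1) ?Q (\<iota> \<circ> \<kappa>) plane f" by (rule parallel_subset[OF H]) (simp add: K1_def)
      show "parallel (top_of_set K1) ?Q (iU \<circ> j1) plane f"
        by (rule immersion_compose_parallel[OF flat Q flat_plane iU j1(1)]) (use j1(2) in auto)
      show "(\<iota> \<circ> \<kappa>) (-1) = (iU \<circ> j1) (-1)" using \<iota>(1) iU \<kappa>(2) j1_base by (simp add: immersion_def)
    qed (use inK in simp_all)
    moreover have "(\<iota> \<circ> \<kappa>) 0 = (iD \<circ> j2 w0) 0"
    proof (rule parallel_unique[OF Q flat_plane _ _ conn(2), where l = z1])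
      show "parallel (top_of_set K2) ?Q (\<iota> \<circ> \<kappa>) plane f" by (rule parallel_subset[OF H]) (simp add: K2_def)
      show "parallel (top_of_set K2) ?Q (iD \<circ> j2 w0) plane f"
        by (rule immersion_compose_parallel[OF flat' Q flat_plane iD j2(1)[OF w0(2)]]) (use j2(2)[OF w0(2)] in auto)
      have "1 < Re z1" using z1(1) by (simp add: N_def)
      then show "(\<iota> \<circ> \<kappa>) z1 = (iD \<circ> j2 w0) z1" using z1(2) iD j2_end[of z1] by (simp add: immersion_def w0_def)
      show "z1 \<in> topspace (top_of_set K2)" using z1(1) N(2) h(1) by (auto simp: K2_def N_def)
    qed (use inK in simp_all)
    ultimately have at0: "iU (e1 (0, f 0)) = iD (e2 (0, f 0 - w0))" by (simp add: j_0)
    obtain w where w: "w \<in> M0" "u = e1 (0, w)" using u by blast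
    have wr: "norm w < \<rho>" using w(1) M0(3) by auto
    then have "iU u = iD (e2 (0, w - w0))"
      using transfer[OF Q iU iD w0(2) f0 at0, of w] \<rho>(2) w(2) by simp
    moreover have "e2 (0, w - w0) \<in> V"
      using norm_triangle_ineq4[of w w0] w0(1) wr by (intro \<rho>(3)) linarith
    ultimately show ?thesis by blast
  qed
  have \<kappa>N: "openin (surface_top ?Y) (\<kappa> ` N)" "\<kappa> ` N \<subseteq> surface_top ?Y interior_of (\<kappa> ` E)"
    using disk(2)[OF N(1,2)] by auto
  have u0M: "u0 \<in> (\<lambda>w. e1 (0, w)) ` M0" using M0(2) e1_path[of 0] \<alpha>(3) by force
  show thesis
  proof (rule that[OF X disk(1) \<kappa>N S0_plus M0(4) u0M])
    fix S iU iD u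
    assume *: "S \<in> moduli_plus X (\<kappa> ` E) (\<kappa> ` N)" "u \<in> (\<lambda>w. e1 (0, w)) ` M0"
      "immersion ?P U (fiber S) (points (fiber S)) iU" "immersion ?P' D (fiber S) (points (fiber S)) iD"
    show "iU u \<in> iD ` V" by (rule near[OF *])
  qed
qed

theorem proposition9:
  fixes T :: moduli_point and U :: "universal_point set"
  assumes "T \<in> \<M>"
    and "open_disk (fiber T) U"
  shows "continuous_map
    (prod_topology (subtopology moduli_topology (moduli_immersed T U))
                   (subtopology (surface_top (fiber T)) U))
    universal_topology
    (\<lambda>(S, u). the_immersion (fiber T) U (fiber S) (points (fiber S)) u)"
proof -
  let ?P = "fiber T" and ?I = "moduli_immersed T U"
  let ?M = "subtopology moduli_topology ?I" and ?U = "subtopology (surface_top (fiber T)) U"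
  let ?f = "\<lambda>(S, u). the_immersion (fiber T) U (fiber S) (points (fiber S)) u"
  note T = assms(1) and U = assms(2)
  note flat = flat_fiber[OF T]
  have Uopen: "openin (surface_top ?P) U" by (rule open_disk_openin[OF flat U])
  have UP: "U \<subseteq> points ?P" using Uopen by (rule openin_subset)
  have Mopen: "openin moduli_topology \<M>"
    unfolding moduli_topology_def by (rule topology_generated_by_Basis) blast
  have imm: "immersion ?P U (fiber S) (points (fiber S)) (the_immersion ?P U (fiber S) (points (fiber S)))"
    if S: "S \<in> ?I" for S
  proof -
    have SM: "S \<in> \<M>" using S by (simp add: moduli_immersed_def)
    obtain \<iota> where \<iota>: "immersion ?P U (fiber S) (points (fiber S)) \<iota>"
      using S by (auto simp: moduli_immersed_def immerses_def)
    then show ?thesis using the_immersion_eq[OF flat flat_fiber[OF SM] \<iota>] by simp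
  qed
  have val: "?f (S, u) \<in> points (fiber S)" "?f (S, u) \<in> \<E>" "proj (?f (S, u)) = S"
    if S: "S \<in> ?I" and u: "u \<in> U" for S u
  proof -
    have SM: "S \<in> \<M>" using S by (simp add: moduli_immersed_def)
    have "continuous_map (subtopology (surface_top ?P) U) (surface_top (fiber S)) (the_immersion ?P U (fiber S) (points (fiber S)))"
      using imm[OF S] by (simp add: immersion_def)
    then show *: "?f (S, u) \<in> points (fiber S)"
      using u UP by (auto simp: continuous_map_def)
    show "?f (S, u) \<in> \<E>" "proj (?f (S, u)) = S" using points_fiber[OF SM *] .
  qed
  have tops: "topspace ?U = U" "topspace ?M \<subseteq> ?I" using UP by auto
  have dom: "S \<in> ?I" "u \<in> U" if "(S, u) \<in> topspace (prod_topology ?M ?U)" for S u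
    using that tops by auto
  have openM: "openin ?M (topspace ?M \<inter> W)" if W: "openin moduli_topology W" for W
  proof -
    have "topspace ?M \<inter> W = ?I \<inter> W" using openin_subset[OF W] by auto
    then show ?thesis using openin_subtopology_Int2[OF W] by simp
  qed
  \<comment> \<open>Over the subbasic sets that come from \<open>\<M>\<close> the map forgets \<open>u\<close>.\<close>
  have base: "openin (prod_topology ?M ?U) (?f -` {s \<in> \<E>. proj s \<in> W} \<inter> topspace (prod_topology ?M ?U))"
    if W: "openin moduli_topology W" for W
  proof -
    have "?f -` {s \<in> \<E>. proj s \<in> W} \<inter> topspace (prod_topology ?M ?U) = (topspace ?M \<inter> W) \<times> U"
      using val dom tops by (auto simp del: topspace_subtopology)
    moreover have "openin ?M (topspace ?M \<inter> W)" by (rule openM[OF W])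
    moreover have "openin ?U U" using UP by (simp add: openin_subtopology_refl)
    ultimately show ?thesis by (simp add: openin_prod_Times_iff)
  qed
  have plus: "openin (prod_topology ?M ?U) (?f -` universal_plus T' D V \<inter> topspace (prod_topology ?M ?U))"
    if T': "T' \<in> \<M>" and D: "closed_disk (fiber T') D" and V: "openin (surface_top (fiber T')) V"
      "V \<subseteq> surface_top (fiber T') interior_of D" for T' D V
  proof (subst openin_subopen, intro ballI)
    fix p assume p: "p \<in> ?f -` universal_plus T' D V \<inter> topspace (prod_topology ?M ?U)"
    obtain S0 u0 where p_eq: "p = (S0, u0)" by (cases p)
    have top0: "(S0, u0) \<in> topspace (prod_topology ?M ?U)" using p unfolding p_eq by (rule IntD2)
    note S0 = dom[OF top0]
    have S0M: "S0 \<in> \<M>" using S0(1) by (simp add: moduli_immersed_def)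
    let ?\<iota>0 = "the_immersion ?P U (fiber S0) (points (fiber S0))"
    have "(S0, u0) \<in> ?f -` universal_plus T' D V" using p unfolding p_eq by (rule IntD1)
    then have "?f (S0, u0) \<in> universal_plus T' D V" by (rule vimageD)
    then obtain iD0 where iD0: "immersion (fiber T') D (fiber S0) (points (fiber S0)) iD0" "?\<iota>0 u0 \<in> iD0 ` V"
      using val(3)[OF S0] by (auto simp: universal_plus_def)
    then obtain d0 where d0: "d0 \<in> V" "?\<iota>0 u0 = iD0 d0" by blast
    obtain X K N M where X: "X \<in> \<M>" "closed_disk (fiber X) K" "openin (surface_top (fiber X)) N"
      "N \<subseteq> surface_top (fiber X) interior_of K" "S0 \<in> moduli_plus X K N"
      "openin (surface_top ?P) M" "u0 \<in> M"
      and near: "\<And>S iU iD u. S \<in> moduli_plus X K N \<Longrightarrow> u \<in> M \<Longrightarrow>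
        immersion ?P U (fiber S) (points (fiber S)) iU \<Longrightarrow>
        immersion (fiber T') D (fiber S) (points (fiber S)) iD \<Longrightarrow> iU u \<in> iD ` V"
      by (rule universal_plus_neighbourhood[OF T U T' D V S0M imm[OF S0(1)] iD0(1) S0(2) d0]) (rule that)
    define W where "W = moduli_plus X K N \<inter> moduli_immersed T' D"
    have "openin moduli_topology (moduli_plus X K N)" "openin moduli_topology (moduli_immersed T' D)"
      unfolding moduli_topology_def using X(1-4) T' D
      by (intro topology_generated_by_Basis; blast)+
    then have "openin moduli_topology W" unfolding W_def by (rule openin_Int)
    then have "openin ?M (topspace ?M \<inter> W)" by (rule openM)
    moreover have "openin ?U (U \<inter> M)" using X(6) by (simp add: openin_subtopology_Int2)
    ultimately have op: "openin (prod_topology ?M ?U) ((topspace ?M \<inter> W) \<times> (U \<inter> M))"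
      by (simp add: openin_prod_Times_iff)
    have "S0 \<in> moduli_immersed T' D" using S0M iD0(1) by (auto simp: moduli_immersed_def immerses_def)
    then have "p \<in> (topspace ?M \<inter> W) \<times> (U \<inter> M)"
      using p_eq top0 X(5,7) S0(2) by (simp add: W_def)
    moreover have "(topspace ?M \<inter> W) \<times> (U \<inter> M) \<subseteq> ?f -` universal_plus T' D V \<inter> topspace (prod_topology ?M ?U)"
    proof
      fix q assume q: "q \<in> (topspace ?M \<inter> W) \<times> (U \<inter> M)"
      obtain S u where q_eq: "q = (S, u)" by (cases q)
      have S: "S \<in> ?I" "S \<in> W" "u \<in> U" "u \<in> M" and top: "q \<in> topspace (prod_topology ?M ?U)"
        using q q_eq tops by auto
      obtain iD where iD: "immersion (fiber T') D (fiber S) (points (fiber S)) iD"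
        using S(2) by (auto simp: W_def moduli_immersed_def immerses_def)
      have "?f (S, u) \<in> iD ` V"
        using near[OF _ S(4) imm[OF S(1)] iD] S(2) by (simp add: W_def)
      then have "?f (S, u) \<in> universal_plus T' D V"
        using val[OF S(1,3)] iD unfolding universal_plus_def by auto
      then show "q \<in> ?f -` universal_plus T' D V \<inter> topspace (prod_topology ?M ?U)"
        using top unfolding q_eq by (intro IntI vimageI2)
    qed
    ultimately show "\<exists>O'. openin (prod_topology ?M ?U) O' \<and> p \<in> O' \<and> O' \<subseteq> ?f -` universal_plus T' D V \<inter> topspace (prod_topology ?M ?U)"
      using op by blast
  qed
  show ?thesis
    unfolding universal_topology_def continuous_on_generated_topo_iff
  proof (intro conjI allI impI)
    fix A assume "A \<in> {{s \<in> \<E>. proj s \<in> W} | W. openin moduli_topology W} \<union>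
     {universal_plus T D U | T D U. T \<in> \<M> \<and> closed_disk (fiber T) D \<and>
        openin (surface_top (fiber T)) U \<and> U \<subseteq> surface_top (fiber T) interior_of D}"
    then show "openin (prod_topology ?M ?U) (?f -` A \<inter> topspace (prod_topology ?M ?U))"
      using base plus by blast
  next
    have "?f p \<in> {s \<in> \<E>. proj s \<in> \<M>}" if p: "p \<in> topspace (prod_topology ?M ?U)" for p
    proof -
      obtain S u where "p = (S, u)" by (cases p)
      then show ?thesis using val dom[of S u] p by (auto simp: moduli_immersed_def)
    qed
    then show "?f ` topspace (prod_topology ?M ?U) \<subseteq> \<Union> ({{s \<in> \<E>. proj s \<in> W} | W. openin moduli_topology W} \<union>
     {universal_plus T D U | T D U. T \<in> \<M> \<and> closed_disk (fiber T) D \<and>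
        openin (surface_top (fiber T)) U \<and> U \<subseteq> surface_top (fiber T) interior_of D})"
      using Mopen by blast
  qed
qed

end
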